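(* Let $d\geq 1$, $1<p\leq 2<q<\infty$, $1\leq\theta\leq\infty$. Then, for $m\in\mathbb{N}$, $$ e_m(B^{r}_{p,\theta})_{B_{q,1}}\asymp \begin{cases} m^{-\frac{q}{2}\left(\frac{r}{d}-\frac{1}{p}+\frac{1}{q}\right)}, & d\left(\frac{1}{p}-\frac{1}{q}\right)<r<\frac{d}{p},\\[2mm] m^{-\frac{r}{d}+\frac{1}{p}-\frac{1}{2}}, & r>\frac{d}{p}. \end{cases} $$
   Context: $\mathbb{T}^d=[0,2\pi)^d$; $L_p(\mathbb{T}^d)$ is the space of functions $2\pi$-periodic in each variable with norm $\|f\|_p=\big((2\pi)^{-d}\int_{\mathbb{T}^d}|f|^p\big)^{1/p}$ ($1\le p<\infty$), $\|f\|_\infty=\operatorname{ess\,sup}|f|$. For $\boldsymbol h\in\mathbb{R}^d$, $\Delta_{\boldsymbol h}f(\boldsymbol x)=f(\boldsymbol x+\boldsymbol h)-f(\boldsymbol x)$, $\Delta^k_{\boldsymbol h}=\Delta_{\boldsymbol h}\Delta^{k-1}_{\boldsymbol h}$, and $\omega_k(f,t)_p=\sup_{|\boldsymbol h|\le t}\|\Delta^k_{\boldsymbol h}f\|_p$ (Euclidean $|\boldsymbol h|$). For $r>0$, $1\le p,\theta\le\infty$ and a fixed integer $k>r$, the Nikol'skii–Besov space $B^r_{p,\theta}$ consists of $f\in L_p(\mathbb{T}^d)$ with finite norm $\|f\|_{B^r_{p,\theta}}=\|f\|_p+\big(\int_0^\infty (t^{-r}\omega_k(f,t)_p)^\theta\,\frac{dt}{t}\big)^{1/\theta}$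 for $\theta<\infty$, and $\|f\|_p+\sup_{t>0}t^{-r}\omega_k(f,t)_p$ for $\theta=\infty$; the class $B^r_{p,\theta}$ denotes its unit ball $\{f:\|f\|_{B^r_{p,\theta}}\le1\}$. Let $V_l(t)=l^{-1}\sum_{k=l}^{2l-1}D_k(t)$ with $D_k(t)=\sum_{|j|\le k}e^{ijt}$ be the de la Vallée-Poussin kernel, $V_l(\boldsymbol x)=\prod_{j=1}^dV_l(x_j)$, $V_l(f)=f*V_l$. Set $\sigma_0(f)=V_1(f)$ and $\sigma_s(f)=V_{2^s}(f)-V_{2^{s-1}}(f)$ for $s\in\mathbb{N}$. For $1\le q\le\infty$, $B_{q,1}$ is the space of $f\in L_q(\mathbb{T}^d)$ with $\|f\|_{B_{q,1}}:=\sum_{s\ge0}\|\sigma_s(f)\|_q<\infty$. For a normed space $\mathcal X$ of functions and $f\in\mathcal X$, the best $m$-term trigonometric approximation is $e_m(f)_{\mathcal X}=\inf_{\Theta_m}\inf_{c_{\boldsymbol k}}\|f-\sum_{\boldsymbol k\in\Theta_m}c_{\boldsymbol k}e^{i(\boldsymbol k,\boldsymbol x)}\|_{\mathcal X}$, where $\Theta_m$ ranges over sets of $m$ vectors in $\mathbb{Z}^d$ and $c_{\boldsymbol k}\in\mathbb{C}$; for a class $F$, $e_m(F)_{\mathcal X}=\sup_{f\in F}e_m(f)_{\mathcal X}$. The notation $a(m)\asymp b(m)$ means there are constants $0<C_1<C_2$ independent of $m$ (depending possibly on the other parameters) with $C_1a(m)\le b(m)\le C_2a(m)$ for all $m\in\mathbb{N}$.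 *)

theory Defs
  imports "HOL-Analysis.Analysis"
begin

text \<open>The torus is represented by the fundamental domain [0,2pi)^d inside real^'d,
  where the dimension d = CARD('d) is encoded as a finite index type.\<close>

definition torus :: "(real^'d) set" where
  "torus = {x. \<forall>i. 0 \<le> x$i \<and> x$i < 2*pi}"

definition periodic_fun :: "(real^'d \<Rightarrow> complex) \<Rightarrow> bool" where
  "periodic_fun f \<longleftrightarrow> (\<forall>x i. f (x + (2*pi) *\<^sub>R axis i 1) = f x)"

definition in_Lp :: "real \<Rightarrow> (real^'d \<Rightarrow> complex) \<Rightarrow> bool" where
  "in_Lp p f \<longleftrightarrow> periodic_fun f \<and> f \<in> borel_measurable lebesgue \<and>
     set_integrable lebesgue torus (\<lambda>x. norm (f x) powr p)"

definition Lp_norm :: "real \<Rightarrow> (real^'d \<Rightarrow> complex) \<Rightarrow> real" where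
  "Lp_norm p f = ((1 / (2*pi) ^ CARD('d)) *
      (LINT x:torus|lebesgue. norm (f x) powr p)) powr (1/p)"

definition fdiff1 :: "real^'d \<Rightarrow> (real^'d \<Rightarrow> complex) \<Rightarrow> (real^'d \<Rightarrow> complex)" where
  "fdiff1 h f = (\<lambda>x. f (x + h) - f x)"

primrec fdiff :: "real^'d \<Rightarrow> nat \<Rightarrow> (real^'d \<Rightarrow> complex) \<Rightarrow> (real^'d \<Rightarrow> complex)" where
  "fdiff h 0 f = f"
| "fdiff h (Suc k) f = fdiff1 h (fdiff h k f)"

definition modulus :: "nat \<Rightarrow> real \<Rightarrow> (real^'d \<Rightarrow> complex) \<Rightarrow> real \<Rightarrow> real" where
  "modulus k p f t = (SUP h\<in>{h. norm h \<le> t}. Lp_norm p (fdiff h k f))"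

definition enn_powr :: "ennreal \<Rightarrow> real \<Rightarrow> ennreal" where
  "enn_powr x a = (if x = \<infinity> then \<infinity> else ennreal (enn2real x powr a))"

text \<open>Besov seminorm (with fixed integer k > r) and the unit ball B^r_{p,theta}.
  theta is an extended real; theta = infinity gives the sup-version.\<close>

definition besov_semi :: "nat \<Rightarrow> real \<Rightarrow> real \<Rightarrow> ereal \<Rightarrow> (real^'d \<Rightarrow> complex) \<Rightarrow> ennreal" where
  "besov_semi k r p \<theta> f =
    (if \<theta> = \<infinity> then (SUP t\<in>{0<..}. ennreal (t powr (-r) * modulus k p f t))
     else enn_powr
       (set_nn_integral lborel {0<..}
          (\<lambda>t. ennreal ((t powr (-r) * modulus k p f t) powr (real_of_ereal \<theta>) / t)))
       (1 / real_of_ereal \<theta>))"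

definition besov_norm :: "nat \<Rightarrow> real \<Rightarrow> real \<Rightarrow> ereal \<Rightarrow> (real^'d \<Rightarrow> complex) \<Rightarrow> ennreal" where
  "besov_norm k r p \<theta> f = ennreal (Lp_norm p f) + besov_semi k r p \<theta> f"

definition besov_ball :: "nat \<Rightarrow> real \<Rightarrow> real \<Rightarrow> ereal \<Rightarrow> (real^'d \<Rightarrow> complex) set" where
  "besov_ball k r p \<theta> = {f. in_Lp p f \<and> besov_norm k r p \<theta> f \<le> 1}"

definition dirichlet :: "nat \<Rightarrow> real \<Rightarrow> complex" where
  "dirichlet k t = (\<Sum>j\<in>{-int k..int k}. exp (\<i> * of_real (of_int j * t)))"

definition vp1 :: "nat \<Rightarrow> real \<Rightarrow> complex" where
  "vp1 l t = (1 / of_nat l) * (\<Sum>k\<in>{l..2*l-1}. dirichlet k t)"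

definition vp :: "nat \<Rightarrow> real^'d \<Rightarrow> complex" where
  "vp l x = (\<Prod>j\<in>UNIV. vp1 l (x$j))"

definition tconv :: "(real^'d \<Rightarrow> complex) \<Rightarrow> (real^'d \<Rightarrow> complex) \<Rightarrow> (real^'d \<Rightarrow> complex)" where
  "tconv f g = (\<lambda>x. (1 / of_real ((2*pi) ^ CARD('d))) *
      (CLINT y:torus|lebesgue. f (x - y) * g y))"

definition vp_op :: "nat \<Rightarrow> (real^'d \<Rightarrow> complex) \<Rightarrow> (real^'d \<Rightarrow> complex)" where
  "vp_op l f = tconv f (vp l)"

definition sigma_block :: "nat \<Rightarrow> (real^'d \<Rightarrow> complex) \<Rightarrow> (real^'d \<Rightarrow> complex)" where
  "sigma_block s f = (if s = 0 then vp_op 1 f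
      else (\<lambda>x. vp_op (2^s) f x - vp_op (2^(s-1)) f x))"

definition Bq1_norm :: "real \<Rightarrow> (real^'d \<Rightarrow> complex) \<Rightarrow> ennreal" where
  "Bq1_norm q f = (if in_Lp q f then (\<Sum>s. ennreal (Lp_norm q (sigma_block s f))) else \<infinity>)"

definition trig_poly :: "(int^'d) set \<Rightarrow> (int^'d \<Rightarrow> complex) \<Rightarrow> (real^'d \<Rightarrow> complex)" where
  "trig_poly \<Theta> c = (\<lambda>x. \<Sum>k\<in>\<Theta>. c k * exp (\<i> * of_real (\<Sum>j\<in>UNIV. of_int (k$j) * x$j)))"

definition best_mterm_Bq1 :: "real \<Rightarrow> nat \<Rightarrow> (real^'d \<Rightarrow> complex) \<Rightarrow> ennreal" where
  "best_mterm_Bq1 q m f =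
     (INF \<Theta>\<in>{\<Theta>::(int^'d) set. finite \<Theta> \<and> card \<Theta> = m}.
        INF c\<in>(UNIV :: (int^'d \<Rightarrow> complex) set).
          Bq1_norm q (\<lambda>x. f x - trig_poly \<Theta> c x))"

definition best_mterm_class_Bq1 :: "real \<Rightarrow> nat \<Rightarrow> (real^'d \<Rightarrow> complex) set \<Rightarrow> ennreal" where
  "best_mterm_class_Bq1 q m F = (SUP f\<in>F. best_mterm_Bq1 q m f)"

definition asymp_equiv_nat :: "(nat \<Rightarrow> real) \<Rightarrow> (nat \<Rightarrow> ennreal) \<Rightarrow> bool" where
  "asymp_equiv_nat a b \<longleftrightarrow> (\<exists>C1 C2. 0 < C1 \<and> C1 < C2 \<and>
     (\<forall>m\<ge>1. ennreal (C1 * a m) \<le> b m \<and> b m \<le> ennreal (C2 * a m)))"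

end

theory Submission
  imports Defs
begin

text \<open>
  A function in the Besov ball satisfies \<open>\<parallel>\<sigma>\<^sub>s f\<parallel>\<^sub>p \<le> C 2\<^bsup>-rs\<^esup>\<close> by Jackson's inequality. For the upper bound keep all blocks
  with \<open>2\<^bsup>sd\<^esup> \<le> m\<close>, drop those with \<open>2\<^bsup>sd\<^esup> > m\<^bsup>q/2\<^esup>\<close>, which Nikol'skii's inequality shows to be small in \<open>L\<^sub>q\<close>, and replace
  each block in between by an \<open>N\<close>-term approximant with error at most \<open>C N\<^bsup>-1/2\<^esup>\<close> times the sum of the moduli of its
  coefficients. Such approximants exist in every \<open>L\<^sub>q\<close> with \<open>q < \<infinity>\<close>: the terms are selected greedily such that an
  integral \<open>\<integral> (1 + |R|\<^sup>2)\<^sup>n\<close> of the accumulated error \<open>R\<close> stays of order \<open>N\<^sup>n\<close> after \<open>N\<close> steps. Budgets \<open>N\<close> decaying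
  geometrically away from the end of the middle range that dominates the error keep the total number of terms
  of order \<open>m\<close> and make the sum of the errors geometric.

  For the lower bound take a multiple of the de la Vallee-Poussin kernel of order \<open>n\<close>, with \<open>n\<^sup>d\<close> of order \<open>m\<^bsup>q/2\<^esup>\<close> if \<open>r < d/p\<close>
  and of order \<open>m\<close> if \<open>r > d/p\<close>, and test the error against the same kernel with the frequencies of the approximant
  removed; the \<open>L\<^sub>q\<^sub>'\<close> norm of this test function is of order \<open>m\<^bsup>1/2\<^esup>\<close>, where \<open>1/q + 1/q' = 1\<close>.
\<close>

section \<open>The torus and its translation-invariant measure\<close>

text \<open>The exponent changes at \<open>r = d/p\<close> because the moduli of the coefficients of
  the block of index s sum to at most C 2^(-(r - d/p)s): spending a fixed number of terms on a block
  is worst for large s below this value of r and for small s above it. The size m^(q/2) reflects a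
  balance in the duality argument: the L_q' norm of the kernel of order n is at most of order
  n^(d/q), which stays below m^(1/2) as long as n^d is at most m^(q/2). One argument serves every
  \<theta>: membership in the ball always gives differences of size C |h|^r in L_p, and the Besov
  norm of a polynomial of degree n is at most a constant times n^r times its L_p norm, uniformly in
  \<theta>. Sparse approximants must be good in B_{q,1} and not just in L_q; this is harmless since
  a block operator sees only the errors of neighbouring blocks. Functions in the ball are merely
  Lebesgue measurable, whereas Fubini's theorem is applied to Borel functions; so the analysis is
  done for Borel periodic representatives and transferred afterwards.\<close>

definition lat :: "int^'d \<Rightarrow> real^'d" where
  "lat k = (\<chi> i. 2 * pi * of_int (k$i))"

text \<open>The representative of \<open>x\<close> in \<open>torus\<close> modulo the lattice.
  Periodic functions factor through it, so translation invariance of their integrals becomes an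
  identity between image measures.\<close>

definition wrap :: "real^'d \<Rightarrow> real^'d" where
  "wrap x = x - lat (\<chi> i. \<lfloor>x$i / (2*pi)\<rfloor>)"

text \<open>Normalised Lebesgue measure of the torus, carried by the whole space and restricted to
  Borel sets: products of it are products of Borel spaces, and total mass 1 makes
  \<open>Lp_le\<close> monotone in the exponent.\<close>

definition tm :: "(real^'d) measure" where
  "tm = density lborel (\<lambda>x. ennreal (indicator torus x / (2*pi) ^ CARD('d)))"

lemma periodic_fun_lat:
  fixes f :: "real^'d \<Rightarrow> complex"
  assumes "periodic_fun f"
  shows "f (x + lat k) = f x"
proof -
  have nat: "f (y + (2*pi*real n) *\<^sub>R axis i 1) = f y" for y i n
  proof (induction n)
    case (Suc n)
    have "f (y + (2*pi*real (Suc n)) *\<^sub>R axis i 1)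
        = f ((y + (2*pi*real n) *\<^sub>R axis i 1) + (2*pi) *\<^sub>R axis i 1)"
      by (simp add: algebra_simps)
    with Suc assms show ?case by (simp add: periodic_fun_def)
  qed simp
  have int: "f (y + (2*pi* of_int n) *\<^sub>R axis i 1) = f y" for y i n
  proof (cases "n \<ge> 0")
    case True
    with nat[of y "nat n" i] show ?thesis by simp
  next
    case False
    with nat[of "y + (2*pi* of_int n) *\<^sub>R axis i 1" "nat (-n)" i] show ?thesis
      by (simp add: algebra_simps)
  qed
  have "f (x + (\<Sum>i\<in>I. (2*pi* of_int (k$i)) *\<^sub>R axis i 1)) = f x" if "finite I" for I
    using that
  proof induction
    case (insert a F)
    have "f (x + (\<Sum>i\<in>insert a F. (2*pi* of_int (k$i)) *\<^sub>R axis i 1))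
      = f ((x + (\<Sum>i\<in>F. (2*pi* of_int (k$i)) *\<^sub>R axis i 1)) + (2*pi* of_int (k$a)) *\<^sub>R axis a 1)"
      using insert.hyps by (simp add: algebra_simps)
    with int insert.IH show ?case by simp
  qed simp
  from this[of UNIV] have "f (x + (\<Sum>i\<in>UNIV. (2*pi* of_int (k$i)) *\<^sub>R axis i 1)) = f x"
    by simp
  moreover have "(\<Sum>i\<in>UNIV. (2*pi* of_int (k$i)) *\<^sub>R axis i 1) = lat k"
    by (simp add: vec_eq_iff lat_def axis_def if_distrib cong: if_cong)
  ultimately show ?thesis by simp
qed

lemma periodic_fun_wrap:
  assumes "periodic_fun f"
  shows "f (wrap x) = f x"
  using periodic_fun_lat[OF assms, of "wrap x" "\<chi> i. \<lfloor>x$i / (2*pi)\<rfloor>"]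
  by (simp add: wrap_def)

text \<open>Half-openness of \<open>torus\<close> makes the lattice vector unique; this is what
  makes the pieces in \<open>distr_tm_wrap_translate\<close> disjoint.\<close>

lemma torus_shift_iff:
  fixes x :: "real^'d"
  shows "x - lat k \<in> torus \<longleftrightarrow> k = (\<chi> i. \<lfloor>x$i / (2*pi)\<rfloor>)"
proof -
  have "(0 \<le> x$i - 2*pi* of_int (k$i) \<and> x$i - 2*pi* of_int (k$i) < 2*pi) \<longleftrightarrow> \<lfloor>x$i / (2*pi)\<rfloor> = k$i" for i
    by (simp add: floor_eq_iff field_simps)
  then show ?thesis
    by (auto simp: torus_def lat_def vec_eq_iff)
qed

lemma wrap_in_torus: "wrap x \<in> torus"
  using torus_shift_iff[of x "\<chi> i. \<lfloor>x$i / (2*pi)\<rfloor>"] by (simp add: wrap_def)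

lemma torus_borel [measurable]: "torus \<in> sets borel"
proof -
  have "torus = (\<Inter>i. {x::real^'d. 0 \<le> x$i} \<inter> {x. x$i < 2*pi})"
    by (auto simp: torus_def)
  also have "\<dots> \<in> sets borel"
    by (intro sets.finite_INT sets.Int borel_closed borel_open closed_halfspace_component_ge_cart
        open_halfspace_component_lt_cart) auto
  finally show ?thesis .
qed

lemma emeasure_torus: "emeasure lborel (torus :: (real^'d) set) = ennreal ((2*pi) ^ CARD('d))"
proof (rule antisym)
  let ?b = "(\<chi> i. 2*pi) :: real^'d"
  have b: "?b \<bullet> u = 2*pi" if "u \<in> Basis" for u
    using that by (auto simp: Basis_vec_def inner_axis)
  have "torus \<subseteq> cbox 0 ?b" by (auto simp: torus_def mem_box_cart less_imp_le)
  then have "emeasure lborel (torus :: (real^'d) set) \<le> emeasure lborel (cbox 0 ?b)"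
    by (intro emeasure_mono) auto
  also have "\<dots> = ennreal ((2*pi) ^ CARD('d))"
    by (subst emeasure_lborel_cbox) (auto simp: b)
  finally show "emeasure lborel (torus :: (real^'d) set) \<le> ennreal ((2*pi) ^ CARD('d))" .
  have "box 0 ?b \<subseteq> torus" by (auto simp: torus_def mem_box_cart less_imp_le)
  then have "emeasure lborel (box 0 ?b) \<le> emeasure lborel (torus :: (real^'d) set)"
    by (intro emeasure_mono) auto
  also have "emeasure lborel (box 0 ?b) = ennreal ((2*pi) ^ CARD('d))"
    by (subst emeasure_lborel_box) (auto simp: b)
  finally show "ennreal ((2*pi) ^ CARD('d)) \<le> emeasure lborel (torus :: (real^'d) set)" .
qed

lemma sets_tm [simp, measurable_cong]: "sets tm = sets borel"
  by (simp add: tm_def)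

lemma space_tm [simp]: "space tm = UNIV"
  by (simp add: tm_def)

lemma emeasure_tm:
  fixes B :: "(real^'d) set"
  assumes [measurable]: "B \<in> sets borel"
  shows "emeasure tm B = emeasure lborel (B \<inter> torus) / ennreal ((2*pi) ^ CARD('d))"
proof -
  have "emeasure tm B = (\<integral>\<^sup>+x. ennreal (indicator torus x / (2*pi) ^ CARD('d)) * indicator B x \<partial>lborel)"
    unfolding tm_def by (subst emeasure_density) auto
  also have "\<dots> = (\<integral>\<^sup>+x. indicator (B \<inter> torus) x / ennreal ((2*pi) ^ CARD('d)) \<partial>lborel)"
    by (intro nn_integral_cong) (auto simp: indicator_def divide_ennreal simp flip: ennreal_1 ennreal_mult)
  also have "\<dots> = emeasure lborel (B \<inter> torus) / ennreal ((2*pi) ^ CARD('d))"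
    by (subst nn_integral_divide) auto
  finally show ?thesis .
qed

lemma emeasure_tm_UNIV [simp]: "emeasure (tm :: (real^'d) measure) UNIV = 1"
  by (simp add: emeasure_tm emeasure_torus divide_ennreal)

interpretation tm: finite_measure tm
  by standard simp

interpretation tmp: pair_sigma_finite tm tm
  by standard

lemma measure_tm_UNIV [simp]: "measure tm UNIV = 1"
  by (simp add: measure_def)

lemma borel_measurable_vec_nth [measurable]: "(\<lambda>x::real^'d. x $ i) \<in> borel_measurable borel"
  by (intro borel_measurable_continuous_onI continuous_intros)

lemma wrap_measurable [measurable]: "wrap \<in> borel \<rightarrow>\<^sub>M (borel :: (real^'d) measure)"
proof -
  have "(\<lambda>x. wrap x $ i) \<in> borel_measurable borel" for i
    unfolding wrap_def lat_def by simp
  then show ?thesis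
    by (subst borel_measurable_euclidean_space) (auto simp: Basis_vec_def inner_axis)
qed

text \<open>The preimage of a set is cut according to the lattice vector subtracted by
  \<open>wrap\<close>. Each piece is moved by an ordinary translation, which preserves Lebesgue
  measure, and the moved pieces partition the part of the set inside the torus.\<close>

lemma distr_tm_wrap_translate:
  "distr tm borel (\<lambda>x. wrap (x + h)) = (tm :: (real^'d) measure)"
proof (rule measure_eqI)
  fix B :: "(real^'d) set"
  assume "B \<in> sets (distr tm borel (\<lambda>x. wrap (x + h)))"
  then have [measurable]: "B \<in> sets borel" by simp
  let ?X = "\<lambda>k. {y. y \<in> torus \<and> y + h - lat k \<in> B \<inter> torus}"
  let ?Y = "\<lambda>k. {z. z \<in> B \<inter> torus \<and> z + lat k - h \<in> torus}"
  have [measurable]: "?X k \<in> sets borel" "?Y k \<in> sets borel" for k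
    by measurable
  have un1: "(\<lambda>x. wrap (x + h)) -` B \<inter> torus = (\<Union>k. ?X k)"
    using wrap_in_torus by (auto simp: torus_shift_iff wrap_def)
  have un2: "B \<inter> torus = (\<Union>k. ?Y k)"
  proof -
    have "\<exists>k. z + lat k - h \<in> torus" for z :: "real^'d"
    proof -
      have "lat (-k) = - lat k" for k :: "int^'d" by (simp add: lat_def vec_eq_iff)
      with torus_shift_iff[of "z - h" "\<chi> i. \<lfloor>(z-h)$i / (2*pi)\<rfloor>"]
      have "z + lat (- (\<chi> i. \<lfloor>(z-h)$i / (2*pi)\<rfloor>)) - h \<in> torus"
        by (simp add: algebra_simps)
      then show ?thesis by blast
    qed
    then show ?thesis by auto
  qed
  have d1: "disjoint_family ?X"
    by (auto simp: disjoint_family_on_def torus_shift_iff)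
  have d2: "disjoint_family ?Y"
  proof -
    have "k = l" if "z + lat k - h \<in> torus" "z + lat l - h \<in> torus" for k l and z :: "real^'d"
    proof -
      have "lat (-k) = - lat k" for k :: "int^'d" by (simp add: lat_def vec_eq_iff)
      with that torus_shift_iff[of "z - h" "-k"] torus_shift_iff[of "z - h" "-l"]
      have "-k = -l" by (simp add: algebra_simps)
      then show ?thesis by simp
    qed
    then show ?thesis by (auto simp: disjoint_family_on_def)
  qed
  have eq: "emeasure lborel (?X k) = emeasure lborel (?Y k)" for k
  proof -
    have "emeasure lborel (?Y k) = emeasure (distr lborel borel ((+) (h - lat k))) (?Y k)"
      by (simp add: lborel_distr_plus)
    also have "\<dots> = emeasure lborel ((+) (h - lat k) -` ?Y k \<inter> space lborel)"
      by (subst emeasure_distr) auto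
    also have "(+) (h - lat k) -` ?Y k \<inter> space lborel = ?X k"
      by (auto simp: algebra_simps)
    finally show ?thesis by simp
  qed
  have "emeasure lborel ((\<lambda>x. wrap (x + h)) -` B \<inter> torus) = (\<integral>\<^sup>+k. emeasure lborel (?X k) \<partial>count_space UNIV)"
    unfolding un1 by (rule emeasure_UN_countable) (use d1 in auto)
  also have "\<dots> = (\<integral>\<^sup>+k. emeasure lborel (?Y k) \<partial>count_space UNIV)"
    by (simp only: eq)
  also have "\<dots> = emeasure lborel (\<Union>k. ?Y k)"
    by (rule emeasure_UN_countable[symmetric]) (use d2 in auto)
  also have "(\<Union>k. ?Y k) = B \<inter> torus"
    by (rule un2[symmetric])
  finally have *: "emeasure lborel ((\<lambda>x. wrap (x + h)) -` B \<inter> torus) = emeasure lborel (B \<inter> torus)" .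
  have "emeasure (distr tm borel (\<lambda>x. wrap (x + h))) B = emeasure tm ((\<lambda>x. wrap (x + h)) -` B \<inter> space tm)"
    by (rule emeasure_distr) auto
  also have "\<dots> = emeasure tm B"
  proof -
    have m: "(\<lambda>x. wrap (x + h)) -` B \<in> sets borel"
      using measurable_sets[of "\<lambda>x. wrap (x + h)" borel borel B] by simp
    show ?thesis by (simp add: emeasure_tm m *)
  qed
  finally show "emeasure (distr tm borel (\<lambda>x. wrap (x + h))) B = emeasure tm B" .
qed simp

lemma integral_tm_translate:
  fixes f :: "real^'d \<Rightarrow> complex"
  assumes [measurable]: "f \<in> borel_measurable borel" and per: "periodic_fun f"
  shows "(\<integral>x. f (x + h) \<partial>tm) = (\<integral>x. f x \<partial>tm)"
proof -
  have "(\<integral>x. f x \<partial>tm) = (\<integral>x. f x \<partial>distr tm borel (\<lambda>x. wrap (x + h)))"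
    by (simp add: distr_tm_wrap_translate)
  also have "\<dots> = (\<integral>x. f (wrap (x + h)) \<partial>tm)"
    by (rule integral_distr) auto
  finally show ?thesis by (simp add: periodic_fun_wrap[OF per])
qed

lemma nn_integral_tm_translate:
  fixes f :: "real^'d \<Rightarrow> complex" and g :: "complex \<Rightarrow> ennreal"
  assumes [measurable]: "f \<in> borel_measurable borel" "g \<in> borel_measurable borel" and per: "periodic_fun f"
  shows "(\<integral>\<^sup>+x. g (f (x + h)) \<partial>tm) = (\<integral>\<^sup>+x. g (f x) \<partial>tm)"
proof -
  have "(\<integral>\<^sup>+x. g (f x) \<partial>tm) = (\<integral>\<^sup>+x. g (f x) \<partial>distr tm borel (\<lambda>x. wrap (x + h)))"
    by (simp add: distr_tm_wrap_translate)
  also have "\<dots> = (\<integral>\<^sup>+x. g (f (wrap (x + h))) \<partial>tm)"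
    by (rule nn_integral_distr) auto
  finally show ?thesis by (simp add: periodic_fun_wrap[OF per])
qed

section \<open>Bounds on L_p norms\<close>

text \<open>A bound instead of a norm: measurability and finiteness of the integral are part of the
  claim, so estimates can be chained without integrability side conditions.\<close>

definition Lp_le :: "real \<Rightarrow> (real^'d \<Rightarrow> complex) \<Rightarrow> real \<Rightarrow> bool" where
  "Lp_le p f a \<longleftrightarrow> f \<in> borel_measurable borel \<and> 0 \<le> a \<and>
     (\<integral>\<^sup>+x. ennreal (norm (f x) powr p) \<partial>tm) \<le> ennreal (a powr p)"

lemma Lp_le_measurable: "Lp_le p f a \<Longrightarrow> f \<in> borel_measurable borel"
  by (simp add: Lp_le_def)

lemma measurable_tm_iff: "f \<in> borel_measurable tm \<longleftrightarrow> f \<in> borel_measurable borel"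
  using measurable_cong_sets[OF sets_tm refl] by blast

text \<open>The common last step of Minkowski, Hoelder, monotonicity in the exponent and the greedy
  estimate: each is a pointwise bound by a combination of two functions with known
  integrals.\<close>

lemma nn_integral_tm_lincomb_le:
  fixes F G H :: "real^'d \<Rightarrow> real"
  assumes [measurable]: "G \<in> borel_measurable borel" "H \<in> borel_measurable borel"
    and "\<And>x. 0 \<le> G x" "\<And>x. 0 \<le> H x"
    and "(\<integral>\<^sup>+x. ennreal (G x) \<partial>tm) \<le> ennreal A" "(\<integral>\<^sup>+x. ennreal (H x) \<partial>tm) \<le> ennreal B"
    and "0 \<le> A" "0 \<le> B" "0 \<le> c" "0 \<le> d" "\<And>x. F x \<le> c * G x + d * H x"
  shows "(\<integral>\<^sup>+x. ennreal (F x) \<partial>tm) \<le> ennreal (c * A + d * B)"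
proof -
  have "(\<integral>\<^sup>+x. ennreal (F x) \<partial>tm) \<le> (\<integral>\<^sup>+x. ennreal c * ennreal (G x) + ennreal d * ennreal (H x) \<partial>tm)"
    using assms by (intro nn_integral_mono) (simp flip: ennreal_mult ennreal_plus add: ennreal_leI)
  also have "\<dots> = ennreal c * (\<integral>\<^sup>+x. ennreal (G x) \<partial>tm) + ennreal d * (\<integral>\<^sup>+x. ennreal (H x) \<partial>tm)"
    by (subst nn_integral_add) (auto simp: nn_integral_cmult)
  also have "\<dots> \<le> ennreal c * ennreal A + ennreal d * ennreal B"
    using assms by (intro add_mono mult_left_mono) auto
  also have "\<dots> = ennreal (c * A + d * B)"
    using assms by (simp flip: ennreal_mult ennreal_plus)
  finally show ?thesis .
qed

lemma Lp_le_mono: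
  assumes "Lp_le p f a" "a \<le> b" "0 < p"
  shows "Lp_le p f b"
proof -
  have "ennreal (a powr p) \<le> ennreal (b powr p)"
    using assms by (intro ennreal_leI powr_mono2) (auto simp: Lp_le_def)
  then show ?thesis using assms unfolding Lp_le_def by (metis order_trans)
qed

lemma Lp_le_bounded:
  fixes f :: "real^'d \<Rightarrow> complex"
  assumes "f \<in> borel_measurable borel" "\<And>x. norm (f x) \<le> B" "0 < p"
  shows "Lp_le p f B"
proof -
  have "0 \<le> B" using assms(2)[of 0] norm_ge_zero order_trans by blast
  moreover have "(\<integral>\<^sup>+x. ennreal (norm (f x) powr p) \<partial>tm) \<le> (\<integral>\<^sup>+x. ennreal (B powr p) \<partial>(tm::(real^'d) measure))"
    using assms by (intro nn_integral_mono ennreal_leI powr_mono2) auto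
  ultimately show ?thesis using assms(1) by (simp add: Lp_le_def)
qed

lemma Lp_le_zero_AE:
  assumes "Lp_le p f 0" "0 < p"
  shows "AE x in tm. f x = 0"
proof -
  have [measurable]: "f \<in> borel_measurable borel" using assms by (simp add: Lp_le_def)
  have "(\<integral>\<^sup>+x. ennreal (norm (f x) powr p) \<partial>tm) = 0" using assms by (simp add: Lp_le_def)
  then have "AE x in tm. ennreal (norm (f x) powr p) = 0"
    by (subst (asm) nn_integral_0_iff_AE) auto
  then show ?thesis by eventually_elim (simp add: ennreal_eq_0_iff)
qed

lemma Lp_le_cong_AE:
  assumes "Lp_le p f a" "AE x in tm. f x = g x" "g \<in> borel_measurable borel"
  shows "Lp_le p g a"
proof -
  have "(\<integral>\<^sup>+x. ennreal (norm (g x) powr p) \<partial>tm) = (\<integral>\<^sup>+x. ennreal (norm (f x) powr p) \<partial>tm)"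
    using assms(2) by (intro nn_integral_cong_AE) auto
  then show ?thesis using assms by (simp add: Lp_le_def)
qed

lemma Lp_le_cmult:
  assumes "Lp_le p f a" "0 < p"
  shows "Lp_le p (\<lambda>x. c * f x) (norm c * a)"
proof -
  have [measurable]: "f \<in> borel_measurable borel" using assms by (simp add: Lp_le_def)
  have "(\<integral>\<^sup>+x. ennreal (norm (c * f x) powr p) \<partial>tm)
      = (\<integral>\<^sup>+x. ennreal (norm c powr p) * ennreal (norm (f x) powr p) \<partial>tm)"
    by (simp add: norm_mult powr_mult ennreal_mult)
  also have "\<dots> = ennreal (norm c powr p) * (\<integral>\<^sup>+x. ennreal (norm (f x) powr p) \<partial>tm)"
    by (rule nn_integral_cmult) auto
  also have "\<dots> \<le> ennreal (norm c powr p) * ennreal (a powr p)"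
    using assms by (intro mult_left_mono) (auto simp: Lp_le_def)
  also have "\<dots> = ennreal ((norm c * a) powr p)"
    using assms by (simp add: powr_mult Lp_le_def flip: ennreal_mult)
  finally show ?thesis using assms by (simp add: Lp_le_def)
qed

lemma Lp_le_norm_mono:
  assumes "Lp_le p f a" "g \<in> borel_measurable borel" "\<And>x. norm (g x) \<le> norm (f x)" "0 < p"
  shows "Lp_le p g a"
proof -
  have "(\<integral>\<^sup>+x. ennreal (norm (g x) powr p) \<partial>tm) \<le> (\<integral>\<^sup>+x. ennreal (norm (f x) powr p) \<partial>tm)"
    using assms by (intro nn_integral_mono ennreal_leI powr_mono2) auto
  then show ?thesis using assms by (auto simp: Lp_le_def)
qed

section \<open>The inequalities of Minkowski and Hoelder; comparison of exponents\<close>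

lemma powr_tangent:
  fixes x c p :: real
  assumes "1 \<le> p" "0 \<le> x" "0 < c"
  shows "c powr p + p * c powr (p - 1) * (x - c) \<le> x powr p"
proof (cases "p = 1")
  case True
  then show ?thesis using assms by simp
next
  case False
  with assms have p: "p > 1" by simp
  define q where "q = p / (p - 1)"
  have q: "q > 1" "1/p + 1/q = 1" using p by (auto simp: q_def field_simps)
  have "x * c powr (p - 1) \<le> x powr p / p + (c powr (p - 1)) powr q / q"
    by (rule Youngs_inequality) (use p q assms in auto)
  also have "(c powr (p - 1)) powr q = c powr p"
    using p by (simp add: powr_powr q_def)
  also have "1 / q = 1 - 1 / p" using q by simp
  then have "c powr p / q = c powr p * (1 - 1/p)" by (metis mult_1_right times_divide_eq_right)
  finally have "p * (x * c powr (p - 1)) \<le> x powr p + (p - 1) * c powr p"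
    using p by (simp add: field_simps)
  moreover have "c powr (p - 1) * c = c powr p"
    using assms by (simp add: powr_diff)
  ultimately show ?thesis by (simp add: algebra_simps)
qed

text \<open>Convexity of the p-th power at (u + v)/(a + b), written as the average of u/a and v/b
  with weights a/(a + b) and b/(a + b). If a and b bound the norms of two functions, integration
  gives exactly (a + b)^p.\<close>

lemma powr_add_convex:
  fixes u v a b p :: real
  assumes "1 \<le> p" "0 \<le> u" "0 \<le> v" "0 < a" "0 < b"
  shows "(u + v) powr p \<le> ((a + b) powr p * (a / (a + b)) / a powr p) * u powr p
     + ((a + b) powr p * (b / (a + b)) / b powr p) * v powr p"
proof (cases "u + v = 0")
  case True
  then show ?thesis using assms by simp
next
  case False
  define c where "c = (u + v) / (a + b)"
  have c: "c > 0" using False assms by (simp add: c_def)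
  define D where "D = p * c powr (p - 1)"
  define A B U V where "A = a / (a + b)" and "B = b / (a + b)" and "U = u / a" and "V = v / b"
  have AB: "A + B = 1" "A \<ge> 0" "B \<ge> 0"
    using assms by (auto simp: A_def B_def simp flip: add_divide_distrib)
  have "A * U = u / (a + b)" "B * V = v / (a + b)"
    using assms by (auto simp: A_def B_def U_def V_def)
  then have AU: "A * U + B * V = c" by (simp add: c_def add_divide_distrib)
  have 1: "c powr p + D * (U - c) \<le> U powr p"
    unfolding D_def by (rule powr_tangent) (use assms c in \<open>auto simp: U_def\<close>)
  have 2: "c powr p + D * (V - c) \<le> V powr p"
    unfolding D_def by (rule powr_tangent) (use assms c in \<open>auto simp: V_def\<close>)
  have "A * (c powr p + D * (U - c)) + B * (c powr p + D * (V - c))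
      = (A + B) * (c powr p - D * c) + D * (A * U + B * V)"
    by (simp add: algebra_simps)
  also have "\<dots> = c powr p" by (simp add: AB AU)
  finally have "c powr p \<le> A * U powr p + B * V powr p"
    using mult_left_mono[OF 1 AB(2)] mult_left_mono[OF 2 AB(3)] by linarith
  then have "(a + b) powr p * c powr p \<le> (a + b) powr p * (A * U powr p + B * V powr p)"
    by (rule mult_left_mono) simp
  moreover have "(a + b) powr p * c powr p = (u + v) powr p"
    using assms by (simp add: c_def powr_divide)
  moreover have "U powr p = u powr p / a powr p" "V powr p = v powr p / b powr p"
    using assms by (auto simp: U_def V_def powr_divide)
  ultimately show ?thesis by (simp add: A_def B_def distrib_left mult.assoc)
qed

lemma Lp_le_add:
  assumes f: "Lp_le p f a" and g: "Lp_le p g b" and p: "1 \<le> p"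
  shows "Lp_le p (\<lambda>x. f x + g x) (a + b)"
proof -
  have [measurable]: "f \<in> borel_measurable borel" "g \<in> borel_measurable borel"
    using f g by (auto simp: Lp_le_def)
  have ab: "0 \<le> a" "0 \<le> b" using f g by (auto simp: Lp_le_def)
  consider "a = 0" | "b = 0" | "a > 0" "b > 0" using ab by linarith
  then show ?thesis
  proof cases
    case 1
    then have "AE x in tm. f x = 0" using Lp_le_zero_AE[of p f] f p by auto
    then have "AE x in tm. g x = f x + g x" by eventually_elim simp
    then show ?thesis using 1 Lp_le_cong_AE[OF g] by simp
  next
    case 2
    then have "AE x in tm. g x = 0" using Lp_le_zero_AE[of p g] g p by auto
    then have "AE x in tm. f x = f x + g x" by eventually_elim simp
    then show ?thesis using 2 Lp_le_cong_AE[OF f] by simp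
  next
    case 3
    let ?c = "(a + b) powr p * (a / (a + b)) / a powr p"
    let ?d = "(a + b) powr p * (b / (a + b)) / b powr p"
    have "(\<integral>\<^sup>+x. ennreal (norm (f x + g x) powr p) \<partial>tm) \<le> ennreal (?c * a powr p + ?d * b powr p)"
    proof (rule nn_integral_tm_lincomb_le[where G="\<lambda>x. norm (f x) powr p" and H="\<lambda>x. norm (g x) powr p"])
      fix x
      have "norm (f x + g x) powr p \<le> (norm (f x) + norm (g x)) powr p"
        using p by (intro powr_mono2 norm_triangle_ineq) auto
      also have "\<dots> \<le> ?c * norm (f x) powr p + ?d * norm (g x) powr p"
        by (rule powr_add_convex) (use 3 p in auto)
      finally show "norm (f x + g x) powr p \<le> ?c * norm (f x) powr p + ?d * norm (g x) powr p" .
    qed (use f g 3 in \<open>auto simp: Lp_le_def\<close>)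
    also have "?c * a powr p + ?d * b powr p = (a + b) powr p"
    proof -
      have "?c * a powr p + ?d * b powr p = (a + b) powr p * (a / (a+b) + b / (a+b))"
        using 3 by (simp add: distrib_left)
      also have "a / (a+b) + b / (a+b) = 1" using 3 by (simp flip: add_divide_distrib)
      finally show ?thesis by simp
    qed
    finally show ?thesis using ab by (simp add: Lp_le_def)
  qed
qed

lemma Lp_le_diff:
  assumes "Lp_le p f a" "Lp_le p g b" "1 \<le> p"
  shows "Lp_le p (\<lambda>x. f x - g x) (a + b)"
  using Lp_le_add[OF assms(1) Lp_le_cmult[OF assms(2), of "-1"] assms(3)] assms(3) by simp

lemma Lp_le_zero: "0 < p \<Longrightarrow> Lp_le p (\<lambda>x. 0) 0"
  by (simp add: Lp_le_def)

lemma Lp_le_sum: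
  assumes "finite I" "\<And>i. i \<in> I \<Longrightarrow> Lp_le p (f i) (a i)" "1 \<le> p"
  shows "Lp_le p (\<lambda>x. \<Sum>i\<in>I. f i x) (\<Sum>i\<in>I. a i)"
  using assms(1,2)
proof induction
  case empty
  show ?case using Lp_le_zero[of p] assms(3) by simp
next
  case (insert i I)
  then have "Lp_le p (\<lambda>x. f i x + (\<Sum>i\<in>I. f i x)) (a i + (\<Sum>i\<in>I. a i))"
    by (intro Lp_le_add assms(3)) auto
  then show ?case using insert.hyps by simp
qed

lemma Lp_le_Holder:
  assumes f: "Lp_le p f a" and g: "Lp_le q g b" and pq: "1 < p" "1 < q" "1/p + 1/q = 1"
  shows "Lp_le 1 (\<lambda>x. f x * g x) (a * b)"
proof -
  have [measurable]: "f \<in> borel_measurable borel" "g \<in> borel_measurable borel"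
    using f g by (auto simp: Lp_le_def)
  have ab: "0 \<le> a" "0 \<le> b" using f g by (auto simp: Lp_le_def)
  consider "a = 0 \<or> b = 0" | "a > 0" "b > 0" using ab by linarith
  then show ?thesis
  proof cases
    case 1
    then have "(AE x in tm. f x = 0) \<or> (AE x in tm. g x = 0)"
      using Lp_le_zero_AE[of p f] Lp_le_zero_AE[of q g] f g pq by auto
    then have "AE x in tm. 0 = f x * g x" by auto
    with Lp_le_cong_AE[OF Lp_le_zero[of 1] this] 1 show ?thesis by auto
  next
    case 2
    have "(\<integral>\<^sup>+x. ennreal (norm (f x * g x) powr 1) \<partial>tm)
       \<le> ennreal ((a * b / p / a powr p) * a powr p + (a * b / q / b powr q) * b powr q)"
    proof (rule nn_integral_tm_lincomb_le[where G="\<lambda>x. norm (f x) powr p" and H="\<lambda>x. norm (g x) powr q"])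
      fix x
      have "norm (f x) / a * (norm (g x) / b) \<le> (norm (f x) / a) powr p / p + (norm (g x) / b) powr q / q"
        by (rule Youngs_inequality) (use pq ab in auto)
      then have "a * b * (norm (f x) / a * (norm (g x) / b))
        \<le> a * b * ((norm (f x) / a) powr p / p + (norm (g x) / b) powr q / q)"
        using ab by (intro mult_left_mono) auto
      then show "norm (f x * g x) powr 1 \<le> a * b / p / a powr p * norm (f x) powr p + a * b / q / b powr q * norm (g x) powr q"
        using 2 pq by (simp add: powr_divide norm_mult algebra_simps)
    qed (use f g 2 pq in \<open>auto simp: Lp_le_def\<close>)
    also have "(a * b / p / a powr p) * a powr p + (a * b / q / b powr q) * b powr q = a * b * (1/p + 1/q)"
      using 2 by (simp add: distrib_left)
    also have "\<dots> = (a * b) powr 1" using pq ab by simp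
    finally show ?thesis using ab by (simp add: Lp_le_def)
  qed
qed

lemma Lp_le_exponent_mono:
  assumes f: "Lp_le q f a" and pq: "0 < p" "p \<le> q"
  shows "Lp_le p f a"
proof -
  have [measurable]: "f \<in> borel_measurable borel" using f by (auto simp: Lp_le_def)
  consider "a = 0" | "a > 0" using f by (fastforce simp: Lp_le_def)
  then show ?thesis
  proof cases
    case 1
    then have "AE x in tm. f x = 0" using Lp_le_zero_AE[of q f] f pq by auto
    then have "AE x in tm. 0 = f x" by eventually_elim simp
    with Lp_le_cong_AE[OF Lp_le_zero[of p] this] 1 pq show ?thesis by auto
  next
    case 2
    have 1: "(\<integral>\<^sup>+x. ennreal 1 \<partial>(tm::(real^'a) measure)) \<le> ennreal 1" by simp
    have "(\<integral>\<^sup>+x. ennreal (norm (f x) powr p) \<partial>tm)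
       \<le> ennreal ((a powr p * (p/q) / a powr q) * a powr q + (a powr p * (1 - p/q)) * 1)"
    proof (rule nn_integral_tm_lincomb_le[where G="\<lambda>x. norm (f x) powr q" and H="\<lambda>x. 1"])
      fix x
      define u where "u = norm (f x) / a"
      have "(u powr q) powr (p/q) * 1 powr (1 - p/q) \<le> (p/q) * u powr q + (1 - p/q) * 1" 
      proof (cases "u = 0")
        case False
        then have "u > 0" using 2 by (simp add: u_def)
        then show ?thesis by (intro Youngs_inequality_0) (use pq in auto)
      qed (use pq in auto)
      moreover have "(u powr q) powr (p/q) = u powr p" using pq by (simp add: powr_powr)
      ultimately have "u powr p \<le> (p/q) * u powr q + (1 - p/q)" by simp
      then have "a powr p * u powr p \<le> a powr p * ((p/q) * u powr q + (1 - p/q))"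
        by (intro mult_left_mono) auto
      then show "norm (f x) powr p \<le> a powr p * (p / q) / a powr q * norm (f x) powr q + a powr p * (1 - p / q) * 1"
        using 2 by (simp add: u_def powr_divide algebra_simps)
    qed (use f 2 pq in \<open>auto simp: Lp_le_def\<close>)
    also have "(a powr p * (p/q) / a powr q) * a powr q + (a powr p * (1 - p/q)) * 1 = a powr p"
      using 2 by (simp add: algebra_simps)
    finally show ?thesis using 2 by (simp add: Lp_le_def)
  qed
qed

lemma Lp_le_1_integral:
  assumes "Lp_le 1 f a"
  shows "integrable tm f" "norm (\<integral>x. f x \<partial>tm) \<le> a"
proof -
  have [measurable]: "f \<in> borel_measurable borel" using assms by (auto simp: Lp_le_def)
  have i: "(\<integral>\<^sup>+x. ennreal (norm (f x)) \<partial>tm) \<le> ennreal a" and a: "0 \<le> a" using assms by (auto simp: Lp_le_def)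
  show int: "integrable tm f"
    by (rule integrableI_bounded) (use i in \<open>auto simp: le_less_trans\<close>)
  have "ennreal (norm (\<integral>x. f x \<partial>tm)) \<le> ennreal a"
    using integral_norm_bound_ennreal[OF int] i by simp
  then show "norm (\<integral>x. f x \<partial>tm) \<le> a" using a by (simp add: ennreal_le_iff)
qed

text \<open>From |f|^q \<le> B^(q-p) |f|^p. It yields the L_p norms of the kernel from its L_1 and
  supremum bounds, and Nikol'skii's inequality from its supremum case.\<close>

lemma Lp_le_interpolate:
  assumes f: "Lp_le p f a" and B: "\<And>x. norm (f x) \<le> B" and pq: "0 < p" "p \<le> q"
  shows "Lp_le q f (B powr (1 - p/q) * a powr (p/q))"
proof -
  have [measurable]: "f \<in> borel_measurable borel" using f by (auto simp: Lp_le_def)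
  have a: "0 \<le> a" using f by (simp add: Lp_le_def)
  have "0 \<le> B" using B[of 0] norm_ge_zero order_trans by blast
  have "(\<integral>\<^sup>+x. ennreal (norm (f x) powr q) \<partial>tm) \<le> (\<integral>\<^sup>+x. ennreal (B powr (q - p)) * ennreal (norm (f x) powr p) \<partial>tm)"
  proof (rule nn_integral_mono)
    fix x
    have "norm (f x) powr q = norm (f x) powr (q - p) * norm (f x) powr p"
      by (simp flip: powr_add)
    also have "\<dots> \<le> B powr (q - p) * norm (f x) powr p"
      using B pq by (intro mult_right_mono powr_mono2) auto
    finally show "ennreal (norm (f x) powr q) \<le> ennreal (B powr (q - p)) * ennreal (norm (f x) powr p)"
      by (simp flip: ennreal_mult add: ennreal_leI)
  qed
  also have "\<dots> = ennreal (B powr (q - p)) * (\<integral>\<^sup>+x. ennreal (norm (f x) powr p) \<partial>tm)"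
    by (rule nn_integral_cmult) auto
  also have "\<dots> \<le> ennreal (B powr (q - p)) * ennreal (a powr p)"
    using f by (intro mult_left_mono) (auto simp: Lp_le_def)
  also have "\<dots> = ennreal ((B powr (1 - p/q) * a powr (p/q)) powr q)"
  proof -
    have "(1 - p/q) * q = q - p" "p/q * q = p" using pq by (auto simp: field_simps)
    then show ?thesis using pq a \<open>0 \<le> B\<close>
      by (simp add: powr_mult powr_powr flip: ennreal_mult)
  qed
  finally show ?thesis by (simp add: Lp_le_def)
qed

lemma Lp_le_translate:
  assumes "Lp_le p f a" "periodic_fun f"
  shows "Lp_le p (\<lambda>x. f (x + h)) a"
proof -
  have [measurable]: "f \<in> borel_measurable borel" using assms by (simp add: Lp_le_def)
  have "(\<integral>\<^sup>+x. ennreal (norm (f (x + h)) powr p) \<partial>tm) = (\<integral>\<^sup>+x. ennreal (norm (f x) powr p) \<partial>tm)"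
    by (rule nn_integral_tm_translate[where g="\<lambda>z. ennreal (norm z powr p)"]) (use assms in auto)
  then show ?thesis using assms by (auto simp: Lp_le_def)
qed

text \<open>Jensen's inequality for the density w of mass at most W, obtained from Hoelder by
  splitting w into w^(1/p) and w^(1/q) with conjugate exponents.\<close>

lemma norm_integral_mult_powr_le:
  fixes g K :: "real^'d \<Rightarrow> complex" and w :: "real^'d \<Rightarrow> real"
  assumes p: "1 \<le> p" and [measurable]: "g \<in> borel_measurable borel" "K \<in> borel_measurable borel"
      "w \<in> borel_measurable borel"
    and K: "\<And>t. norm (K t) \<le> w t" and W: "(\<integral>\<^sup>+t. ennreal (w t) \<partial>tm) \<le> ennreal W" "0 < W"
  shows "ennreal (norm (\<integral>t. g t * K t \<partial>tm) powr p)
     \<le> ennreal (W powr (p - 1)) * (\<integral>\<^sup>+t. ennreal (norm (g t) powr p * w t) \<partial>tm)"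
proof (cases "(\<integral>\<^sup>+t. ennreal (norm (g t) powr p * w t) \<partial>tm) = \<infinity>")
  case True
  then show ?thesis using W by (simp add: ennreal_mult_top)
next
  case False
  then obtain X where X: "0 \<le> X" "(\<integral>\<^sup>+t. ennreal (norm (g t) powr p * w t) \<partial>tm) = ennreal X"
    by (cases "\<integral>\<^sup>+t. ennreal (norm (g t) powr p * w t) \<partial>tm") auto
  have w: "0 \<le> w t" for t using K[of t] norm_ge_zero order_trans by blast
  have gw: "Lp_le 1 (\<lambda>t. of_real (norm (g t) * w t)) (X powr (1/p) * W powr (1 - 1/p))"
  proof (cases "p = 1")
    case True
    have "(\<integral>\<^sup>+t. ennreal (norm (complex_of_real (norm (g t) * w t)) powr 1) \<partial>tm) = ennreal X"
      using X w True by (simp add: norm_mult)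
    then show ?thesis using True X W by (simp add: Lp_le_def)
  next
    case False
    with p have p1: "p > 1" by simp
    define q where "q = p / (p - 1)"
    have q: "q > 1" "1/p + 1/q = 1" "1/q = 1 - 1/p" using p1 by (auto simp: q_def field_simps)
    have "Lp_le p (\<lambda>t. of_real (norm (g t) * w t powr (1/p))) (X powr (1/p))"
      using X w p1 by (simp add: Lp_le_def powr_mult powr_powr norm_mult)
    moreover have "Lp_le q (\<lambda>t. of_real (w t powr (1/q))) (W powr (1/q))"
    proof -
      have "q * (1/q) = 1" "1/q * q = 1" using q(1) by auto
      then show ?thesis using W w by (simp add: Lp_le_def powr_powr del: times_divide_eq_left times_divide_eq_right)
    qed
    ultimately have "Lp_le 1 (\<lambda>t. of_real (norm (g t) * w t powr (1/p)) * of_real (w t powr (1/q))) (X powr (1/p) * W powr (1/q))"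
      by (rule Lp_le_Holder) (use p1 q in auto)
    moreover have "w t powr (1/p) * w t powr (1/q) = w t" for t
      using q w by (simp flip: powr_add)
    ultimately show ?thesis using q by (simp add: mult.assoc flip: of_real_mult)
  qed
  have "Lp_le 1 (\<lambda>t. g t * K t) (X powr (1/p) * W powr (1 - 1/p))"
    by (rule Lp_le_norm_mono[OF gw]) (use K w in \<open>auto simp: norm_mult intro!: mult_left_mono\<close>)
  then have "norm (\<integral>t. g t * K t \<partial>tm) \<le> X powr (1/p) * W powr (1 - 1/p)"
    by (rule Lp_le_1_integral)
  then have "norm (\<integral>t. g t * K t \<partial>tm) powr p \<le> (X powr (1/p) * W powr (1 - 1/p)) powr p"
    using p by (intro powr_mono2) auto
  also have "\<dots> = W powr (p - 1) * X"
  proof -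
    have "(1 - 1/p) * p = p - 1" "1/p * p = 1" using p by (auto simp: field_simps)
    then show ?thesis using X p by (simp add: powr_mult powr_powr)
  qed
  finally show ?thesis using X by (simp flip: ennreal_mult add: ennreal_leI)
qed

text \<open>Minkowski's inequality for integrals in p-th power form. The bound b may depend on t,
  because in Jackson's inequality the bound on the differences grows with the step t; convolution is
  the case of constant b.\<close>

lemma Lp_le_integral_kernel:
  fixes F :: "real^'d \<Rightarrow> real^'d \<Rightarrow> complex" and K :: "real^'d \<Rightarrow> complex" and w b :: "real^'d \<Rightarrow> real"
  assumes p: "1 \<le> p" and F[measurable]: "case_prod F \<in> borel_measurable (borel \<Otimes>\<^sub>M borel)"
      and [measurable]: "K \<in> borel_measurable borel" "w \<in> borel_measurable borel" "b \<in> borel_measurable borel"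
    and K: "\<And>t. norm (K t) \<le> w t" and W: "(\<integral>\<^sup>+t. ennreal (w t) \<partial>tm) \<le> ennreal W" "0 < W"
    and b: "\<And>t. (\<integral>\<^sup>+x. ennreal (norm (F x t) powr p) \<partial>tm) \<le> ennreal (b t)" "\<And>t. 0 \<le> b t"
    and E: "(\<integral>\<^sup>+t. ennreal (b t * w t) \<partial>tm) \<le> ennreal E" "0 \<le> E"
  shows "Lp_le p (\<lambda>x. \<integral>t. F x t * K t \<partial>tm) ((W powr (p - 1) * E) powr (1/p))"
proof -
  have w: "0 \<le> w t" for t using K[of t] norm_ge_zero order_trans by blast
  have [measurable]: "(\<lambda>t. F x t) \<in> borel_measurable borel" for x
    using measurable_compose[of "\<lambda>t. (x, t)" borel "borel \<Otimes>\<^sub>M borel" "case_prod F" borel] by simp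
  have [measurable]: "(\<lambda>x. F x t) \<in> borel_measurable borel" for t
    using measurable_compose[of "\<lambda>x. (x, t)" borel "borel \<Otimes>\<^sub>M borel" "case_prod F" borel] by simp
  have [measurable]: "case_prod F \<in> borel_measurable (tm \<Otimes>\<^sub>M tm)"
    using F by (simp cong: measurable_cong_sets sets_pair_measure_cong)
  have "(\<lambda>x. \<integral>t. F x t * K t \<partial>tm) \<in> borel_measurable tm"
    by (rule tm.borel_measurable_lebesgue_integral) measurable
  then have m: "(\<lambda>x. \<integral>t. F x t * K t \<partial>tm) \<in> borel_measurable borel"
    by (simp add: measurable_tm_iff)
  have "(\<integral>\<^sup>+x. ennreal (norm (\<integral>t. F x t * K t \<partial>tm) powr p) \<partial>tm)
     \<le> (\<integral>\<^sup>+x. ennreal (W powr (p - 1)) * (\<integral>\<^sup>+t. ennreal (norm (F x t) powr p * w t) \<partial>tm) \<partial>tm)"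
    by (intro nn_integral_mono norm_integral_mult_powr_le p K W) auto
  also have "\<dots> = ennreal (W powr (p - 1)) * (\<integral>\<^sup>+x. (\<integral>\<^sup>+t. ennreal (norm (F x t) powr p * w t) \<partial>tm) \<partial>tm)"
    by (rule nn_integral_cmult) measurable
  also have "(\<integral>\<^sup>+x. (\<integral>\<^sup>+t. ennreal (norm (F x t) powr p * w t) \<partial>tm) \<partial>tm)
     = (\<integral>\<^sup>+t. (\<integral>\<^sup>+x. ennreal (norm (F x t) powr p * w t) \<partial>tm) \<partial>tm)"
    by (rule tmp.Fubini'[symmetric]) measurable
  also have "\<dots> \<le> (\<integral>\<^sup>+t. ennreal (b t * w t) \<partial>tm)"
  proof (rule nn_integral_mono)
    fix t
    have "(\<integral>\<^sup>+x. ennreal (norm (F x t) powr p * w t) \<partial>tm) = (\<integral>\<^sup>+x. ennreal (norm (F x t) powr p) \<partial>tm) * ennreal (w t)"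
      using w by (subst nn_integral_multc[symmetric]) (auto simp: ennreal_mult)
    also have "\<dots> \<le> ennreal (b t) * ennreal (w t)"
      using b by (intro mult_right_mono) auto
    finally show "(\<integral>\<^sup>+x. ennreal (norm (F x t) powr p * w t) \<partial>tm) \<le> ennreal (b t * w t)"
      using b w by (simp add: ennreal_mult)
  qed
  also note E(1)
  finally have "(\<integral>\<^sup>+x. ennreal (norm (\<integral>t. F x t * K t \<partial>tm) powr p) \<partial>tm) \<le> ennreal (W powr (p - 1)) * ennreal E"
    by (simp add: mult_left_mono)
  also have "\<dots> = ennreal (((W powr (p - 1) * E) powr (1/p)) powr p)"
    using p E W by (simp add: powr_powr flip: ennreal_mult)
  finally show ?thesis using m by (simp add: Lp_le_def)
qed

text \<open>The translation \<open>t \<mapsto> t + s/j\<close> makes the left-hand side independent of \<open>x\<close>, so averaging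
  over \<open>x\<close> gives its value.\<close>

lemma nn_integral_tm_dilate:
  fixes f :: "real^'d \<Rightarrow> complex" and g :: "complex \<Rightarrow> ennreal" and j :: int
  assumes [measurable]: "f \<in> borel_measurable borel" "g \<in> borel_measurable borel" and per: "periodic_fun f"
    and "j \<noteq> 0"
  shows "(\<integral>\<^sup>+t. g (f (x + of_int j *\<^sub>R t)) \<partial>tm) = (\<integral>\<^sup>+t. g (f t) \<partial>tm)"
proof -
  let ?U = "\<lambda>x. \<integral>\<^sup>+t. g (f (x + of_int j *\<^sub>R t)) \<partial>tm"
  have perj: "periodic_fun (\<lambda>t. f (x + of_int j *\<^sub>R t))" for x
    unfolding periodic_fun_def
  proof (intro allI)
    fix t i
    have "f (x + of_int j *\<^sub>R (t + (2*pi) *\<^sub>R axis i 1)) = f ((x + of_int j *\<^sub>R t) + lat (\<chi> l. if l = i then j else 0))"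
      by (rule arg_cong[of _ _ f]) (auto simp: lat_def vec_eq_iff axis_def algebra_simps)
    then show "f (x + of_int j *\<^sub>R (t + (2*pi) *\<^sub>R axis i 1)) = f (x + of_int j *\<^sub>R t)"
      by (simp add: periodic_fun_lat[OF per])
  qed
  have const: "?U x = ?U 0" for x
  proof -
    have "?U 0 = (\<integral>\<^sup>+t. g (f (0 + of_int j *\<^sub>R (t + (1 / of_int j) *\<^sub>R x))) \<partial>tm)"
      by (rule nn_integral_tm_translate[where f="\<lambda>t. f (0 + of_int j *\<^sub>R t)", symmetric]) (use perj[of 0] in auto)
    also have "\<dots> = ?U x" using assms(4) by (simp add: scaleR_add_right add.commute)
    finally show ?thesis by simp
  qed
  have "?U x = (\<integral>\<^sup>+y. ?U x \<partial>(tm :: (real^'d) measure))" by simp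
  also have "\<dots> = (\<integral>\<^sup>+y. ?U y \<partial>tm)" by (subst const) (rule nn_integral_cong, rule const[symmetric])
  also have "\<dots> = (\<integral>\<^sup>+t. (\<integral>\<^sup>+y. g (f (y + of_int j *\<^sub>R t)) \<partial>tm) \<partial>tm)"
    by (rule tmp.Fubini'[symmetric]) measurable
  also have "\<dots> = (\<integral>\<^sup>+t. (\<integral>\<^sup>+y. g (f y) \<partial>tm) \<partial>(tm :: (real^'d) measure))"
    by (simp add: nn_integral_tm_translate per)
  finally show ?thesis by simp
qed

section \<open>Characters, trigonometric polynomials and convolution\<close>

definition tchar :: "int^'d \<Rightarrow> real^'d \<Rightarrow> complex" where
  "tchar k x = exp (\<i> * of_real (\<Sum>j\<in>UNIV. of_int (k$j) * x$j))"

lemma trig_poly_tchar: "trig_poly \<Theta> c x = (\<Sum>k\<in>\<Theta>. c k * tchar k x)"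
  by (simp add: trig_poly_def tchar_def)

lemma tchar_add: "tchar k (x + y) = tchar k x * tchar k y"
  by (simp add: tchar_def algebra_simps sum.distrib flip: exp_add)

lemma tchar_add_freq: "tchar (k + l) x = tchar k x * tchar l x"
  by (simp add: tchar_def algebra_simps sum.distrib flip: exp_add)

lemma tchar_zero [simp]: "tchar 0 x = 1" "tchar k 0 = 1"
  by (simp_all add: tchar_def)

lemma norm_tchar [simp]: "norm (tchar k x) = 1"
  by (simp add: tchar_def norm_exp_i_times)

lemma cnj_tchar: "cnj (tchar k x) = tchar (- k) x"
  by (simp add: tchar_def exp_cnj sum_negf)

lemma tchar_minus: "tchar k (- x) = tchar (- k) x"
  by (simp add: tchar_def sum_negf)

lemma tchar_mult_cnj: "tchar k x * cnj (tchar l x) = tchar (k - l) x"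
  using tchar_add_freq[of k "-l" x] by (simp add: cnj_tchar)

lemma continuous_on_tchar: "continuous_on A (tchar k)"
  unfolding tchar_def by (intro continuous_intros)

lemma tchar_measurable [measurable]: "tchar k \<in> borel_measurable borel"
  by (rule borel_measurable_continuous_onI) (rule continuous_on_tchar)

lemma periodic_tchar: "periodic_fun (tchar k)"
proof -
  have "tchar k ((2*pi) *\<^sub>R axis i 1) = 1" for i
  proof -
    have "(\<Sum>j\<in>UNIV. of_int (k$j) * ((2*pi) *\<^sub>R axis i 1 :: real^'a)$j) = (\<Sum>j\<in>UNIV. if j = i then 2*pi * of_int (k$i) else 0)"
      by (intro sum.cong) (auto simp: axis_def)
    then have "tchar k ((2*pi) *\<^sub>R axis i 1) = exp (\<i> * of_real (2*pi * of_int (k$i)))"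
      by (simp add: tchar_def)
    also have "\<dots> = exp ((2 * of_int (k$i) * of_real pi) * \<i>)"
      by (simp add: algebra_simps)
    also have "\<dots> = 1"
      using exp_integer_2pi[of "of_int (k$i)"] by simp
    finally show ?thesis .
  qed
  then show ?thesis by (simp add: periodic_fun_def tchar_add)
qed

text \<open>A translation by pi / k_i in a coordinate where k does not vanish changes the sign of
  the character, so its mean is its own negative.\<close>

lemma integral_tchar: "(\<integral>x. tchar k x \<partial>tm) = (if k = 0 then 1 else 0)"
proof (cases "k = 0")
  case True
  then show ?thesis by simp
next
  case False
  then obtain i where i: "k $ i \<noteq> 0" by (auto simp: vec_eq_iff)
  let ?h = "(pi / of_int (k$i)) *\<^sub>R axis i 1 :: real^'a"
  have "(\<Sum>j\<in>UNIV. of_int (k$j) * ?h$j) = (\<Sum>j\<in>UNIV. if j = i then pi else 0)"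
    using i by (intro sum.cong) (auto simp: axis_def)
  then have h: "tchar k ?h = -1" by (simp add: tchar_def)
  have "(\<integral>x. tchar k x \<partial>tm) = (\<integral>x. tchar k (x + ?h) \<partial>tm)"
    by (rule integral_tm_translate[symmetric]) (auto simp: periodic_tchar)
  also have "\<dots> = - (\<integral>x. tchar k x \<partial>tm)" by (simp add: tchar_add h)
  finally show ?thesis using False by simp
qed

lemma continuous_on_trig_poly: "continuous_on A (trig_poly \<Lambda> c)"
  unfolding trig_poly_tchar by (intro continuous_intros continuous_on_tchar)

lemma trig_poly_measurable [measurable]: "trig_poly \<Lambda> c \<in> borel_measurable borel"
  by (rule borel_measurable_continuous_onI) (rule continuous_on_trig_poly)

lemma periodic_trig_poly: "periodic_fun (trig_poly \<Lambda> c)"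
  unfolding periodic_fun_def trig_poly_tchar by (simp add: periodic_tchar[unfolded periodic_fun_def, rule_format])

lemma norm_trig_poly_le: "norm (trig_poly \<Lambda> c x) \<le> (\<Sum>k\<in>\<Lambda>. norm (c k))"
  unfolding trig_poly_tchar by (rule order_trans[OF norm_sum]) (simp add: norm_mult)

lemma integrable_tm_bounded:
  fixes f :: "real^'d \<Rightarrow> 'b :: {banach, second_countable_topology}"
  assumes "f \<in> borel_measurable borel" "\<And>x. norm (f x) \<le> B"
  shows "integrable tm f"
  by (rule tm.integrable_const_bound[where B=B]) (use assms in auto)

lemma integrable_tchar [simp]: "integrable tm (tchar k)"
  by (rule integrable_tm_bounded[where B=1]) auto

lemma trig_poly_diff: "trig_poly \<Lambda> (\<lambda>k. b k - c k) x = trig_poly \<Lambda> b x - trig_poly \<Lambda> c x"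
  by (simp add: trig_poly_def algebra_simps sum_subtractf)

lemma trig_poly_cong: "(\<And>k. k \<in> \<Lambda> \<Longrightarrow> b k = c k) \<Longrightarrow> trig_poly \<Lambda> b = trig_poly \<Lambda> c"
  by (auto simp: trig_poly_def fun_eq_iff)

lemma trig_poly_mono_neutral:
  assumes "finite \<Lambda>'" "\<Lambda> \<subseteq> \<Lambda>'" "\<And>k. k \<in> \<Lambda>' - \<Lambda> \<Longrightarrow> c k = 0"
  shows "trig_poly \<Lambda> c = trig_poly \<Lambda>' c"
  unfolding fun_eq_iff trig_poly_tchar using assms by (intro allI sum.mono_neutral_left) auto

lemma integral_trig_poly_mult_cnj:
  assumes "finite \<Lambda>"
  shows "(\<integral>x. trig_poly \<Lambda> b x * cnj (trig_poly \<Lambda> c x) \<partial>tm) = (\<Sum>k\<in>\<Lambda>. b k * cnj (c k))"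
proof -
  have "(\<integral>x. trig_poly \<Lambda> b x * cnj (trig_poly \<Lambda> c x) \<partial>tm)
     = (\<integral>x. (\<Sum>k\<in>\<Lambda>. \<Sum>l\<in>\<Lambda>. b k * cnj (c l) * tchar (k - l) x) \<partial>tm)"
    by (simp add: trig_poly_tchar sum_product mult_ac flip: tchar_mult_cnj)
  also have "\<dots> = (\<Sum>k\<in>\<Lambda>. \<Sum>l\<in>\<Lambda>. b k * cnj (c l) * (\<integral>x. tchar (k - l) x \<partial>tm))"
    by (simp add: Bochner_Integration.integral_sum)
  also have "\<dots> = (\<Sum>k\<in>\<Lambda>. \<Sum>l\<in>\<Lambda>. if l = k then b k * cnj (c k) else 0)"
    by (intro sum.cong refl) (auto simp: integral_tchar)
  also have "\<dots> = (\<Sum>k\<in>\<Lambda>. b k * cnj (c k))"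
    using assms by simp
  finally show ?thesis .
qed

lemma nn_integral_trig_poly_norm2:
  assumes "finite \<Lambda>"
  shows "(\<integral>\<^sup>+x. ennreal (norm (trig_poly \<Lambda> c x) powr 2) \<partial>tm) = ennreal (\<Sum>k\<in>\<Lambda>. (norm (c k))\<^sup>2)"
proof -
  have sq: "norm z powr 2 = (norm z)\<^sup>2" for z :: complex by simp
  have int: "integrable tm (\<lambda>x. (norm (trig_poly \<Lambda> c x))\<^sup>2)"
    by (rule integrable_tm_bounded[where B="(\<Sum>k\<in>\<Lambda>. norm (c k))\<^sup>2"])
      (auto intro!: power_mono norm_trig_poly_le)
  have "complex_of_real (\<integral>x. (norm (trig_poly \<Lambda> c x))\<^sup>2 \<partial>tm)
      = (\<integral>x. complex_of_real ((norm (trig_poly \<Lambda> c x))\<^sup>2) \<partial>tm)"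
    by (rule integral_complex_of_real[symmetric])
  also have "\<dots> = (\<integral>x. trig_poly \<Lambda> c x * cnj (trig_poly \<Lambda> c x) \<partial>tm)"
    by (simp only: complex_norm_square)
  also have "\<dots> = (\<Sum>k\<in>\<Lambda>. c k * cnj (c k))"
    by (rule integral_trig_poly_mult_cnj) fact
  also have "\<dots> = complex_of_real (\<Sum>k\<in>\<Lambda>. (norm (c k))\<^sup>2)"
    by (simp only: complex_norm_square of_real_sum)
  finally have "(\<integral>x. (norm (trig_poly \<Lambda> c x))\<^sup>2 \<partial>tm) = (\<Sum>k\<in>\<Lambda>. (norm (c k))\<^sup>2)"
    by (simp only: of_real_eq_iff)
  moreover have "(\<integral>\<^sup>+x. ennreal ((norm (trig_poly \<Lambda> c x))\<^sup>2) \<partial>tm) = ennreal (\<integral>x. (norm (trig_poly \<Lambda> c x))\<^sup>2 \<partial>tm)"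
    by (rule nn_integral_eq_integral[OF int]) simp
  ultimately show ?thesis by (simp only: sq)
qed

lemma Lp_le_2_trig_poly:
  assumes "finite \<Lambda>"
  shows "Lp_le 2 (trig_poly \<Lambda> c) (sqrt (\<Sum>k\<in>\<Lambda>. (norm (c k))\<^sup>2))"
  using assms by (simp add: Lp_le_def nn_integral_trig_poly_norm2 sum_nonneg del: powr_numeral)
    (simp add: sum_nonneg)

text \<open>Parseval and Cauchy-Schwarz. It passes from a norm to the sum of the moduli of the
  coefficients, the quantity in which greedy approximation is expressed.\<close>

lemma Lp_le_2_trig_poly_coeff:
  assumes "finite \<Lambda>" "Lp_le 2 (trig_poly \<Lambda> c) a"
  shows "(\<Sum>k\<in>\<Lambda>. norm (c k)) \<le> sqrt (card \<Lambda>) * a"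
proof -
  have a: "0 \<le> a" using assms by (simp add: Lp_le_def)
  have "ennreal (\<Sum>k\<in>\<Lambda>. (norm (c k))\<^sup>2) \<le> ennreal (a powr 2)"
    using assms nn_integral_trig_poly_norm2[OF assms(1), of c] by (simp add: Lp_le_def del: powr_numeral)
  then have s: "(\<Sum>k\<in>\<Lambda>. (norm (c k))\<^sup>2) \<le> a\<^sup>2"
    using a by (subst (asm) ennreal_le_iff) auto
  have "(\<Sum>k\<in>\<Lambda>. 1 * norm (c k))\<^sup>2 \<le> (\<Sum>k\<in>\<Lambda>. 1\<^sup>2) * (\<Sum>k\<in>\<Lambda>. (norm (c k))\<^sup>2)"
    by (rule Cauchy_Schwarz_ineq_sum)
  also have "\<dots> \<le> card \<Lambda> * a\<^sup>2" using s by (simp add: mult_left_mono)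
  also have "\<dots> = (sqrt (card \<Lambda>) * a)\<^sup>2" by (simp add: power_mult_distrib)
  finally have "(\<Sum>k\<in>\<Lambda>. norm (c k))\<^sup>2 \<le> (sqrt (card \<Lambda>) * a)\<^sup>2" by simp
  then show ?thesis by (rule power2_le_imp_le) (use a in simp)
qed

lemma Lp_le_1_nn_integral: "Lp_le 1 f a \<Longrightarrow> (\<integral>\<^sup>+x. ennreal (norm (f x)) \<partial>tm) \<le> ennreal a"
  by (auto simp: Lp_le_def)

text \<open>The usual Fourier coefficient after substituting -y for y; in this form it arises
  directly from integrating \<open>f (x - y)\<close> against a character.\<close>

definition fhat :: "(real^'d \<Rightarrow> complex) \<Rightarrow> int^'d \<Rightarrow> complex" where
  "fhat f k = (\<integral>y. f (- y) * tchar k y \<partial>tm)"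

lemma periodic_reflect:
  assumes "periodic_fun f"
  shows "periodic_fun (\<lambda>y. f (x - y))"
  unfolding periodic_fun_def
proof (intro allI)
  fix y i
  have "f ((x - y - (2*pi) *\<^sub>R axis i 1) + (2*pi) *\<^sub>R axis i 1) = f (x - y - (2*pi) *\<^sub>R axis i 1)"
    using assms unfolding periodic_fun_def by blast
  then show "f (x - (y + (2*pi) *\<^sub>R axis i 1)) = f (x - y)"
    by (simp add: algebra_simps)
qed

lemma periodic_mult: "periodic_fun f \<Longrightarrow> periodic_fun g \<Longrightarrow> periodic_fun (\<lambda>x. f x * g x)"
  and periodic_diff: "periodic_fun f \<Longrightarrow> periodic_fun g \<Longrightarrow> periodic_fun (\<lambda>x. f x - g x)"
  by (simp_all add: periodic_fun_def)

text \<open>Reflection is the dilation by -1, so \<open>nn_integral_tm_dilate\<close>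
  applies.\<close>

lemma integrable_reflect:
  assumes "Lp_le 1 f a" "periodic_fun f"
  shows "integrable tm (\<lambda>y. f (x - y))"
proof -
  have [measurable]: "f \<in> borel_measurable borel" using assms by (simp add: Lp_le_def)
  have "(\<integral>\<^sup>+y. ennreal (norm (f (x + of_int (-1) *\<^sub>R y))) \<partial>tm) = (\<integral>\<^sup>+y. ennreal (norm (f y)) \<partial>tm)"
    by (rule nn_integral_tm_dilate[where g="\<lambda>z. ennreal (norm z)"]) (use assms in auto)
  also have "\<dots> \<le> ennreal a" using assms(1) by (rule Lp_le_1_nn_integral)
  finally have "(\<integral>\<^sup>+y. ennreal (norm (f (x - y))) \<partial>tm) \<le> ennreal a" by simp
  then show ?thesis
    by (intro integrableI_bounded) (auto simp: le_less_trans)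
qed

lemma integrable_mult_bounded:
  fixes f g :: "real^'d \<Rightarrow> complex"
  assumes "integrable tm f" "g \<in> borel_measurable borel" "\<And>x. norm (g x) \<le> B"
  shows "integrable tm (\<lambda>x. f x * g x)"
proof (rule Bochner_Integration.integrable_bound)
  show "integrable tm (\<lambda>x. f x * of_real B)" using assms by auto
  show "(\<lambda>x. f x * g x) \<in> borel_measurable tm" using assms by auto
  have "norm (f x * g x) \<le> norm (f x * of_real B)" for x
    using assms(3)[of x] by (auto simp: norm_mult intro!: mult_left_mono)
  then show "AE x in tm. norm (f x * g x) \<le> norm (f x * of_real B)" by simp
qed

lemma integral_reflect_tchar:
  assumes [measurable]: "f \<in> borel_measurable borel" and per: "periodic_fun f"
  shows "(\<integral>y. f (x - y) * tchar k y \<partial>tm) = fhat f k * tchar k x"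
proof -
  have "(\<integral>y. f (x - y) * tchar k y \<partial>tm) = (\<integral>y. f (x - (y + x)) * tchar k (y + x) \<partial>tm)"
    by (rule integral_tm_translate[symmetric])
      (auto intro!: periodic_mult periodic_reflect per periodic_tchar)
  also have "\<dots> = (\<integral>y. (f (- y) * tchar k y) * tchar k x \<partial>tm)"
    by (simp add: tchar_add mult.assoc)
  also have "\<dots> = fhat f k * tchar k x"
    unfolding fhat_def by (rule integral_mult_left_zero)
  finally show ?thesis .
qed

lemma integral_reflect_trig_poly:
  assumes f: "Lp_le 1 f a" and per: "periodic_fun f"
  shows "(\<integral>y. f (x - y) * trig_poly \<Lambda> c y \<partial>tm) = trig_poly \<Lambda> (\<lambda>k. c k * fhat f k) x"
proof -
  have [measurable]: "f \<in> borel_measurable borel" using f by (simp add: Lp_le_def)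
  have int: "integrable tm (\<lambda>y. f (x - y) * tchar k y)" for k
    by (rule integrable_mult_bounded[where B=1]) (use integrable_reflect[OF f per] in auto)
  have "(\<integral>y. f (x - y) * trig_poly \<Lambda> c y \<partial>tm) = (\<integral>y. (\<Sum>k\<in>\<Lambda>. c k * (f (x - y) * tchar k y)) \<partial>tm)"
    by (simp add: trig_poly_tchar sum_distrib_left mult_ac)
  also have "\<dots> = (\<Sum>k\<in>\<Lambda>. c k * (\<integral>y. f (x - y) * tchar k y \<partial>tm))"
    using int by (subst Bochner_Integration.integral_sum) auto
  also have "\<dots> = trig_poly \<Lambda> (\<lambda>k. c k * fhat f k) x"
    by (simp add: trig_poly_tchar integral_reflect_tchar per mult.assoc)
  finally show ?thesis .
qed

lemma fhat_diff:
  assumes "Lp_le 1 f a" "periodic_fun f" "Lp_le 1 g b" "periodic_fun g"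
  shows "fhat (\<lambda>x. f x - g x) k = fhat f k - fhat g k"
proof -
  have "integrable tm (\<lambda>y. f (0 - y) * tchar k y)" "integrable tm (\<lambda>y. g (0 - y) * tchar k y)"
    by (intro integrable_mult_bounded[where B=1] integrable_reflect[OF assms(1,2)] integrable_reflect[OF assms(3,4)]; simp)+
  then show ?thesis
    by (simp add: fhat_def left_diff_distrib)
qed

lemma fhat_trig_poly:
  assumes "finite \<Lambda>"
  shows "fhat (trig_poly \<Lambda> c) k = (if k \<in> \<Lambda> then c k else 0)"
proof -
  have "fhat (trig_poly \<Lambda> c) k = (\<integral>y. (\<Sum>l\<in>\<Lambda>. c l * tchar (k - l) y) \<partial>tm)"
    unfolding fhat_def
    by (intro Bochner_Integration.integral_cong refl)
      (simp add: trig_poly_tchar sum_distrib_left tchar_minus mult_ac flip: tchar_mult_cnj cnj_tchar)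
  also have "\<dots> = (\<Sum>l\<in>\<Lambda>. c l * (\<integral>y. tchar (k - l) y \<partial>tm))"
    by (simp add: Bochner_Integration.integral_sum)
  also have "\<dots> = (\<Sum>l\<in>\<Lambda>. if l = k then c k else 0)"
    by (intro sum.cong refl) (auto simp: integral_tchar)
  finally show ?thesis using assms by simp
qed

text \<open>Bridge to the Lebesgue integrals of the definitions: completion does not change
  integrals of Borel functions.\<close>

lemma integral_tm_lebesgue:
  fixes F :: "real^'d \<Rightarrow> 'b :: {banach, second_countable_topology}"
  assumes [measurable]: "F \<in> borel_measurable borel"
  shows "(\<integral>x. F x \<partial>tm) = (1 / (2*pi) ^ CARD('d)) *\<^sub>R (LINT x:torus|lebesgue. F x)"
proof -
  have "(\<integral>x. F x \<partial>tm) = (\<integral>x. (indicator torus x / (2*pi) ^ CARD('d)) *\<^sub>R F x \<partial>lborel)"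
    unfolding tm_def by (rule integral_density) auto
  also have "\<dots> = (\<integral>x. (1 / (2*pi) ^ CARD('d)) *\<^sub>R (indicator torus x *\<^sub>R F x) \<partial>lborel)"
    by simp
  also have "\<dots> = (1 / (2*pi) ^ CARD('d)) *\<^sub>R (\<integral>x. indicator torus x *\<^sub>R F x \<partial>lborel)"
    by (rule integral_scaleR_right)
  also have "(\<integral>x. indicator torus x *\<^sub>R F x \<partial>lborel) = (\<integral>x. indicator torus x *\<^sub>R F x \<partial>lebesgue)"
    by (rule integral_completion[symmetric]) measurable
  finally show ?thesis by (simp add: set_lebesgue_integral_def)
qed

lemma tconv_trig_poly:
  fixes f :: "real^'d \<Rightarrow> complex"
  assumes f: "Lp_le 1 f a" and per: "periodic_fun f"
  shows "tconv f (trig_poly \<Lambda> c) = trig_poly \<Lambda> (\<lambda>k. c k * fhat f k)"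
proof
  fix x
  have [measurable]: "f \<in> borel_measurable borel" using f by (simp add: Lp_le_def)
  have "tconv f (trig_poly \<Lambda> c) x = (\<integral>y. f (x - y) * trig_poly \<Lambda> c y \<partial>tm)"
    by (subst integral_tm_lebesgue) (auto simp: tconv_def scaleR_conv_of_real)
  then show "tconv f (trig_poly \<Lambda> c) x = trig_poly \<Lambda> (\<lambda>k. c k * fhat f k) x"
    by (simp add: integral_reflect_trig_poly[OF f per])
qed

lemma Lp_le_convolution:
  fixes f K :: "real^'d \<Rightarrow> complex"
  assumes f: "Lp_le p f a" and per: "periodic_fun f" and K: "Lp_le 1 K b" and p: "1 \<le> p"
  shows "Lp_le p (\<lambda>x. \<integral>y. f (x - y) * K y \<partial>tm) (b * a)"
proof -
  have [measurable]: "f \<in> borel_measurable borel" "K \<in> borel_measurable borel"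
    using f K by (auto simp: Lp_le_def)
  have ab: "0 \<le> a" "0 \<le> b" using f K by (auto simp: Lp_le_def)
  show ?thesis
  proof (cases "b = 0")
    case True
    then have "AE y in tm. K y = 0" using Lp_le_zero_AE[of 1 K] K by auto
    then have "AE y in tm. f (x - y) * K y = 0" for x by eventually_elim simp
    then have "(\<integral>y. f (x - y) * K y \<partial>tm) = 0" for x
      by (rule integral_eq_zero_AE)
    then show ?thesis using True Lp_le_zero[of p] p by simp
  next
    case False
    then have b: "b > 0" using ab by simp
    have Kb: "(\<integral>\<^sup>+t. ennreal (norm (K t)) \<partial>tm) \<le> ennreal b"
      using K by (rule Lp_le_1_nn_integral)
    have "Lp_le p (\<lambda>x. \<integral>y. f (x - y) * K y \<partial>tm) ((b powr (p - 1) * (a powr p * b)) powr (1/p))"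
    proof (rule Lp_le_integral_kernel[where w="\<lambda>t. norm (K t)" and b="\<lambda>_. a powr p"])
      show "(\<integral>\<^sup>+x. ennreal (norm (f (x - t)) powr p) \<partial>tm) \<le> ennreal (a powr p)" for t
        using Lp_le_translate[OF f per, of "-t"] by (simp add: Lp_le_def)
      have "(\<integral>\<^sup>+t. ennreal (a powr p * norm (K t)) \<partial>tm) = ennreal (a powr p) * (\<integral>\<^sup>+t. ennreal (norm (K t)) \<partial>tm)"
        by (subst nn_integral_cmult[symmetric]) (auto simp: ennreal_mult)
      also have "\<dots> \<le> ennreal (a powr p) * ennreal b"
        by (intro mult_left_mono Kb) auto
      finally show "(\<integral>\<^sup>+t. ennreal (a powr p * norm (K t)) \<partial>tm) \<le> ennreal (a powr p * b)"
        using b by (simp add: ennreal_mult)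
    qed (use p b Kb in auto)
    also have "(b powr (p - 1) * (a powr p * b)) powr (1/p) = b * a"
    proof -
      have "b powr (p - 1) * (a powr p * b) = (b * a) powr p"
        using b ab by (simp add: powr_mult powr_diff)
      then show ?thesis using p b ab by (simp add: powr_powr)
    qed
    finally show ?thesis .
  qed
qed

section \<open>The de la Vallee-Poussin kernel; Bernstein and Nikol'skii inequalities\<close>

definition cube :: "int set \<Rightarrow> (int^'d) set" where
  "cube S = {k. \<forall>i. k$i \<in> S}"

abbreviation Box :: "nat \<Rightarrow> (int^'d) set" where
  "Box n \<equiv> cube {- int n..int n}"

lemma sum_cube_prod:
  fixes g :: "'d::finite \<Rightarrow> int \<Rightarrow> 'b :: comm_semiring_1"
  assumes "finite S"
  shows "(\<Sum>k\<in>cube S. \<Prod>i\<in>UNIV. g i (k$i)) = (\<Prod>i\<in>UNIV. \<Sum>j\<in>S. g i j)"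
proof -
  have "bij_betw vec_lambda (Pi\<^sub>E UNIV (\<lambda>_::'d. S)) (cube S)"
    by (rule bij_betw_byWitness[where f'=vec_nth]) (auto simp: cube_def vec_lambda_inverse vec_nth_inverse)
  then have "(\<Sum>k\<in>cube S. \<Prod>i\<in>UNIV. g i (k$i)) = (\<Sum>h\<in>Pi\<^sub>E UNIV (\<lambda>_. S). \<Prod>i\<in>UNIV. g i (vec_lambda h $ i))"
    by (rule sum.reindex_bij_betw[symmetric])
  also have "\<dots> = (\<Prod>i\<in>UNIV. \<Sum>j\<in>S. g i j)"
    using assms by (subst prod_sum_PiE) auto
  finally show ?thesis .
qed

lemma finite_cube [simp]:
  assumes "finite S"
  shows "finite (cube S :: (int^'d) set)"
proof -
  have "cube S \<subseteq> vec_lambda ` (Pi\<^sub>E (UNIV::'d set) (\<lambda>_. S))"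
  proof
    fix k :: "int^'d" assume "k \<in> cube S"
    then have "vec_nth k \<in> Pi\<^sub>E UNIV (\<lambda>_. S)" by (auto simp: cube_def)
    then have "vec_lambda (vec_nth k) \<in> vec_lambda ` (Pi\<^sub>E UNIV (\<lambda>_. S))" by blast
    then show "k \<in> vec_lambda ` (Pi\<^sub>E UNIV (\<lambda>_. S))" by simp
  qed
  then show ?thesis
    by (rule finite_subset) (intro finite_imageI finite_PiE, use assms in auto)
qed

lemma card_cube:
  assumes "finite S"
  shows "card (cube S :: (int^'d) set) = card S ^ CARD('d)"
  using sum_cube_prod[OF assms, of "\<lambda>(_::'d) _. 1::nat"] by simp

lemma tchar_prod: "tchar k x = (\<Prod>i\<in>UNIV. exp (\<i> * of_real (of_int (k$i) * x$i)))"
  by (simp add: tchar_def sum_distrib_left exp_sum)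

lemma trig_poly_cube_prod:
  assumes "finite S"
  shows "trig_poly (cube S) (\<lambda>k. \<Prod>i\<in>UNIV. c (k$i)) x
     = (\<Prod>i\<in>UNIV. \<Sum>j\<in>S. c j * exp (\<i> * of_real (of_int j * x$i)))"
  unfolding trig_poly_tchar tchar_prod prod.distrib[symmetric]
  by (rule sum_cube_prod[OF assms, of "\<lambda>i j. c j * exp (\<i> * of_real (of_int j * x$i))"])

text \<open>For l > 0 the trapezoidal multiplier of the kernel: 1 for |j| \<le> l, then linear down
  to 0 at |j| = 2l.\<close>

definition vcoef1 :: "nat \<Rightarrow> int \<Rightarrow> real" where
  "vcoef1 l j = max 0 (min 1 (2 - of_int \<bar>j\<bar> / real l))"

definition vcoef :: "nat \<Rightarrow> int^'d \<Rightarrow> real" where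
  "vcoef l k = (\<Prod>i\<in>UNIV. vcoef1 l (k$i))"

lemma vp1_coeffs:
  assumes "0 < l"
  shows "vp1 l t = (\<Sum>j\<in>{- int (2*l)..int (2*l)}. of_real (vcoef1 l j) * exp (\<i> * of_real (of_int j * t)))"
proof -
  let ?E = "\<lambda>j::int. exp (\<i> * complex_of_real (of_int j * t))"
  let ?J = "{- int (2*l)..int (2*l)}"
  have D: "dirichlet k t = (\<Sum>j\<in>?J. if \<bar>j\<bar> \<le> int k then ?E j else 0)" if "k \<in> {l..2*l-1}" for k
  proof -
    have "{j\<in>?J. \<bar>j\<bar> \<le> int k} = {- int k..int k}" using that by auto
    then show ?thesis by (simp add: dirichlet_def flip: sum.inter_filter)
  qed
  \<comment> \<open>The multiplier at j is the proportion of the orders k whose Dirichlet kernel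
    contains the frequency j.\<close>
  have c: "(\<Sum>k\<in>{l..2*l-1}. if \<bar>j\<bar> \<le> int k then 1 else 0 :: real) = real l * vcoef1 l j" if "j \<in> ?J" for j
  proof -
    have "{k\<in>{l..2*l-1}. \<bar>j\<bar> \<le> int k} = {max l (nat \<bar>j\<bar>)..2*l-1}" by auto
    then have "(\<Sum>k\<in>{l..2*l-1}. if \<bar>j\<bar> \<le> int k then 1 else 0 :: real) = real (2*l - max l (nat \<bar>j\<bar>))"
      using assms by (simp flip: sum.inter_filter) 
    also have "\<dots> = real l * vcoef1 l j"
    proof (cases "\<bar>j\<bar> \<le> int l")
      case True
      then have "2 - of_int \<bar>j\<bar> / real l \<ge> 1" using assms by (simp add: field_simps)
      then have "vcoef1 l j = 1" by (simp add: vcoef1_def)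
      then show ?thesis using True by (auto simp: max_def)
    next
      case False
      then have m: "max l (nat \<bar>j\<bar>) = nat \<bar>j\<bar>" "nat \<bar>j\<bar> \<le> 2*l" using that by auto
      have "2 - of_int \<bar>j\<bar> / real l \<le> 1" "2 - of_int \<bar>j\<bar> / real l \<ge> 0"
        using assms False that by (auto simp: field_simps)
      then have "vcoef1 l j = 2 - of_int \<bar>j\<bar> / real l" by (simp add: vcoef1_def)
      then show ?thesis using m assms by (simp add: of_nat_diff field_simps)
    qed
    finally show ?thesis .
  qed
  have "(\<Sum>k\<in>{l..2*l-1}. dirichlet k t) = (\<Sum>k\<in>{l..2*l-1}. \<Sum>j\<in>?J. of_real (if \<bar>j\<bar> \<le> int k then 1 else 0) * ?E j)"
    using D by (intro sum.cong) (auto intro!: sum.cong)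
  also have "\<dots> = (\<Sum>j\<in>?J. of_real (\<Sum>k\<in>{l..2*l-1}. if \<bar>j\<bar> \<le> int k then 1 else 0) * ?E j)"
    by (subst sum.swap) (simp only: of_real_sum sum_distrib_right)
  also have "\<dots> = (\<Sum>j\<in>?J. of_real (real l * vcoef1 l j) * ?E j)"
    by (intro sum.cong refl) (simp only: c)
  finally show ?thesis using assms by (simp add: vp1_def sum_distrib_left mult.assoc)
qed

lemma vp_trig_poly:
  assumes "0 < l"
  shows "vp l = trig_poly (Box (2*l)) (\<lambda>k. of_real (vcoef l k))"
proof
  fix x :: "real^'a"
  show "vp l x = trig_poly (Box (2*l)) (\<lambda>k. of_real (vcoef l k)) x"
    using trig_poly_cube_prod[of "{- int (2*l)..int (2*l)}" "\<lambda>j. of_real (vcoef1 l j)" x]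
    unfolding vp_def vcoef_def vp1_coeffs[OF assms] by simp
qed

text \<open>A factorisation into geometric sums of 3l and l terms. It replaces closed formulas for
  the kernel: Cauchy-Schwarz and Parseval give the L_1 norm, and counting terms gives the
  supremum.\<close>

lemma vp1_product:
  assumes "0 < l"
  shows "of_nat l * vp1 l t = (\<Sum>a\<in>{- int l..2 * int l - 1}. exp (\<i> * of_real (of_int a * t)))
     * cnj (\<Sum>b\<in>{0..int l - 1}. exp (\<i> * of_real (of_int b * t)))"
proof -
  let ?E = "\<lambda>j::int. exp (\<i> * complex_of_real (of_int j * t))"
  have E: "?E a * cnj (?E b) = ?E (a - b)" for a b
    by (simp add: exp_cnj algebra_simps flip: exp_add)
  have "(\<Sum>a\<in>{- int l..2 * int l - 1}. ?E a) * cnj (\<Sum>b\<in>{0..int l - 1}. ?E b)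
      = (\<Sum>b\<in>{0..int l - 1}. \<Sum>a\<in>{- int l..2 * int l - 1}. ?E (a - b))"
    by (simp only: cnj_sum sum_product E) (rule sum.swap)
  also have "\<dots> = (\<Sum>b\<in>{0..int l - 1}. \<Sum>j\<in>{- int l - b..2 * int l - 1 - b}. ?E j)"
    by (intro sum.cong refl sum.reindex_bij_witness[where i="\<lambda>j. j + _" and j="\<lambda>a. a - _"]) auto
  \<comment> \<open>The intervals are cut at 0 and their upper parts reordered by b -> l - 1 - b;
    the two parts belonging to b then form the symmetric interval of the Dirichlet kernel of order l
    + b.\<close>
  also have "\<dots> = (\<Sum>b\<in>{0..int l - 1}. (\<Sum>j\<in>{- int l - b..-1}. ?E j) + (\<Sum>j\<in>{0..2 * int l - 1 - b}. ?E j))"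
  proof (intro sum.cong refl)
    fix b assume "b \<in> {0..int l - 1}"
    then have "{- int l - b..2 * int l - 1 - b} = {- int l - b..-1} \<union> {0..2 * int l - 1 - b}" by auto
    then show "(\<Sum>j\<in>{- int l - b..2 * int l - 1 - b}. ?E j) = (\<Sum>j\<in>{- int l - b..-1}. ?E j) + (\<Sum>j\<in>{0..2 * int l - 1 - b}. ?E j)"
      by (simp only:) (rule sum.union_disjoint, auto)
  qed
  also have "\<dots> = (\<Sum>b\<in>{0..int l - 1}. \<Sum>j\<in>{- int l - b..-1}. ?E j) + (\<Sum>b\<in>{0..int l - 1}. \<Sum>j\<in>{0..2 * int l - 1 - b}. ?E j)"
    by (rule sum.distrib)
  also have "(\<Sum>b\<in>{0..int l - 1}. \<Sum>j\<in>{0..2 * int l - 1 - b}. ?E j) = (\<Sum>b\<in>{0..int l - 1}. \<Sum>j\<in>{0..int l + b}. ?E j)"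
    by (rule sum.reindex_bij_witness[where i="\<lambda>b. int l - 1 - b" and j="\<lambda>b. int l - 1 - b"]) (auto simp: algebra_simps)
  also have "(\<Sum>b\<in>{0..int l - 1}. \<Sum>j\<in>{- int l - b..-1}. ?E j) + (\<Sum>b\<in>{0..int l - 1}. \<Sum>j\<in>{0..int l + b}. ?E j)
     = (\<Sum>b\<in>{0..int l - 1}. \<Sum>j\<in>{- int l - b..int l + b}. ?E j)"
    unfolding sum.distrib[symmetric]
  proof (intro sum.cong refl)
    fix b assume "b \<in> {0..int l - 1}"
    then have "{- int l - b..int l + b} = {- int l - b..-1} \<union> {0..int l + b}" by auto
    then show "(\<Sum>j\<in>{- int l - b..-1}. ?E j) + (\<Sum>j\<in>{0..int l + b}. ?E j) = (\<Sum>j\<in>{- int l - b..int l + b}. ?E j)"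
      by (simp only:) (rule sum.union_disjoint[symmetric], auto)
  qed
  also have "\<dots> = (\<Sum>k\<in>{l..2*l-1}. dirichlet k t)"
    unfolding dirichlet_def
    by (rule sum.reindex_bij_witness[where i="\<lambda>k. int k - int l" and j="\<lambda>b. nat (b + int l)"])
      (use assms in \<open>auto simp: algebra_simps intro!: sum.cong\<close>)
  finally show ?thesis using assms by (simp add: vp1_def)
qed

abbreviation cube_sum :: "int set \<Rightarrow> real^'d \<Rightarrow> complex" where
  "cube_sum S \<equiv> trig_poly (cube S) (\<lambda>_. 1)"

lemma cube_sum_prod:
  assumes "finite S"
  shows "cube_sum S x = (\<Prod>i\<in>UNIV. \<Sum>j\<in>S. exp (\<i> * of_real (of_int j * x$i)))"
  using trig_poly_cube_prod[OF assms, of "\<lambda>_. 1" x] by simp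

lemma vp_product:
  fixes x :: "real^'d"
  assumes "0 < l"
  shows "vp l x = (1 / of_nat l ^ CARD('d)) * (cube_sum {- int l..2 * int l - 1} x * cnj (cube_sum {0..int l - 1} x))"
proof -
  have "of_nat l ^ CARD('d) * vp l x = (\<Prod>i\<in>UNIV. of_nat l * vp1 l (x$i))"
    by (simp add: vp_def prod.distrib)
  also have "\<dots> = cube_sum {- int l..2 * int l - 1} x * cnj (cube_sum {0..int l - 1} x)"
    unfolding vp1_product[OF assms] prod.distrib by (simp add: cube_sum_prod)
  finally show ?thesis using assms by (simp add: field_simps)
qed

lemma Lp_le_2_cube_sum:
  assumes "finite S"
  shows "Lp_le 2 (cube_sum S :: real^'d \<Rightarrow> complex) (sqrt (real (card S) ^ CARD('d)))"
  using Lp_le_2_trig_poly[of "cube S :: (int^'d) set" "\<lambda>_. 1"] assms by (simp add: card_cube)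

lemma cnj_measurable [measurable]: "cnj \<in> borel_measurable borel"
  by (intro borel_measurable_continuous_onI continuous_intros)

lemma Lp_le_cnj: "Lp_le p f a \<Longrightarrow> Lp_le p (\<lambda>x. cnj (f x)) a"
  by (auto simp: Lp_le_def)

lemma Lp_le_1_product:
  assumes "Lp_le 2 f a" "Lp_le 2 g b"
  shows "Lp_le 1 (\<lambda>x. f x * cnj (g x)) (a * b)"
  by (rule Lp_le_Holder[OF assms(1) Lp_le_cnj[OF assms(2)]]) auto

lemma vp_measurable [measurable]: "0 < l \<Longrightarrow> vp l \<in> borel_measurable borel"
  by (simp add: vp_trig_poly)

lemma Lp_le_1_vp:
  assumes "0 < l"
  shows "Lp_le 1 (vp l :: real^'d \<Rightarrow> complex) (3 ^ CARD('d))"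
proof -
  let ?d = "CARD('d)"
  have "Lp_le 1 (\<lambda>x::real^'d. cube_sum {- int l..2 * int l - 1} x * cnj (cube_sum {0..int l - 1} x))
      (sqrt (real (3*l) ^ ?d) * sqrt (real l ^ ?d))"
  proof (rule Lp_le_1_product)
    show "Lp_le 2 (cube_sum {- int l..2 * int l - 1} :: real^'d \<Rightarrow> complex) (sqrt (real (3*l) ^ ?d))"
      using Lp_le_2_cube_sum[of "{- int l..2 * int l - 1}", where 'd='d] by (simp add: nat_add_distrib)
    show "Lp_le 2 (cube_sum {0..int l - 1} :: real^'d \<Rightarrow> complex) (sqrt (real l ^ ?d))"
      using Lp_le_2_cube_sum[of "{0..int l - 1}", where 'd='d] by simp
  qed
  from Lp_le_cmult[OF this, of "1 / of_nat l ^ ?d"]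
  have "Lp_le 1 (vp l :: real^'d \<Rightarrow> complex) (norm (1 / of_nat l ^ ?d :: complex) * (sqrt (real (3*l) ^ ?d) * sqrt (real l ^ ?d)))"
    by (simp add: vp_product[OF assms, abs_def])
  \<comment> \<open>The exact value is \<open>sqrt (3 ^ ?d)\<close>. Rounding it up to the constant
    of \<open>norm_vp_le\<close> lets the interpolation in \<open>Lp_le_vp\<close> keep a single
    constant.\<close>
  moreover have "norm (1 / of_nat l ^ ?d :: complex) * (sqrt (real (3*l) ^ ?d) * sqrt (real l ^ ?d)) \<le> 3 ^ ?d"
  proof -
    have "sqrt (real (3*l) ^ ?d) * sqrt (real l ^ ?d) = sqrt (3 ^ ?d) * (sqrt (real l ^ ?d) * sqrt (real l ^ ?d))"
      by (simp add: power_mult_distrib real_sqrt_mult)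
    also have "sqrt (real l ^ ?d) * sqrt (real l ^ ?d) = real l ^ ?d" by simp
    finally have "norm (1 / of_nat l ^ ?d :: complex) * (sqrt (real (3*l) ^ ?d) * sqrt (real l ^ ?d)) = sqrt (3 ^ ?d)"
      using assms by (simp add: norm_divide norm_power)
    also have "\<dots> \<le> 3 ^ ?d"
      by (rule real_le_lsqrt) (auto simp: power2_eq_square mult_le_cancel_left1)
    finally show ?thesis .
  qed
  ultimately show ?thesis by (rule Lp_le_mono) simp
qed

lemma norm_cube_sum_le:
  fixes x :: "real^'d"
  assumes "finite S"
  shows "norm (cube_sum S x) \<le> real (card S) ^ CARD('d)"
  using norm_trig_poly_le[of "cube S" "\<lambda>_. 1" x] assms by (simp add: card_cube)

lemma norm_vp_le:
  fixes x :: "real^'d"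
  assumes "0 < l"
  shows "norm (vp l x) \<le> 3 ^ CARD('d) * real l ^ CARD('d)"
proof -
  let ?d = "CARD('d)"
  have "norm (vp l x) = 1 / real l ^ ?d * (norm (cube_sum {- int l..2 * int l - 1} x) * norm (cube_sum {0..int l - 1} x))"
    by (simp add: vp_product[OF assms] norm_mult norm_divide norm_power)
  also have "\<dots> \<le> 1 / real l ^ ?d * (real (3*l) ^ ?d * real l ^ ?d)"
    using norm_cube_sum_le[of "{- int l..2 * int l - 1}" x] norm_cube_sum_le[of "{0..int l - 1}" x]
    by (intro mult_left_mono mult_mono) (auto simp: nat_add_distrib)
  also have "\<dots> = 3 ^ ?d * real l ^ ?d"
    using assms by (simp add: power_mult_distrib)
  finally show ?thesis .
qed

lemma Lp_le_vp:
  assumes "0 < l" "1 \<le> p"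
  shows "Lp_le p (vp l :: real^'d \<Rightarrow> complex) (3 ^ CARD('d) * real l powr (CARD('d) * (1 - 1/p)))"
proof -
  let ?d = "CARD('d)"
  have "Lp_le p (vp l :: real^'d \<Rightarrow> complex) ((3 ^ ?d * real l ^ ?d) powr (1 - 1/p) * (3 ^ ?d) powr (1/p))"
    by (rule Lp_le_interpolate[OF Lp_le_1_vp]) (use assms norm_vp_le in auto)
  also have "(3 ^ ?d * real l ^ ?d) powr (1 - 1/p) * (3 ^ ?d) powr (1/p)
      = ((3 ^ ?d) powr (1 - 1/p) * (3 ^ ?d) powr (1/p)) * (real l ^ ?d) powr (1 - 1/p)"
    by (simp add: powr_mult)
  also have "(3 ^ ?d :: real) powr (1 - 1/p) * (3 ^ ?d) powr (1/p) = 3 ^ ?d"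
    by (simp flip: powr_add)
  also have "(real l ^ ?d) powr (1 - 1/p) = real l powr (?d * (1 - 1/p))"
    using assms by (simp add: powr_powr flip: powr_realpow)
  finally show ?thesis .
qed

section \<open>Inequalities of Bernstein and Nikol'skii\<close>

lemma fdiff1_trig_poly: "fdiff1 h (trig_poly \<Lambda> c) = trig_poly \<Lambda> (\<lambda>k. c k * (tchar k h - 1))"
  by (simp add: fun_eq_iff fdiff1_def trig_poly_tchar tchar_add algebra_simps sum_subtractf)

lemma norm_exp_i_minus_1: "norm (exp (\<i> * of_real t) - 1) \<le> \<bar>t\<bar>"
  using abs_sin_x_le_abs_x[of "t/2"] by (simp add: dist_exp_i_1)

lemma norm_tchar_minus_1:
  fixes h :: "real^'d"
  assumes "k \<in> Box n"
  shows "norm (tchar k h - 1) \<le> real CARD('d) * real n * norm h"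
proof -
  have "norm (tchar k h - 1) \<le> \<bar>\<Sum>j\<in>UNIV. of_int (k$j) * h$j\<bar>"
    unfolding tchar_def by (rule norm_exp_i_minus_1)
  also have "\<dots> \<le> (\<Sum>j\<in>UNIV. \<bar>of_int (k$j) * h$j\<bar>)" by (rule sum_abs)
  also have "\<dots> \<le> (\<Sum>j\<in>(UNIV::'d set). real n * norm h)"
  proof (rule sum_mono)
    fix j
    have "\<bar>k$j\<bar> \<le> int n" using assms by (auto simp: cube_def abs_le_iff minus_le_iff)
    then have "\<bar>real_of_int (k$j)\<bar> \<le> real n" by linarith
    then show "\<bar>of_int (k$j) * h$j\<bar> \<le> real n * norm h"
      unfolding abs_mult by (intro mult_mono component_le_norm_cart) auto
  qed
  finally show ?thesis by simp
qed

lemma Lp_le_2_fdiff1_cube_sum: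
  assumes "S \<subseteq> {- int n..int n}"
  shows "Lp_le 2 (fdiff1 h (cube_sum S) :: real^'d \<Rightarrow> complex)
     (sqrt (real (card S) ^ CARD('d)) * (real CARD('d) * real n * norm h))"
proof -
  let ?b = "real CARD('d) * real n * norm h"
  have fin: "finite S" using assms finite_subset by blast
  have "Lp_le 2 (fdiff1 h (cube_sum S) :: real^'d \<Rightarrow> complex) (sqrt (\<Sum>k\<in>cube S. (norm (1 * (tchar k h - 1)))\<^sup>2))"
    unfolding fdiff1_trig_poly by (rule Lp_le_2_trig_poly) (use fin in simp)
  moreover have "sqrt (\<Sum>k\<in>cube S. (norm (1 * (tchar k h - 1)))\<^sup>2) \<le> sqrt (real (card S) ^ CARD('d)) * ?b"
  proof -
    have "(\<Sum>k\<in>cube S. (norm (1 * (tchar k h - 1)))\<^sup>2) \<le> (\<Sum>k\<in>(cube S :: (int^'d) set). ?b\<^sup>2)"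
    proof (rule sum_mono)
      fix k :: "int^'d" assume "k \<in> cube S"
      then have "k \<in> Box n" using assms by (auto simp: cube_def)
      then show "(norm (1 * (tchar k h - 1)))\<^sup>2 \<le> ?b\<^sup>2"
        using norm_tchar_minus_1[of k n h] by (intro power_mono) auto
    qed
    also have "\<dots> = real (card S) ^ CARD('d) * ?b\<^sup>2" by (simp add: card_cube[OF fin])
    finally have "sqrt (\<Sum>k\<in>cube S. (norm (1 * (tchar k h - 1)))\<^sup>2) \<le> sqrt (real (card S) ^ CARD('d) * ?b\<^sup>2)"
      by (rule real_sqrt_le_mono)
    also have "\<dots> = sqrt (real (card S) ^ CARD('d)) * ?b"
      by (simp only: real_sqrt_mult real_sqrt_abs) simp
    finally show ?thesis .
  qed
  ultimately show ?thesis by (rule Lp_le_mono) simp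
qed

text \<open>Leibniz rule for differences applied to the factorisation \<open>vp_product\<close>: one
  factor is differenced at a time, and in L_2 the difference acts on coefficients through
  \<open>tchar k h - 1\<close>. The 4 comes from two summands and frequencies up to 2l.\<close>

lemma Lp_le_1_fdiff1_vp:
  assumes "0 < l"
  shows "Lp_le 1 (fdiff1 h (vp l) :: real^'d \<Rightarrow> complex) (4 * real CARD('d) * 3 ^ CARD('d) * real l * norm h)"
proof -
  let ?d = "CARD('d)"
  let ?A = "cube_sum {- int l..2 * int l - 1} :: real^'d \<Rightarrow> complex"
  let ?B = "cube_sum {0..int l - 1} :: real^'d \<Rightarrow> complex"
  let ?b = "real ?d * real (2*l) * norm h"
  let ?a = "sqrt (real (3*l) ^ ?d)" and ?c = "sqrt (real l ^ ?d)"
  have A: "Lp_le 2 ?A ?a" and B: "Lp_le 2 ?B ?c"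
    using Lp_le_2_cube_sum[of "{- int l..2 * int l - 1}", where 'd='d] Lp_le_2_cube_sum[of "{0..int l - 1}", where 'd='d]
    by (simp_all add: nat_add_distrib)
  have DA: "Lp_le 2 (fdiff1 h ?A) (?a * ?b)" and DB: "Lp_le 2 (fdiff1 h ?B) (?c * ?b)"
    using Lp_le_2_fdiff1_cube_sum[of "{- int l..2 * int l - 1}" "2*l" h] Lp_le_2_fdiff1_cube_sum[of "{0..int l - 1}" "2*l" h]
    by (simp_all add: nat_add_distrib)
  have Bh: "Lp_le 2 (\<lambda>x. ?B (x + h)) ?c"
    by (rule Lp_le_translate[OF B periodic_trig_poly])
  have "Lp_le 1 (\<lambda>x. fdiff1 h ?A x * cnj (?B (x + h)) + ?A x * cnj (fdiff1 h ?B x)) (?a * ?b * ?c + ?a * (?c * ?b))"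
    by (intro Lp_le_add Lp_le_1_product DA Bh A DB) simp
  from Lp_le_cmult[OF this, of "1 / of_nat l ^ ?d"]
  have "Lp_le 1 (\<lambda>x. 1 / of_nat l ^ ?d * (fdiff1 h ?A x * cnj (?B (x + h)) + ?A x * cnj (fdiff1 h ?B x)))
     (norm (1 / of_nat l ^ ?d :: complex) * (?a * ?b * ?c + ?a * (?c * ?b)))" by simp
  also have "(\<lambda>x. 1 / of_nat l ^ ?d * (fdiff1 h ?A x * cnj (?B (x + h)) + ?A x * cnj (fdiff1 h ?B x))) = fdiff1 h (vp l)"
    by (simp add: fun_eq_iff fdiff1_def vp_product[OF assms] algebra_simps add_divide_distrib diff_divide_distrib)
  finally have "Lp_le 1 (fdiff1 h (vp l) :: real^'d \<Rightarrow> complex) (norm (1 / of_nat l ^ ?d :: complex) * (?a * ?b * ?c + ?a * (?c * ?b)))" .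
  moreover have "norm (1 / of_nat l ^ ?d :: complex) * (?a * ?b * ?c + ?a * (?c * ?b)) \<le> 4 * real ?d * 3 ^ ?d * real l * norm h"
  proof -
    have ac: "?a * ?c = sqrt (3 ^ ?d) * real l ^ ?d"
      by (simp add: power_mult_distrib real_sqrt_mult)
    have "norm (1 / of_nat l ^ ?d :: complex) * (?a * ?b * ?c + ?a * (?c * ?b)) = 1 / real l ^ ?d * ((?a * ?c) * (2 * ?b))"
      by (simp add: norm_divide norm_power)
    also have "\<dots> = sqrt (3 ^ ?d) * (2 * ?b)" unfolding ac using assms by simp
    also have "\<dots> \<le> 3 ^ ?d * (2 * ?b)"
      by (intro mult_right_mono real_le_lsqrt) (auto simp: power2_eq_square mult_le_cancel_left1)
    also have "\<dots> = 4 * real ?d * 3 ^ ?d * real l * norm h" by simp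
    finally show ?thesis .
  qed
  ultimately show ?thesis by (rule Lp_le_mono) simp
qed

lemma vcoef1_bounds: "0 \<le> vcoef1 l j" "vcoef1 l j \<le> 1"
  by (auto simp: vcoef1_def)

lemma vcoef_bounds: "0 \<le> vcoef l k" "vcoef l k \<le> 1"
  unfolding vcoef_def by (auto intro!: prod_nonneg prod_le_1 vcoef1_bounds)

lemma vcoef_one:
  assumes "k \<in> Box l"
  shows "vcoef l k = 1"
proof -
  have "vcoef1 l (k$i) = 1" for i
  proof -
    have "\<bar>k$i\<bar> \<le> int l" using assms by (auto simp: cube_def abs_le_iff minus_le_iff)
    then have "of_int \<bar>k$i\<bar> \<le> real l" by linarith
    then have "of_int \<bar>k$i\<bar> / real l \<le> 1" by (cases "l = 0") (auto simp: divide_le_eq_1)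
    then show ?thesis by (simp add: vcoef1_def)
  qed
  then show ?thesis by (simp add: vcoef_def)
qed

lemma vcoef_zero:
  assumes "k \<notin> Box (2*l)" "0 < l"
  shows "vcoef l k = 0"
proof -
  obtain i where "\<not> (- int (2*l) \<le> k$i \<and> k$i \<le> int (2*l))" using assms by (auto simp: cube_def)
  then have "\<bar>k$i\<bar> > int (2*l)" by linarith
  then have "of_int \<bar>k$i\<bar> > 2 * real l" by linarith
  then have "2 - of_int \<bar>k$i\<bar> / real l \<le> 0" using assms by (simp add: field_simps)
  then have "vcoef1 l (k$i) = 0" by (simp add: vcoef1_def)
  then show ?thesis by (auto simp: vcoef_def)
qed

lemma vp_op_trig_poly:
  assumes "Lp_le 1 f a" "periodic_fun f" "0 < l"
  shows "vp_op l f = trig_poly (Box (2*l)) (\<lambda>k. of_real (vcoef l k) * fhat f k)"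
  unfolding vp_op_def vp_trig_poly[OF assms(3)] by (rule tconv_trig_poly[OF assms(1,2)])

lemma vp_op_integral:
  assumes "Lp_le 1 f a" "periodic_fun f" "0 < l"
  shows "vp_op l f = (\<lambda>x. \<integral>y. f (x - y) * vp l y \<partial>tm)"
  unfolding vp_op_trig_poly[OF assms] vp_trig_poly[OF assms(3)] integral_reflect_trig_poly[OF assms(1,2)] ..

lemma Lp_le_vp_op:
  fixes f :: "real^'d \<Rightarrow> complex"
  assumes "Lp_le p f a" "periodic_fun f" "0 < l" "1 \<le> p"
  shows "Lp_le p (vp_op l f) (3 ^ CARD('d) * a)"
proof -
  have 1: "Lp_le 1 f a" by (rule Lp_le_exponent_mono[OF assms(1)]) (use assms in auto)
  show ?thesis unfolding vp_op_integral[OF 1 assms(2,3)]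
    by (rule Lp_le_convolution[OF assms(1,2) Lp_le_1_vp]) (use assms in auto)
qed

lemma Lp_le_trig_poly_trivial:
  "0 < p \<Longrightarrow> Lp_le p (trig_poly \<Lambda> c) (\<Sum>k\<in>\<Lambda>. norm (c k))"
  by (rule Lp_le_bounded) (auto intro: norm_trig_poly_le)

lemma cube_mono: "S \<subseteq> T \<Longrightarrow> cube S \<subseteq> cube T"
  by (auto simp: cube_def)

lemma Box_mono: "m \<le> n \<Longrightarrow> Box m \<subseteq> Box n"
  by (rule cube_mono) auto

lemma vp_op_id:
  fixes \<Lambda> :: "(int^'d) set"
  assumes "\<Lambda> \<subseteq> Box l" "0 < l"
  shows "vp_op l (trig_poly \<Lambda> c) = trig_poly \<Lambda> c"
proof -
  have fin: "finite \<Lambda>" using assms(1) by (rule finite_subset) simp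
  have "vp_op l (trig_poly \<Lambda> c) = trig_poly (Box (2*l)) (\<lambda>k. of_real (vcoef l k) * fhat (trig_poly \<Lambda> c) k)"
    by (rule vp_op_trig_poly[OF Lp_le_trig_poly_trivial periodic_trig_poly assms(2)]) simp
  also have "\<dots> = trig_poly \<Lambda> (\<lambda>k. of_real (vcoef l k) * fhat (trig_poly \<Lambda> c) k)"
    by (rule trig_poly_mono_neutral[symmetric])
      (use assms Box_mono[of l "2*l"] in \<open>auto simp: fhat_trig_poly[OF fin]\<close>)
  also have "\<dots> = trig_poly \<Lambda> c"
    by (rule trig_poly_cong) (use assms in \<open>auto simp: vcoef_one fhat_trig_poly[OF fin]\<close>)
  finally show ?thesis .
qed

text \<open>Since \<open>vp l\<close> reproduces polynomials with frequencies in
  \<open>Box l\<close>, the difference may fall on the kernel, whose L_1 norm is known. Differences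
  are used instead of derivatives because iterating them bounds moduli of smoothness
  directly.\<close>

lemma Bernstein_difference:
  fixes \<Lambda> :: "(int^'d) set"
  assumes \<Lambda>: "\<Lambda> \<subseteq> Box l" and l: "0 < l" and P: "Lp_le p (trig_poly \<Lambda> c) a" and p: "1 \<le> p"
  shows "Lp_le p (fdiff1 h (trig_poly \<Lambda> c)) (4 * real CARD('d) * 3 ^ CARD('d) * real l * norm h * a)"
proof -
  have fin: "finite \<Lambda>" using \<Lambda> by (rule finite_subset) simp
  let ?P = "trig_poly \<Lambda> c"
  have "(\<integral>y. ?P (x - y) * fdiff1 h (vp l) y \<partial>tm) = fdiff1 h ?P x" for x
  proof -
    have "(\<integral>y. ?P (x - y) * fdiff1 h (vp l) y \<partial>tm)
       = trig_poly (Box (2*l)) (\<lambda>k. of_real (vcoef l k) * (tchar k h - 1) * fhat ?P k) x"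
      unfolding vp_trig_poly[OF l] fdiff1_trig_poly
      by (rule integral_reflect_trig_poly[OF Lp_le_trig_poly_trivial periodic_trig_poly]) simp
    also have "trig_poly (Box (2*l)) (\<lambda>k. of_real (vcoef l k) * (tchar k h - 1) * fhat ?P k)
       = trig_poly \<Lambda> (\<lambda>k. of_real (vcoef l k) * (tchar k h - 1) * fhat ?P k)"
      by (rule trig_poly_mono_neutral[symmetric])
        (use \<Lambda> Box_mono[of l "2*l"] in \<open>auto simp: fhat_trig_poly[OF fin]\<close>)
    also have "\<dots> = fdiff1 h ?P" unfolding fdiff1_trig_poly
      by (rule trig_poly_cong) (use \<Lambda> in \<open>auto simp: vcoef_one fhat_trig_poly[OF fin]\<close>)
    finally show ?thesis .
  qed
  then have "fdiff1 h ?P = (\<lambda>x. \<integral>y. ?P (x - y) * fdiff1 h (vp l) y \<partial>tm)" by simp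
  then show ?thesis
    using Lp_le_convolution[OF P periodic_trig_poly Lp_le_1_fdiff1_vp[OF l, of h] p] by simp
qed

lemma Lp_le_reflect:
  assumes "Lp_le p f a" "periodic_fun f"
  shows "Lp_le p (\<lambda>y. f (x - y)) a"
proof -
  have [measurable]: "f \<in> borel_measurable borel" using assms by (simp add: Lp_le_def)
  have "(\<integral>\<^sup>+y. ennreal (norm (f (x + of_int (-1) *\<^sub>R y)) powr p) \<partial>tm) = (\<integral>\<^sup>+y. ennreal (norm (f y) powr p) \<partial>tm)"
    by (rule nn_integral_tm_dilate[where g="\<lambda>z. ennreal (norm z powr p)"]) (use assms in auto)
  then show ?thesis using assms by (simp add: Lp_le_def)
qed

text \<open>Hoelder in the reproducing identity, with the kernel measured in the dual
  exponent.\<close>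

lemma Nikolskii_sup:
  fixes \<Lambda> :: "(int^'d) set"
  assumes \<Lambda>: "\<Lambda> \<subseteq> Box l" and l: "0 < l" and P: "Lp_le p (trig_poly \<Lambda> c) a" and p: "1 < p"
  shows "norm (trig_poly \<Lambda> c x) \<le> 3 ^ CARD('d) * real l powr (CARD('d) / p) * a"
proof -
  let ?P = "trig_poly \<Lambda> c"
  define q where "q = p / (p - 1)"
  have q: "q > 1" "1/p + 1/q = 1" "1 - 1/q = 1/p" using p by (auto simp: q_def field_simps)
  have "Lp_le 1 (\<lambda>y. ?P (x - y) * vp l y) (a * (3 ^ CARD('d) * real l powr (CARD('d) * (1 - 1/q))))"
    by (rule Lp_le_Holder[OF Lp_le_reflect[OF P periodic_trig_poly] Lp_le_vp[OF l]]) (use p q in auto)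
  then have "norm (\<integral>y. ?P (x - y) * vp l y \<partial>tm) \<le> a * (3 ^ CARD('d) * real l powr (CARD('d) * (1 - 1/q)))"
    by (rule Lp_le_1_integral)
  moreover have "(\<integral>y. ?P (x - y) * vp l y \<partial>tm) = ?P x"
    using vp_op_id[OF \<Lambda> l, of c] vp_op_integral[OF Lp_le_trig_poly_trivial periodic_trig_poly l, of \<Lambda> c]
    by (simp add: fun_eq_iff)
  ultimately show ?thesis using q by (simp add: mult_ac)
qed

lemma Nikolskii:
  fixes \<Lambda> :: "(int^'d) set"
  assumes \<Lambda>: "\<Lambda> \<subseteq> Box l" and l: "0 < l" and P: "Lp_le p (trig_poly \<Lambda> c) a" and p: "1 < p" "p \<le> q"
  shows "Lp_le q (trig_poly \<Lambda> c) (3 ^ CARD('d) * real l powr (CARD('d) * (1/p - 1/q)) * a)"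
proof -
  let ?d = "CARD('d)"
  have a: "0 \<le> a" using P by (simp add: Lp_le_def)
  have "Lp_le q (trig_poly \<Lambda> c) ((3 ^ ?d * real l powr (?d / p) * a) powr (1 - p/q) * a powr (p/q))"
    by (rule Lp_le_interpolate[OF P Nikolskii_sup[OF \<Lambda> l P p(1)]]) (use p in auto)
  moreover have "(3 ^ ?d * real l powr (?d / p) * a) powr (1 - p/q) * a powr (p/q)
      = (3 ^ ?d) powr (1 - p/q) * real l powr (?d * (1/p - 1/q)) * a"
  proof -
    have "(?d / p) * (1 - p/q) = ?d * (1/p - 1/q)" using p by (simp add: field_simps)
    moreover have "a powr (1 - p/q) * a powr (p/q) = a" using a by (simp flip: powr_add)
    ultimately show ?thesis by (simp add: powr_mult powr_powr)
  qed
  moreover have "(3 ^ ?d :: real) powr (1 - p/q) \<le> (3 ^ ?d) powr 1"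
    using p by (intro powr_mono) auto
  then have "(3 ^ ?d) powr (1 - p/q) * real l powr (?d * (1/p - 1/q)) * a \<le> 3 ^ ?d * real l powr (?d * (1/p - 1/q)) * a"
    using a by (intro mult_right_mono) auto
  ultimately show ?thesis using p by (auto intro: Lp_le_mono)
qed

section \<open>Jackson's inequality\<close>

lemma sin_concave: "concave_on {0..pi} sin"
  by (rule f''_le0_imp_concave[where f'=cos and f''="\<lambda>x. - sin x"])
    (auto intro!: derivative_eq_intros sin_ge_zero)

lemma sin_ge_linear:
  assumes "0 \<le> x" "x \<le> pi/2"
  shows "2 / pi * x \<le> sin x"
proof -
  define u where "u = 2 / pi * x"
  have u: "0 \<le> u" "u \<le> 1" using assms by (auto simp: u_def field_simps)
  have "(1 - u) * sin 0 + u * sin (pi/2) \<le> sin ((1 - u) *\<^sub>R 0 + u *\<^sub>R (pi/2))"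
    by (rule concave_onD[OF sin_concave u]) auto
  then show ?thesis using assms by (simp add: u_def)
qed

text \<open>A converse to \<open>norm_exp_i_minus_1\<close> on one period: the Jackson kernel
  controls moments of the periodic quantity on the right, whereas the smoothness condition is
  phrased in |t|.\<close>

lemma abs_le_norm_exp_i_minus_1:
  assumes "\<bar>t\<bar> \<le> pi"
  shows "\<bar>t\<bar> \<le> pi / 2 * norm (exp (\<i> * of_real t) - 1)"
proof -
  have "2 / pi * (\<bar>t\<bar>/2) \<le> sin (\<bar>t\<bar>/2)" by (rule sin_ge_linear) (use assms in auto)
  also have "\<dots> \<le> \<bar>sin (t/2)\<bar>" by (cases "t \<ge> 0") auto
  finally show ?thesis unfolding dist_exp_i_1 by (simp add: field_simps)
qed

text \<open>Degree at most n in each variable, with the coefficients hidden, so that products,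
  powers and conjugates can be handled by closure rules alone.\<close>

definition tdeg :: "nat \<Rightarrow> (real^'d \<Rightarrow> complex) \<Rightarrow> bool" where
  "tdeg n f \<longleftrightarrow> (\<exists>c. f = trig_poly (Box n) c)"

lemma tdeg_trig_poly:
  assumes "\<Lambda> \<subseteq> Box n"
  shows "tdeg n (trig_poly \<Lambda> c)"
proof -
  have "trig_poly \<Lambda> c = trig_poly \<Lambda> (\<lambda>k. if k \<in> \<Lambda> then c k else 0)"
    by (rule trig_poly_cong) simp
  also have "\<dots> = trig_poly (Box n) (\<lambda>k. if k \<in> \<Lambda> then c k else 0)"
    by (rule trig_poly_mono_neutral) (use assms in auto)
  finally show ?thesis unfolding tdeg_def by blast
qed

lemma tdeg_mono: "tdeg m f \<Longrightarrow> m \<le> n \<Longrightarrow> tdeg n f"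
  unfolding tdeg_def[of m] using tdeg_trig_poly[OF Box_mono] by blast

lemma tdeg_mult:
  assumes "tdeg m f" "tdeg n g"
  shows "tdeg (m + n) (\<lambda>x. f x * g x)"
proof -
  obtain a b where f: "f = trig_poly (Box m) a" and g: "g = trig_poly (Box n) b"
    using assms by (auto simp: tdeg_def)
  let ?S = "Box m \<times> Box n :: ((int^'a) \<times> (int^'a)) set"
  define c where "c k = (\<Sum>(u,v)\<in>{z\<in>?S. fst z + snd z = k}. a u * b v)" for k
  have "f x * g x = trig_poly (Box (m + n)) c x" for x
  proof -
    have "f x * g x = (\<Sum>(u,v)\<in>?S. a u * b v * tchar (u + v) x)"
      unfolding f g trig_poly_tchar sum_product by (simp add: tchar_add_freq sum.cartesian_product mult_ac)
    also have "\<dots> = (\<Sum>k\<in>Box (m + n). \<Sum>z\<in>{z\<in>?S. fst z + snd z = k}. case z of (u,v) \<Rightarrow> a u * b v * tchar (u + v) x)"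
    proof (rule sum.group[symmetric])
      show "(\<lambda>z. fst z + snd z) ` ?S \<subseteq> Box (m + n)"
      proof (rule image_subsetI)
        fix z :: "(int^'a) \<times> (int^'a)" assume z: "z \<in> ?S"
        have "- int (m + n) \<le> (fst z + snd z) $ i \<and> (fst z + snd z) $ i \<le> int (m + n)" for i
        proof -
          have "- int m \<le> fst z $ i" "fst z $ i \<le> int m" "- int n \<le> snd z $ i" "snd z $ i \<le> int n"
            using z by (auto simp: cube_def)
          then show ?thesis by simp
        qed
        then show "fst z + snd z \<in> Box (m + n)" by (simp add: cube_def)
      qed
    qed auto
    also have "\<dots> = (\<Sum>k\<in>Box (m + n). c k * tchar k x)"
      unfolding c_def sum_distrib_right by (intro sum.cong refl) auto
    finally show ?thesis by (simp add: trig_poly_tchar)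
  qed
  then show ?thesis unfolding tdeg_def by blast
qed

lemma tdeg_cmult: "tdeg n f \<Longrightarrow> tdeg n (\<lambda>x. c * f x)"
proof -
  assume "tdeg n f"
  then obtain a where "f = trig_poly (Box n) a" by (auto simp: tdeg_def)
  then have "(\<lambda>x. c * f x) = trig_poly (Box n) (\<lambda>k. c * a k)"
    by (simp add: fun_eq_iff trig_poly_tchar sum_distrib_left mult.assoc)
  then show ?thesis unfolding tdeg_def by blast
qed

lemma tdeg_add: "tdeg n f \<Longrightarrow> tdeg n g \<Longrightarrow> tdeg n (\<lambda>x. f x + g x)"
proof -
  assume "tdeg n f" "tdeg n g"
  then obtain a b where "f = trig_poly (Box n) a" "g = trig_poly (Box n) b" by (auto simp: tdeg_def)
  then have "(\<lambda>x. f x + g x) = trig_poly (Box n) (\<lambda>k. a k + b k)"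
    by (simp add: fun_eq_iff trig_poly_tchar sum.distrib distrib_right)
  then show ?thesis unfolding tdeg_def by blast
qed

lemma tdeg_sum: "finite I \<Longrightarrow> (\<And>i. i \<in> I \<Longrightarrow> tdeg n (f i)) \<Longrightarrow> tdeg n (\<lambda>x. \<Sum>i\<in>I. f i x)"
proof (induction I rule: finite_induct)
  case empty
  have "(\<lambda>x. 0) = trig_poly (Box n) (\<lambda>_. 0)" by (simp add: fun_eq_iff trig_poly_def)
  then show ?case unfolding tdeg_def by auto
qed (auto intro: tdeg_add)

lemma tdeg_cnj:
  assumes "tdeg n f"
  shows "tdeg n (\<lambda>x. cnj (f x))"
proof -
  obtain a where f: "f = trig_poly (Box n) a" using assms by (auto simp: tdeg_def)
  have "cnj (f x) = trig_poly (Box n) (\<lambda>k. cnj (a (- k))) x" for x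
    unfolding f trig_poly_tchar cnj_sum complex_cnj_mult cnj_tchar
    by (rule sum.reindex_bij_witness[where i=uminus and j=uminus])
      (auto simp: cube_def minus_le_iff le_minus_iff)
  then show ?thesis unfolding tdeg_def by blast
qed

lemma tdeg_const: "tdeg n (\<lambda>x. c)"
proof -
  have "tdeg n (trig_poly {0} (\<lambda>_. c))" by (rule tdeg_trig_poly) (simp add: cube_def)
  then show ?thesis by (simp add: trig_poly_tchar[abs_def])
qed

lemma tdeg_power: "tdeg n f \<Longrightarrow> tdeg (j * n) (\<lambda>x. f x ^ j)"
  by (induction j) (auto simp: tdeg_const tdeg_mult)

text \<open>The binomial expansion of (S - 1)^k, S being the shift by h; the coefficients depend on
  k alone. The value at 0 is recorded since it is the factor with which f itself enters its
  difference.\<close>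

lemma fdiff_expand:
  "\<exists>a. a 0 = (-1) ^ k \<and> (\<forall>(f :: real^'d \<Rightarrow> complex) h x. fdiff h k f x = (\<Sum>j\<le>k. a j * f (x + real j *\<^sub>R h)))"
proof (induction k)
  case 0
  show ?case by (rule exI[of _ "\<lambda>_. 1"]) simp
next
  case (Suc k)
  then obtain a where a0: "a 0 = (-1) ^ k"
    and a: "\<And>(f :: real^'d \<Rightarrow> complex) h x. fdiff h k f x = (\<Sum>j\<le>k. a j * f (x + real j *\<^sub>R h))" by blast
  define b where "b j = (if j = 0 then 0 else a (j - 1)) - (if j \<le> k then a j else 0)" for j
  have "fdiff h (Suc k) f x = (\<Sum>j\<le>Suc k. b j * f (x + real j *\<^sub>R h))" for f :: "real^'d \<Rightarrow> complex" and h x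
  proof -
    have "(\<Sum>j\<le>Suc k. b j * f (x + real j *\<^sub>R h))
       = (\<Sum>j\<le>Suc k. (if j = 0 then 0 else a (j - 1)) * f (x + real j *\<^sub>R h))
        - (\<Sum>j\<le>Suc k. (if j \<le> k then a j else 0) * f (x + real j *\<^sub>R h))"
      unfolding b_def left_diff_distrib sum_subtractf ..
    also have "(\<Sum>j\<le>Suc k. (if j = 0 then 0 else a (j - 1)) * f (x + real j *\<^sub>R h))
        = (\<Sum>j\<le>k. a j * f (x + h + real j *\<^sub>R h))"
      by (subst sum.atMost_Suc_shift) (simp add: algebra_simps)
    also have "(\<Sum>j\<le>Suc k. (if j \<le> k then a j else 0) * f (x + real j *\<^sub>R h)) = (\<Sum>j\<le>k. a j * f (x + real j *\<^sub>R h))"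
      by simp
    finally show ?thesis by (simp add: fdiff1_def a)
  qed
  moreover have "b 0 = (-1) ^ Suc k" by (simp add: b_def a0)
  ultimately show ?case by blast
qed

text \<open>The map \<open>G\<close> sending \<open>x\<close> to the integral satisfies \<open>G (x + j s) = tchar (- l) s * G x\<close>; periodicity
  then forces \<open>G = 0\<close> unless \<open>j\<close> divides \<open>l\<close>.\<close>

lemma tdeg_dilated_mean:
  fixes f :: "real^'d \<Rightarrow> complex"
  assumes [measurable]: "f \<in> borel_measurable borel" and per: "periodic_fun f" and j: "0 < j" and l: "l \<in> Box n"
  shows "tdeg n (\<lambda>x. \<integral>t. f (x + real j *\<^sub>R t) * tchar l t \<partial>tm)"
proof -
  define G where "G x = (\<integral>t. f (x + real j *\<^sub>R t) * tchar l t \<partial>tm)" for x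
  have perj: "periodic_fun (\<lambda>t. f (real j *\<^sub>R t))"
    unfolding periodic_fun_def
  proof (intro allI)
    fix t i
    have "f (real j *\<^sub>R (t + (2*pi) *\<^sub>R axis i 1)) = f (real j *\<^sub>R t + lat (\<chi> l. if l = i then int j else 0))"
      by (rule arg_cong[of _ _ f]) (auto simp: lat_def vec_eq_iff axis_def algebra_simps)
    then show "f (real j *\<^sub>R (t + (2*pi) *\<^sub>R axis i 1)) = f (real j *\<^sub>R t)"
      by (simp add: periodic_fun_lat[OF per])
  qed
  have G: "G x = G 0 * tchar (- l) ((1 / real j) *\<^sub>R x)" for x
  proof -
    have "G 0 = (\<integral>t. f (real j *\<^sub>R (t + (1 / real j) *\<^sub>R x)) * tchar l (t + (1 / real j) *\<^sub>R x) \<partial>tm)"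
      unfolding G_def
      by (simp, rule integral_tm_translate[where f="\<lambda>t. f (real j *\<^sub>R t) * tchar l t", symmetric])
        (auto intro!: periodic_mult perj periodic_tchar)
    also have "\<dots> = (\<integral>t. (f (x + real j *\<^sub>R t) * tchar l t) * tchar l ((1 / real j) *\<^sub>R x) \<partial>tm)"
      using j by (simp add: tchar_add scaleR_add_right mult.assoc add.commute)
    also have "\<dots> = G x * tchar l ((1 / real j) *\<^sub>R x)"
      unfolding G_def by (rule integral_mult_left_zero)
    finally have "G 0 * tchar (- l) ((1 / real j) *\<^sub>R x)
        = G x * (tchar l ((1 / real j) *\<^sub>R x) * tchar (- l) ((1 / real j) *\<^sub>R x))" by simp
    then show ?thesis by (simp flip: tchar_add_freq)
  qed
  have "tdeg n G"
  proof (cases "\<forall>i. int j dvd l $ i")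
    case True
    define m where "m = (\<chi> i. - (l $ i div int j))"
    have m: "int j * m $ i = - l $ i" for i using True by (simp add: m_def)
    have "tchar (- l) ((1 / real j) *\<^sub>R x) = tchar m x" for x
    proof -
      have "of_int (- l $ i) = real j * of_int (m $ i)" for i
        using arg_cong[OF m[of i, symmetric], of real_of_int] by simp
      then have "(\<Sum>i\<in>UNIV. of_int ((- l) $ i) * ((1 / real j) *\<^sub>R x) $ i) = (\<Sum>i\<in>UNIV. of_int (m $ i) * x $ i)"
        using j by (intro sum.cong) auto
      then show ?thesis by (simp only: tchar_def)
    qed
    then have "G = trig_poly {m} (\<lambda>_. G 0)"
      by (intro ext) (subst G, simp add: trig_poly_tchar)
    moreover have "m \<in> Box n"
    proof -
      have "\<bar>m $ i\<bar> \<le> int n" for i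
      proof -
        have "\<bar>m $ i\<bar> \<le> int j * \<bar>m $ i\<bar>" using j by (simp add: mult_le_cancel_right1)
        also have "\<dots> = \<bar>l $ i\<bar>" using arg_cong[OF m[of i], of abs] by (simp add: abs_mult)
        also have "\<dots> \<le> int n" using l by (auto simp: cube_def abs_le_iff minus_le_iff)
        finally show ?thesis .
      qed
      then show ?thesis by (simp add: cube_def abs_le_iff minus_le_iff)
    qed
    ultimately show ?thesis using tdeg_trig_poly[of "{m}" n "\<lambda>_. G 0"]
      by (metis empty_subsetI insert_subset)
  next
    case False
    then obtain i where i: "\<not> int j dvd l $ i" by blast
    let ?e = "(2*pi) *\<^sub>R axis i 1 :: real^'d"
    have "G (0 + ?e) = G 0"
    proof -
      have "f (0 + ?e + real j *\<^sub>R t) = f (0 + real j *\<^sub>R t)" for t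
      proof -
        have "f (0 + ?e + real j *\<^sub>R t) = f ((0 + real j *\<^sub>R t) + ?e)"
          by (rule arg_cong[of _ _ f]) simp
        also have "\<dots> = f (0 + real j *\<^sub>R t)"
          using per unfolding periodic_fun_def by blast
        finally show ?thesis .
      qed
      then show ?thesis unfolding G_def by (simp only:)
    qed
    moreover have "tchar (- l) ((1 / real j) *\<^sub>R ?e) \<noteq> 1"
    proof
      assume *: "tchar (- l) ((1 / real j) *\<^sub>R ?e) = 1"
      have "(\<Sum>u\<in>UNIV. of_int ((- l) $ u) * ((1 / real j) *\<^sub>R ?e) $ u) = (\<Sum>u\<in>UNIV. if u = i then - of_int (l $ i) * (2 * pi) / real j else 0)"
        by (intro sum.cong) (auto simp: axis_def)
      then have "exp (\<i> * of_real (- of_int (l $ i) * (2 * pi) / real j)) = 1"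
        using * unfolding tchar_def by (simp only: sum.delta finite UNIV_I if_True)
      then obtain N where N: "- of_int (l $ i) * (2 * pi) / real j = of_int (2 * N) * pi"
        unfolding exp_eq_1 by auto
      have "(2 * pi) * - of_int (l $ i) = (- of_int (l $ i) * (2 * pi) / real j) * real j" using j by simp
      also have "\<dots> = (2 * pi) * (real j * of_int N)" unfolding N by simp
      finally have "- of_int (l $ i) = real j * of_int N" by (simp only: mult_cancel_left) simp
      then have "of_int (- (l $ i)) = real_of_int (int j * N)" by simp
      then have "- (l $ i) = int j * N" by (simp only: of_int_eq_iff)
      then have "int j dvd l $ i" by (metis dvd_minus_iff dvd_triv_left)
      with i show False by simp
    qed
    ultimately have "G 0 = 0" using G[of "0 + ?e"] by (metis add_0 mult_cancel_left1)
    then have "G = (\<lambda>_. 0)" by (intro ext) (subst G, simp)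
    then show ?thesis by (simp add: tdeg_const)
  qed
  then show ?thesis by (simp add: G_def[abs_def])
qed

section \<open>The Jackson kernel and its moments\<close>

lemma norm_geometric_exp_le:
  "norm (exp (\<i> * of_real t) - 1) * norm (\<Sum>j\<in>{0..int M - 1}. exp (\<i> * of_real (of_int j * t))) \<le> 2"
proof -
  define z where "z = exp (\<i> * complex_of_real t)"
  have "(\<Sum>j\<in>{0..int M - 1}. exp (\<i> * of_real (of_int j * t))) = (\<Sum>j<M. z ^ j)"
    by (rule sum.reindex_bij_witness[where i="int" and j="nat"])
      (auto simp: z_def mult_ac simp flip: exp_of_nat_mult)
  then have "norm (exp (\<i> * of_real t) - 1) * norm (\<Sum>j\<in>{0..int M - 1}. exp (\<i> * of_real (of_int j * t))) = norm ((z - 1) * (\<Sum>j<M. z ^ j))"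
    by (simp add: norm_mult z_def)
  also have "(z - 1) * (\<Sum>j<M. z ^ j) = z ^ M - 1" by (rule power_diff_1_eq[symmetric])
  also have "norm (z ^ M - 1) \<le> norm (z ^ M) + norm (1::complex)" by (rule norm_triangle_ineq4)
  also have "\<dots> = 2" by (simp add: z_def norm_power norm_exp_i_times)
  finally show ?thesis .
qed

text \<open>In coordinate i the geometric sum telescopes, giving 2 instead of M; the other
  coordinates keep the trivial bound. This gain of one power of M per factor produces the decay of
  the moments.\<close>

lemma norm_cube_sum_edge:
  fixes x :: "real^'d"
  shows "norm (exp (\<i> * of_real (x$i)) - 1) * norm (cube_sum {0..int M - 1} x) * real M \<le> 2 * real M ^ CARD('d)"
proof -
  let ?G = "\<lambda>u. \<Sum>j\<in>{0..int M - 1}. exp (\<i> * of_real (of_int j * x$u))"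
  have G: "norm (?G u) \<le> real M" for u
    by (rule order_trans[OF norm_sum]) (unfold norm_exp_i_times, simp)
  have "cube_sum {0..int M - 1} x = (\<Prod>u\<in>UNIV. ?G u)" by (rule cube_sum_prod) simp
  also have "\<dots> = ?G i * (\<Prod>u\<in>UNIV - {i}. ?G u)" by (rule prod.remove) auto
  finally have "norm (exp (\<i> * of_real (x$i)) - 1) * norm (cube_sum {0..int M - 1} x)
     = norm (exp (\<i> * of_real (x$i)) - 1) * norm (?G i) * (\<Prod>u\<in>UNIV - {i}. norm (?G u))"
    by (simp only: norm_mult prod_norm mult.assoc)
  also have "\<dots> \<le> 2 * (\<Prod>u\<in>UNIV - {i}. real M)"
  proof (rule mult_mono[OF norm_geometric_exp_le])
    show "(\<Prod>u\<in>UNIV - {i}. norm (?G u)) \<le> (\<Prod>u\<in>UNIV - {i}. real M)"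
      by (rule prod_mono) (intro conjI norm_ge_zero G)
    show "0 \<le> (\<Prod>u\<in>UNIV - {i}. norm (?G u))" by (intro prod_nonneg norm_ge_zero)
  qed simp
  finally have "norm (exp (\<i> * of_real (x$i)) - 1) * norm (cube_sum {0..int M - 1} x) * real M
     \<le> 2 * (\<Prod>u\<in>UNIV - {i}. real M) * real M" by (rule mult_right_mono) simp
  also have "\<dots> = 2 * (real M * (\<Prod>u\<in>UNIV - {i}. real M))" by simp
  also have "real M * (\<Prod>u\<in>UNIV - {i}. real M) = (\<Prod>u\<in>(UNIV::'d set). real M)"
    by (rule prod.remove[symmetric]) auto
  finally show ?thesis by simp
qed

text \<open>The kernel is |S|^(2b+2), normalised, where S is a product of geometric sums of length
  M. The power is high enough for the moments of order 2b to be of size M^(-2b).\<close>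

lemma Jackson_kernel:
  fixes b M :: nat
  assumes M: "0 < M"
  obtains w :: "real^'d \<Rightarrow> real" where
    "tdeg (2 * (b + 1) * M) (\<lambda>x. of_real (w x))" "\<And>x. 0 \<le> w x" "w \<in> borel_measurable borel"
    "(\<integral>\<^sup>+x. ennreal (w x) \<partial>tm) = 1"
    "\<And>i. (\<integral>\<^sup>+x. ennreal (norm (exp (\<i> * of_real (x$i)) - 1) ^ (2*b) * w x) \<partial>tm)
       \<le> ennreal (4 ^ b * (4 * real (b + 1)) ^ CARD('d) / real M ^ (2*b))"
proof -
  let ?d = "CARD('d)"
  let ?S = "cube_sum {0..int M - 1} :: real^'d \<Rightarrow> complex"
  have S: "tdeg M ?S" by (intro tdeg_trig_poly cube_mono) auto
  have R: "tdeg ((b + 1) * M) (\<lambda>x. ?S x ^ (b + 1))" by (rule tdeg_power[OF S])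
  then obtain c where c: "(\<lambda>x. ?S x ^ (b + 1)) = trig_poly (Box ((b + 1) * M)) c" by (auto simp: tdeg_def)
  define A where "A = (\<Sum>k\<in>Box ((b + 1) * M). (norm (c k))\<^sup>2)"
  have A0: "0 \<le> A" by (simp add: A_def sum_nonneg)
  have sq: "u ^ (2*b+2) = (u ^ (b + 1))\<^sup>2" for u :: real
  proof -
    have e: "2*b+2 = (b + 1) * 2" by simp
    show ?thesis unfolding e power_mult ..
  qed
  have int: "(\<integral>\<^sup>+x. ennreal (norm (?S x) ^ (2*b+2)) \<partial>tm) = ennreal A"
  proof -
    have "norm (?S x) ^ (2*b+2) = norm (trig_poly (Box ((b + 1) * M)) c x) powr 2" for x
    proof -
      have "norm (?S x) ^ (2*b+2) = (norm (?S x ^ (b + 1)))\<^sup>2"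
        unfolding sq norm_power ..
      then show ?thesis using fun_cong[OF c, of x] by simp
    qed
    then show ?thesis unfolding A_def by (simp add: nn_integral_trig_poly_norm2 del: powr_numeral)
  qed
  \<comment> \<open>A lower bound for the normalisation: S^(b+1) has the value M^(d(b+1)) at 0 and
    at most (4(b+1)M)^d frequencies, so Parseval with Cauchy-Schwarz prevents its L_2 norm from
    being small.\<close>
  have A: "real M ^ (?d * (2*b+1)) / (4 * real (b + 1)) ^ ?d \<le> A"
  proof -
    have "real M ^ (?d * (b + 1)) = norm (?S 0 ^ (b + 1))"
      unfolding norm_power power_mult by (simp add: trig_poly_tchar card_cube norm_power)
    also have "\<dots> \<le> (\<Sum>k\<in>Box ((b + 1) * M). norm (c k))"
      using fun_cong[OF c, of 0] norm_trig_poly_le[of "Box ((b + 1) * M)" c 0] by simp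
    also have "\<dots> \<le> sqrt (card (Box ((b + 1) * M) :: (int^'d) set)) * sqrt A"
      unfolding A_def by (intro Lp_le_2_trig_poly_coeff Lp_le_2_trig_poly) auto
    finally have "(real M ^ (?d * (b + 1)))\<^sup>2 \<le> (sqrt (card (Box ((b + 1) * M) :: (int^'d) set)) * sqrt A)\<^sup>2"
      by (rule power_mono) simp
    also have "\<dots> = real (card (Box ((b + 1) * M) :: (int^'d) set)) * A"
      using A0 by (simp add: power_mult_distrib)
    also have "\<dots> \<le> (4 * real (b + 1) * real M) ^ ?d * A"
    proof (rule mult_right_mono[OF _ A0])
      have "card {- int a..int a} = 2 * a + 1" for a by simp
      then have "card {- int ((b + 1) * M)..int ((b + 1) * M)} = 2 * ((b + 1) * M) + 1" .
      moreover have "1 \<le> (b + 1) * M" using M by simp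
      ultimately have "card {- int ((b + 1) * M)..int ((b + 1) * M)} \<le> 4 * (b + 1) * M" by linarith
      then have "real (card {- int ((b + 1) * M)..int ((b + 1) * M)}) \<le> real (4 * (b + 1) * M)"
        by (simp only: of_nat_le_iff)
      then show "real (card (Box ((b + 1) * M) :: (int^'d) set)) \<le> (4 * real (b + 1) * real M) ^ ?d"
        by (simp only: card_cube finite_atLeastAtMost_int of_nat_power) (rule power_mono, simp_all)
    qed
    also have "\<dots> = (4 * real (b + 1)) ^ ?d * A * real M ^ ?d"
      by (subst power_mult_distrib) (simp only: mult_ac)
    also have "(real M ^ (?d * (b + 1)))\<^sup>2 = real M ^ (?d * (2*b+1)) * real M ^ ?d"
      by (simp add: algebra_simps flip: power_add power_mult)
    finally have "real M ^ (?d * (2*b+1)) * real M ^ ?d \<le> (4 * real (b + 1)) ^ ?d * A * real M ^ ?d" .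
    then have "real M ^ (?d * (2*b+1)) \<le> (4 * real (b + 1)) ^ ?d * A"
      by (rule mult_right_le_imp_le) (use M in simp)
    then show ?thesis by (simp add: field_simps)
  qed
  have Apos: "0 < A" by (rule less_le_trans[OF _ A]) (use M in simp)
  define w where "w x = norm (?S x) ^ (2*b+2) / A" for x
  show ?thesis
  proof
    have "tdeg ((b + 1) * M + (b + 1) * M) (\<lambda>x. (1 / of_real A) * (?S x ^ (b + 1) * cnj (?S x ^ (b + 1))))"
      by (intro tdeg_cmult tdeg_mult tdeg_cnj R)
    moreover have "(1 / of_real A) * (?S x ^ (b + 1) * cnj (?S x ^ (b + 1))) = of_real (w x)" for x
    proof -
      have "?S x ^ (b + 1) * cnj (?S x ^ (b + 1)) = of_real ((norm (?S x ^ (b + 1)))\<^sup>2)"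
        by (rule complex_norm_square[symmetric])
      also have "(norm (?S x ^ (b + 1)))\<^sup>2 = norm (?S x) ^ (2*b+2)"
        unfolding sq norm_power ..
      finally show ?thesis by (simp add: w_def)
    qed
    moreover have "(b + 1) * M + (b + 1) * M = 2 * (b + 1) * M" by simp
    ultimately show "tdeg (2 * (b + 1) * M) (\<lambda>x. of_real (w x))" by (simp only:)
    show "0 \<le> w x" for x using A0 by (simp add: w_def)
    show [measurable]: "w \<in> borel_measurable borel" unfolding w_def by measurable
    have "ennreal (w x) = ennreal (1 / A) * ennreal (norm (?S x) ^ (2*b+2))" for x
      using Apos by (simp add: w_def flip: ennreal_mult)
    then have "(\<integral>\<^sup>+x. ennreal (w x) \<partial>tm) = (\<integral>\<^sup>+x. ennreal (1 / A) * ennreal (norm (?S x) ^ (2*b+2)) \<partial>tm)"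
      by (simp only:)
    also have "\<dots> = ennreal (1 / A) * (\<integral>\<^sup>+x. ennreal (norm (?S x) ^ (2*b+2)) \<partial>tm)"
      by (rule nn_integral_cmult) measurable
    finally have "(\<integral>\<^sup>+x. ennreal (w x) \<partial>tm) = ennreal (1 / A) * (\<integral>\<^sup>+x. ennreal (norm (?S x) ^ (2*b+2)) \<partial>tm)" .
    then show "(\<integral>\<^sup>+x. ennreal (w x) \<partial>tm) = 1"
      using Apos unfolding int by (subst (asm) ennreal_mult[symmetric]) auto
    fix i
    let ?e = "\<lambda>x::real^'d. norm (exp (\<i> * of_real (x$i)) - 1)"
    \<comment> \<open>Of the 2b + 2 factors |S|, 2b are paired with |exp(i x_i) - 1| and bounded by
      \<open>?B\<close>; the remaining two are integrated by Parseval.\<close>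
    let ?B = "2 * real M ^ ?d / real M"
    have "(\<integral>\<^sup>+x. ennreal (?e x ^ (2*b) * w x) \<partial>tm) \<le> (\<integral>\<^sup>+x. ennreal (?B ^ (2*b) / A) * ennreal (norm (?S x) powr 2) \<partial>tm)"
    proof (rule nn_integral_mono)
      fix x
      have "?e x * norm (?S x) \<le> ?B"
        using norm_cube_sum_edge[of x i M] M by (simp add: field_simps)
      then have "(?e x * norm (?S x)) ^ (2*b) * (norm (?S x))\<^sup>2 / A \<le> ?B ^ (2*b) * (norm (?S x))\<^sup>2 / A"
        using A0 by (intro divide_right_mono mult_right_mono power_mono) auto
      moreover have "?e x ^ (2*b) * w x = (?e x * norm (?S x)) ^ (2*b) * (norm (?S x))\<^sup>2 / A"
        by (simp only: w_def power_mult_distrib power_add) simp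
      ultimately show "ennreal (?e x ^ (2*b) * w x) \<le> ennreal (?B ^ (2*b) / A) * ennreal (norm (?S x) powr 2)"
        using A0 by (simp add: ennreal_leI flip: ennreal_mult)
    qed
    also have "\<dots> = ennreal (?B ^ (2*b) / A) * ennreal (real M ^ ?d)"
      by (subst nn_integral_cmult) (auto simp: nn_integral_trig_poly_norm2 card_cube simp del: powr_numeral)
    also have "\<dots> = ennreal (?B ^ (2*b) * real M ^ ?d / A)"
      using A0 by (simp flip: ennreal_mult)
    also have "\<dots> \<le> ennreal (4 ^ b * (4 * real (b + 1)) ^ ?d / real M ^ (2*b))"
    proof (rule ennreal_leI)
      have "?B ^ (2*b) * real M ^ ?d / A \<le> ?B ^ (2*b) * real M ^ ?d / (real M ^ (?d * (2*b+1)) / (4 * real (b + 1)) ^ ?d)"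
        using A M Apos by (intro divide_left_mono mult_pos_pos) auto
      also have "\<dots> = 4 ^ b * (4 * real (b + 1)) ^ ?d / real M ^ (2*b)"
      proof -
        have "?B ^ (2*b) = 4 ^ b * real M ^ (?d * (2*b)) / real M ^ (2*b)"
          by (simp add: power_divide power_mult_distrib power_mult)
        moreover have "real M ^ (?d * (2*b+1)) = real M ^ (?d * (2*b)) * real M ^ ?d"
          by (simp add: add.commute flip: power_add)
        ultimately show ?thesis using M by simp
      qed
      finally show "?B ^ (2*b) * real M ^ ?d / A \<le> 4 ^ b * (4 * real (b + 1)) ^ ?d / real M ^ (2*b)" .
    qed
    finally show "(\<integral>\<^sup>+x. ennreal (?e x ^ (2*b) * w x) \<partial>tm) \<le> ennreal (4 ^ b * (4 * real (b + 1)) ^ ?d / real M ^ (2*b))" .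
  qed
qed

text \<open>Representatives centred at 0: for them the smoothness bound in terms of
  \<open>norm h\<close> is strong, and |t_i| is comparable with |exp(i t_i) - 1| by
  \<open>abs_le_norm_exp_i_minus_1\<close>.\<close>

lemma wrap_symmetric:
  fixes t :: "real^'d"
  obtains k where "\<And>i. \<bar>(t + lat k) $ i\<bar> \<le> pi"
proof -
  define k :: "int^'d" where "k = (\<chi> i. - \<lfloor>(t $ i + pi) / (2*pi)\<rfloor>)"
  have "\<bar>(t + lat k) $ i\<bar> \<le> pi" for i
  proof -
    define n where "n = \<lfloor>(t $ i + pi) / (2*pi)\<rfloor>"
    have "of_int n \<le> (t $ i + pi) / (2*pi)" "(t $ i + pi) / (2*pi) < of_int n + 1"
      unfolding n_def using floor_correct[of "(t $ i + pi) / (2*pi)"] by auto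
    then have "of_int n * (2*pi) \<le> t $ i + pi" "t $ i + pi < (of_int n + 1) * (2*pi)"
      by (simp_all add: le_divide_eq divide_less_eq)
    then have "\<bar>t $ i - 2*pi * of_int n\<bar> \<le> pi"
      by (simp add: abs_le_iff algebra_simps)
    then show ?thesis by (simp add: k_def lat_def n_def)
  qed
  then show ?thesis by (rule that)
qed

lemma fdiff_lat:
  assumes "periodic_fun f"
  shows "fdiff (t + lat l) k f = fdiff t k f"
proof -
  obtain a where a: "\<And>(f :: real^'a \<Rightarrow> complex) h x. fdiff h k f x = (\<Sum>j\<le>k. a j * f (x + real j *\<^sub>R h))"
    using fdiff_expand[of k, where 'd='a] by blast
  have "f (x + real j *\<^sub>R (t + lat l)) = f (x + real j *\<^sub>R t)" for x j
  proof -
    have "x + real j *\<^sub>R (t + lat l) = (x + real j *\<^sub>R t) + lat (\<chi> i. int j * l $ i)"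
      by (simp add: lat_def vec_eq_iff algebra_simps)
    then show ?thesis by (simp only: periodic_fun_lat[OF assms])
  qed
  then show ?thesis by (simp add: fun_eq_iff a)
qed

lemma tchar1_lat:
  fixes t :: "real^'d"
  shows "exp (\<i> * of_real ((t + lat k) $ i)) = exp (\<i> * of_real (t $ i))"
proof -
  have "exp (\<i> * of_real ((t + lat k) $ i)) = exp (\<i> * of_real (t $ i)) * exp ((2 * of_int (k$i) * of_real pi) * \<i>)"
    by (simp add: lat_def algebra_simps flip: exp_add)
  also have "exp ((2 * of_int (k$i) * of_real pi) * \<i>) = (1::complex)"
    using exp_integer_2pi[of "of_int (k$i)"] by simp
  finally show ?thesis by simp
qed

lemma norm_power_le_sum:
  fixes t :: "real^'d"
  shows "norm t ^ (2*b) \<le> real CARD('d) ^ b * (\<Sum>i\<in>UNIV. \<bar>t$i\<bar> ^ (2*b))"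
proof -
  obtain i where i: "\<And>j. \<bar>t$j\<bar> \<le> \<bar>t$i\<bar>"
  proof -
    have "finite (range (\<lambda>j. \<bar>t$j\<bar>))" "range (\<lambda>j. \<bar>t$j\<bar>) \<noteq> {}" by auto
    then have "Max (range (\<lambda>j. \<bar>t$j\<bar>)) \<in> range (\<lambda>j. \<bar>t$j\<bar>)" by (rule Max_in)
    then obtain i where "Max (range (\<lambda>j. \<bar>t$j\<bar>)) = \<bar>t$i\<bar>" by (rule rangeE)
    then have "\<bar>t$j\<bar> \<le> \<bar>t$i\<bar>" for j using Max_ge[of "range (\<lambda>j. \<bar>t$j\<bar>)" "\<bar>t$j\<bar>"] by simp
    then show ?thesis by (rule that)
  qed
  have "(norm t)\<^sup>2 = (\<Sum>j\<in>UNIV. (t$j)\<^sup>2)"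
    by (simp add: norm_vec_def L2_set_def sum_nonneg)
  also have "\<dots> \<le> (\<Sum>j\<in>(UNIV::'d set). \<bar>t$i\<bar>\<^sup>2)"
    using i by (intro sum_mono) (simp add: abs_le_square_iff[symmetric] del: power2_abs)
  also have "\<dots> = real CARD('d) * \<bar>t$i\<bar>\<^sup>2" by simp
  finally have "((norm t)\<^sup>2) ^ b \<le> (real CARD('d) * \<bar>t$i\<bar>\<^sup>2) ^ b" by (rule power_mono) simp
  then have "norm t ^ (2*b) \<le> real CARD('d) ^ b * \<bar>t$i\<bar> ^ (2*b)"
    by (simp only: power_mult power_mult_distrib)
  also have "\<dots> \<le> real CARD('d) ^ b * (\<Sum>j\<in>UNIV. \<bar>t$j\<bar> ^ (2*b))"
    by (intro mult_left_mono member_le_sum) auto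
  finally show ?thesis .
qed

text \<open>Trades a real exponent for an integer one, in which the moments of the kernel and the
  greedy potential are available.\<close>

lemma powr_le_one_plus_power:
  fixes y s :: real
  assumes "0 \<le> y" "0 \<le> s" "s \<le> real n"
  shows "y powr s \<le> 1 + y ^ n"
proof (cases "y \<le> 1")
  case True
  then have "y powr s \<le> 1" using assms by (intro powr_le1) auto
  then show ?thesis using assms by (smt (verit) zero_le_power)
next
  case False
  then have "y powr s \<le> y powr real n" using assms by (intro powr_mono) auto
  also have "\<dots> = y ^ n" using False by (intro powr_realpow) auto
  finally show ?thesis by simp
qed

text \<open>The 1 is the mass of the kernel. In the rest, d^b passes from the Euclidean norm to
  coordinates, (pi/2)^(2b) from |t_i| to |exp(i t_i) - 1|, and the last factor sums the moments over
  d coordinates.\<close>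

definition jackson_const :: "nat \<Rightarrow> nat \<Rightarrow> real" where
  "jackson_const d b = 1 + real d ^ b * (pi/2) ^ (2*b) * (real d * (4 ^ b * (4 * real (b + 1)) ^ d))"

lemma jackson_const_ge_1: "1 \<le> jackson_const d b"
  by (simp add: jackson_const_def)

text \<open>The approximant is the part \<open>j \<ge> 1\<close> of the mean of \<open>fdiff t k f x\<close> against the Jackson kernel;
  the part \<open>j = 0\<close> reproduces \<open>f\<close> up to sign.\<close>

lemma Jackson:
  fixes f :: "real^'d \<Rightarrow> complex"
  assumes f: "Lp_le p f a" and per: "periodic_fun f" and p: "1 \<le> p" and r: "0 < r" and b: "r * p \<le> real (2*b)"
    and D: "\<And>h. Lp_le p (fdiff h k f) (D * norm h powr r)" and D0: "0 \<le> D" and M: "0 < M"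
  obtains T where "tdeg (2 * (b + 1) * M) T"
    "Lp_le p (\<lambda>x. f x - T x) (jackson_const CARD('d) b * D * real M powr (-r))"
proof -
  let ?d = "CARD('d)"
  have [measurable]: "f \<in> borel_measurable borel" using f by (simp add: Lp_le_def)
  have f1: "Lp_le 1 f a" by (rule Lp_le_exponent_mono[OF f]) (use p in auto)
  obtain w :: "real^'d \<Rightarrow> real" where wdeg: "tdeg (2 * (b + 1) * M) (\<lambda>x. of_real (w x))"
    and w0: "\<And>x. 0 \<le> w x" and [measurable]: "w \<in> borel_measurable borel"
    and w1: "(\<integral>\<^sup>+x. ennreal (w x) \<partial>tm) = 1"
    and wm: "\<And>i. (\<integral>\<^sup>+x. ennreal (norm (exp (\<i> * of_real (x$i)) - 1) ^ (2*b) * w x) \<partial>tm)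
       \<le> ennreal (4 ^ b * (4 * real (b + 1)) ^ ?d / real M ^ (2*b))"
    by (rule Jackson_kernel[OF M, where b=b and 'd='d]) (rule that)
  obtain c where c: "(\<lambda>x. of_real (w x)) = trig_poly (Box (2 * (b + 1) * M)) c"
    using wdeg by (auto simp: tdeg_def)
  obtain \<alpha> where \<alpha>0: "\<alpha> 0 = (-1) ^ k"
    and \<alpha>: "\<And>(f :: real^'d \<Rightarrow> complex) h x. fdiff h k f x = (\<Sum>j\<le>k. \<alpha> j * f (x + real j *\<^sub>R h))"
    using fdiff_expand[of k, where 'd='d] by blast
  let ?K = "\<lambda>t. complex_of_real (w t)"
  define T where "T x = - ((-1) ^ k * (\<Sum>j\<in>{1..k}. \<alpha> j * (\<integral>t. f (x + real j *\<^sub>R t) * ?K t \<partial>tm)))" for x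
  have int: "integrable tm (\<lambda>t. f (x + real j *\<^sub>R t))" if "0 < j" for x j
  proof (rule integrableI_bounded)
    have "(\<integral>\<^sup>+t. ennreal (norm (f (x + of_int (int j) *\<^sub>R t))) \<partial>tm) = (\<integral>\<^sup>+t. ennreal (norm (f t)) \<partial>tm)"
      by (rule nn_integral_tm_dilate[where g="\<lambda>z. ennreal (norm z)"]) (use that per in auto)
    also have "\<dots> \<le> ennreal a" by (rule Lp_le_1_nn_integral[OF f1])
    finally show "(\<integral>\<^sup>+t. ennreal (norm (f (x + real j *\<^sub>R t))) \<partial>tm) < \<infinity>"
      by (simp add: le_less_trans)
  qed measurable
  have intch: "integrable tm (\<lambda>t. f (x + real j *\<^sub>R t) * tchar l t)" if "0 < j" for x j l
    by (rule integrable_mult_bounded[where B=1]) (use int[OF that] in auto)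
  obtain B where B: "\<And>t. norm (?K t) \<le> B"
    using norm_trig_poly_le[of "Box (2 * (b + 1) * M)" c] fun_cong[OF c] by metis
  have intK: "integrable tm (\<lambda>t. f (x + real j *\<^sub>R t) * ?K t)" if "0 < j" for x j
    by (rule integrable_mult_bounded[where B=B]) (use int[OF that] B in auto)
  have tdegT: "tdeg (2 * (b + 1) * M) T"
  proof -
    have "tdeg (2 * (b + 1) * M) (\<lambda>x. \<integral>t. f (x + real j *\<^sub>R t) * ?K t \<partial>tm)" if "0 < j" for j
    proof -
      have "(\<integral>t. f (x + real j *\<^sub>R t) * ?K t \<partial>tm)
         = (\<Sum>l\<in>Box (2 * (b + 1) * M). c l * (\<integral>t. f (x + real j *\<^sub>R t) * tchar l t \<partial>tm))" for x
      proof -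
        have "(\<integral>t. f (x + real j *\<^sub>R t) * ?K t \<partial>tm)
          = (\<integral>t. (\<Sum>l\<in>Box (2 * (b + 1) * M). c l * (f (x + real j *\<^sub>R t) * tchar l t)) \<partial>tm)"
          unfolding fun_cong[OF c] trig_poly_tchar sum_distrib_left by (simp only: mult_ac)
        also have "\<dots> = (\<Sum>l\<in>Box (2 * (b + 1) * M). (\<integral>t. c l * (f (x + real j *\<^sub>R t) * tchar l t) \<partial>tm))"
          by (rule Bochner_Integration.integral_sum) (use intch[OF that] in auto)
        finally show ?thesis by simp
      qed
      then show ?thesis
        by (simp only:) (intro tdeg_sum tdeg_cmult tdeg_dilated_mean; use that per in simp)
    qed
    then have "tdeg (2 * (b + 1) * M) (\<lambda>x. (- ((-1) ^ k)) * (\<Sum>j\<in>{1..k}. \<alpha> j * (\<integral>t. f (x + real j *\<^sub>R t) * ?K t \<partial>tm)))"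
      by (intro tdeg_cmult tdeg_sum) auto
    moreover have "(\<lambda>x. (- ((-1) ^ k)) * (\<Sum>j\<in>{1..k}. \<alpha> j * (\<integral>t. f (x + real j *\<^sub>R t) * ?K t \<partial>tm))) = T"
      by (simp add: T_def fun_eq_iff)
    ultimately show ?thesis by simp
  qed
  have intKK: "integrable tm ?K" by (rule integrable_tm_bounded[OF _ B]) simp
  have K1: "(\<integral>t. ?K t \<partial>tm) = 1"
  proof -
    have "integrable tm w" by (rule integrable_tm_bounded[where B=B]) (use B in auto)
    then have "(\<integral>\<^sup>+x. ennreal (w x) \<partial>tm) = ennreal (\<integral>x. w x \<partial>tm)"
      by (rule nn_integral_eq_integral) (use w0 in simp)
    then have "(\<integral>x. w x \<partial>tm) = 1" using w1 by (metis ennreal_eq_1)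
    then show ?thesis by simp
  qed
  have diff: "f x - T x = (-1) ^ k * (\<integral>t. fdiff t k f x * ?K t \<partial>tm)" for x
  proof -
    have "(\<integral>t. fdiff t k f x * ?K t \<partial>tm) = (\<integral>t. (\<Sum>j\<in>insert 0 {1..k}. \<alpha> j * (f (x + real j *\<^sub>R t) * ?K t)) \<partial>tm)"
    proof (intro Bochner_Integration.integral_cong refl)
      have "{..k} = insert 0 {1..k}" by auto
      then show "fdiff t k f x * ?K t = (\<Sum>j\<in>insert 0 {1..k}. \<alpha> j * (f (x + real j *\<^sub>R t) * ?K t))" for t
        unfolding \<alpha> by (simp only: sum_distrib_right mult.assoc)
    qed
    also have "\<dots> = (\<Sum>j\<in>insert 0 {1..k}. (\<integral>t. \<alpha> j * (f (x + real j *\<^sub>R t) * ?K t) \<partial>tm))"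
    proof (rule Bochner_Integration.integral_sum)
      fix j assume "j \<in> insert 0 {1..k}"
      then show "integrable tm (\<lambda>t. \<alpha> j * (f (x + real j *\<^sub>R t) * ?K t))"
        using intK intKK by (cases "j = 0") auto
    qed
    also have "\<dots> = \<alpha> 0 * f x + (\<Sum>j\<in>{1..k}. \<alpha> j * (\<integral>t. f (x + real j *\<^sub>R t) * ?K t \<partial>tm))"
      using K1 by (subst sum.insert) auto
    finally have *: "(\<integral>t. fdiff t k f x * ?K t \<partial>tm) = \<alpha> 0 * f x + (\<Sum>j\<in>{1..k}. \<alpha> j * (\<integral>t. f (x + real j *\<^sub>R t) * ?K t \<partial>tm))" .
    have "(-1) ^ k * (-1) ^ k = (1::complex)" by (simp flip: power_add power_mult_distrib)
    then show ?thesis unfolding * \<alpha>0 T_def distrib_left by (simp flip: mult.assoc)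
  qed
  define Q where "Q = 4 ^ b * (4 * real (b + 1)) ^ ?d"
  \<comment> \<open>A periodic majorant, up to constants, of 1 + (M |s|)^(2b), where s is the
    representative of t centred at 0. The scaling by M makes its mean against w bounded
    independently of M.\<close>
  define H where "H t = 1 + real M ^ (2*b) * (real ?d ^ b * (pi/2) ^ (2*b) * (\<Sum>i\<in>UNIV. norm (exp (\<i> * of_real (t$i)) - 1) ^ (2*b)))" for t :: "real^'d"
  have [measurable]: "H \<in> borel_measurable borel" unfolding H_def
    by (intro borel_measurable_continuous_onI continuous_intros)
  define E0 where "E0 = D powr p * real M powr (- (r * p))"
  have E00: "0 \<le> E0" by (simp add: E0_def)
  have H0: "0 \<le> H t" for t unfolding H_def by (intro add_nonneg_nonneg mult_nonneg_nonneg sum_nonneg) auto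
  have bound: "(\<integral>\<^sup>+x. ennreal (norm (fdiff t k f x) powr p) \<partial>tm) \<le> ennreal (E0 * H t)" for t
  proof -
    obtain l where l: "\<And>i. \<bar>(t + lat l) $ i\<bar> \<le> pi" using wrap_symmetric[of t] by blast
    define s where "s = t + lat l"
    have "(\<integral>\<^sup>+x. ennreal (norm (fdiff t k f x) powr p) \<partial>tm) = (\<integral>\<^sup>+x. ennreal (norm (fdiff s k f x) powr p) \<partial>tm)"
      by (simp add: s_def fdiff_lat[OF per])
    also have "\<dots> \<le> ennreal ((D * norm s powr r) powr p)" using D[of s] by (simp add: Lp_le_def)
    also have "\<dots> \<le> ennreal (E0 * H t)"
    proof (rule ennreal_leI)
      have "(D * norm s powr r) powr p = D powr p * norm s powr (r * p)"
        using D0 by (simp add: powr_mult powr_powr)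
      also have "norm s powr (r * p) = real M powr (- (r * p)) * (real M * norm s) powr (r * p)"
        using M by (simp add: powr_mult powr_minus)
      also have "(real M * norm s) powr (r * p) \<le> 1 + (real M * norm s) ^ (2*b)"
        using r p b by (intro powr_le_one_plus_power) auto
      also have "(real M * norm s) ^ (2*b) \<le> real M ^ (2*b) * (real ?d ^ b * (\<Sum>i\<in>UNIV. \<bar>s$i\<bar> ^ (2*b)))"
        unfolding power_mult_distrib by (intro mult_left_mono norm_power_le_sum) auto
      also have "(\<Sum>i\<in>UNIV. \<bar>s$i\<bar> ^ (2*b)) \<le> (\<Sum>i\<in>UNIV. (pi/2) ^ (2*b) * norm (exp (\<i> * of_real (t$i)) - 1) ^ (2*b))"
      proof (rule sum_mono)
        fix i
        have "\<bar>s$i\<bar> \<le> pi / 2 * norm (exp (\<i> * of_real (s$i)) - 1)"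
          using l by (intro abs_le_norm_exp_i_minus_1) (simp add: s_def)
        also have "exp (\<i> * of_real (s$i)) = exp (\<i> * of_real (t$i))" unfolding s_def by (rule tchar1_lat)
        finally show "\<bar>s$i\<bar> ^ (2*b) \<le> (pi/2) ^ (2*b) * norm (exp (\<i> * of_real (t$i)) - 1) ^ (2*b)"
          unfolding power_mult_distrib[symmetric] by (intro power_mono) auto
      qed
      finally show "(D * norm s powr r) powr p \<le> E0 * H t"
        unfolding E0_def H_def
        by (simp add: mult_left_mono mult.assoc sum_distrib_left)
    qed
    finally show ?thesis .
  qed
  have HW: "(\<integral>\<^sup>+t. ennreal (H t * w t) \<partial>tm) \<le> ennreal (jackson_const ?d b)"
  proof -
    let ?g = "real M ^ (2*b) * (real ?d ^ b * (pi/2) ^ (2*b))"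
    let ?e = "\<lambda>i (t::real^'d). norm (exp (\<i> * of_real (t$i)) - 1) ^ (2*b) * w t"
    have [measurable]: "?e i \<in> borel_measurable borel" for i
    proof -
      have "(\<lambda>t::real^'d. norm (exp (\<i> * of_real (t$i)) - 1) ^ (2*b)) \<in> borel_measurable borel"
        by (intro borel_measurable_continuous_onI continuous_intros)
      then show ?thesis by measurable
    qed
    have "ennreal (H t * w t) = ennreal (w t) + ennreal ?g * (\<Sum>i\<in>UNIV. ennreal (?e i t))" for t
    proof -
      have "H t * w t = w t + ?g * (\<Sum>i\<in>UNIV. ?e i t)"
        unfolding H_def sum_distrib_right[symmetric] by (simp add: algebra_simps)
      moreover have "0 \<le> (\<Sum>i\<in>UNIV. ?e i t)" "0 \<le> ?g" using w0 by (auto intro!: sum_nonneg)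
      ultimately have "ennreal (H t * w t) = ennreal (w t) + ennreal ?g * ennreal (\<Sum>i\<in>UNIV. ?e i t)"
        using w0[of t] by (simp only: ennreal_plus ennreal_mult mult_nonneg_nonneg)
      then show ?thesis using w0[of t] by (subst (asm) sum_ennreal[symmetric]) auto
    qed
    then have "(\<integral>\<^sup>+t. ennreal (H t * w t) \<partial>tm) = (\<integral>\<^sup>+t. ennreal (w t) + ennreal ?g * (\<Sum>i\<in>UNIV. ennreal (?e i t)) \<partial>tm)"
      by (simp only:)
    also have "\<dots> = 1 + ennreal ?g * (\<Sum>i\<in>UNIV. (\<integral>\<^sup>+t. ennreal (?e i t) \<partial>tm))"
      by (subst nn_integral_add, simp, simp, subst nn_integral_cmult, simp, subst nn_integral_sum, simp, simp only: w1)
    also have "\<dots> \<le> 1 + ennreal ?g * (\<Sum>i\<in>(UNIV::'d set). ennreal (Q / real M ^ (2*b)))"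
      unfolding Q_def by (intro add_left_mono mult_left_mono sum_mono wm) auto
    also have "\<dots> = ennreal (1 + ?g * (real ?d * (Q / real M ^ (2*b))))"
    proof -
      have Q0: "0 \<le> Q / real M ^ (2*b)" by (simp add: Q_def)
      then have "(\<Sum>i\<in>(UNIV::'d set). ennreal (Q / real M ^ (2*b))) = ennreal (real ?d * (Q / real M ^ (2*b)))"
        by (subst sum_ennreal) auto
      moreover have "0 \<le> ?g" by simp
      ultimately show ?thesis using Q0
        by (simp only: ennreal_plus ennreal_mult mult_nonneg_nonneg of_nat_0_le_iff zero_le_one ennreal_1)
    qed
    also have "1 + ?g * (real ?d * (Q / real M ^ (2*b))) = jackson_const ?d b"
      using M by (simp add: jackson_const_def Q_def)
    finally show ?thesis .
  qed
  have "Lp_le p (\<lambda>x. \<integral>t. fdiff t k f x * ?K t \<partial>tm) ((1 powr (p - 1) * (E0 * jackson_const ?d b)) powr (1/p))"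
  proof (rule Lp_le_integral_kernel[where w=w and b="\<lambda>t. E0 * H t"])
    show "case_prod (\<lambda>x t. fdiff t k f x) \<in> borel_measurable (borel \<Otimes>\<^sub>M borel)"
      unfolding \<alpha> by measurable
    show "(\<integral>\<^sup>+t. ennreal (E0 * H t * w t) \<partial>tm) \<le> ennreal (E0 * jackson_const ?d b)"
    proof -
      have "(\<integral>\<^sup>+t. ennreal (E0 * H t * w t) \<partial>tm) = (\<integral>\<^sup>+t. ennreal E0 * ennreal (H t * w t) \<partial>tm)"
        using E00 H0 w0 by (simp add: mult.assoc flip: ennreal_mult)
      also have "\<dots> = ennreal E0 * (\<integral>\<^sup>+t. ennreal (H t * w t) \<partial>tm)"
        by (rule nn_integral_cmult) measurable
      also have "\<dots> \<le> ennreal E0 * ennreal (jackson_const ?d b)"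
        by (intro mult_left_mono HW) auto
      also have "\<dots> = ennreal (E0 * jackson_const ?d b)"
        using E00 jackson_const_ge_1[of ?d b] by (simp add: ennreal_mult)
      finally show ?thesis .
    qed
    show "0 \<le> E0 * jackson_const ?d b" using E00 jackson_const_ge_1[of ?d b] by simp
  qed (use p w0 w1 bound H0 E00 in auto)
  moreover have "(1 powr (p - 1) * (E0 * jackson_const ?d b)) powr (1/p) \<le> jackson_const ?d b * D * real M powr (-r)"
  proof -
    have "(1 powr (p - 1) * (E0 * jackson_const ?d b)) powr (1/p) = E0 powr (1/p) * jackson_const ?d b powr (1/p)"
      using E00 jackson_const_ge_1[of ?d b] by (simp add: powr_mult)
    also have "E0 powr (1/p) = D * real M powr (-r)"
      unfolding E0_def using D0 p by (simp add: powr_mult powr_powr)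
    also have "D * real M powr (-r) * jackson_const ?d b powr (1/p) \<le> D * real M powr (-r) * jackson_const ?d b powr 1"
      using jackson_const_ge_1[of ?d b] p D0 by (intro mult_left_mono powr_mono) auto
    also have "\<dots> = jackson_const ?d b * D * real M powr (-r)"
      using jackson_const_ge_1[of ?d b] by simp
    finally show ?thesis .
  qed
  ultimately have "Lp_le p (\<lambda>x. \<integral>t. fdiff t k f x * ?K t \<partial>tm) (jackson_const ?d b * D * real M powr (-r))"
    by (rule Lp_le_mono) (use p in simp)
  from Lp_le_cmult[OF this, of "(-1) ^ k"] p
  have "Lp_le p (\<lambda>x. f x - T x) (jackson_const ?d b * D * real M powr (-r))"
    by (simp add: diff norm_power)
  with tdegT show ?thesis by (rule that)
qed

section \<open>Dyadic blocks\<close>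

definition scoef :: "nat \<Rightarrow> int^'d \<Rightarrow> real" where
  "scoef s k = (if s = 0 then vcoef 1 k else vcoef (2^s) k - vcoef (2^(s-1)) k)"

lemma vp_op_trig_poly_Box:
  assumes "Lp_le 1 f a" "periodic_fun f" "0 < l" "2 * l \<le> n"
  shows "vp_op l f = trig_poly (Box n) (\<lambda>k. of_real (vcoef l k) * fhat f k)"
  unfolding vp_op_trig_poly[OF assms(1-3)]
proof (rule trig_poly_mono_neutral[OF _ Box_mono[OF assms(4)]])
  fix k :: "int^'a" assume "k \<in> Box n - Box (2*l)"
  then have "vcoef l k = 0" using assms(3) by (intro vcoef_zero) auto
  then show "of_real (vcoef l k) * fhat f k = 0" by simp
qed simp

lemma sigma_block_trig_poly:
  assumes "Lp_le 1 f a" "periodic_fun f"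
  shows "sigma_block s f = trig_poly (Box (2^(s+1))) (\<lambda>k. of_real (scoef s k) * fhat f k)"
proof (cases "s = 0")
  case True
  then show ?thesis
    using vp_op_trig_poly_Box[OF assms, of 1 2] by (simp add: sigma_block_def scoef_def)
next
  case False
  have 1: "vp_op (2^s) f = trig_poly (Box (2^(s+1))) (\<lambda>k. of_real (vcoef (2^s) k) * fhat f k)"
    by (rule vp_op_trig_poly_Box[OF assms]) auto
  have 2: "vp_op (2^(s-1)) f = trig_poly (Box (2^(s+1))) (\<lambda>k. of_real (vcoef (2^(s-1)) k) * fhat f k)"
  proof (rule vp_op_trig_poly_Box[OF assms])
    have "2 * 2 ^ (s - 1) = (2::nat) ^ s" using False by (simp flip: power_Suc)
    then show "2 * 2 ^ (s - 1) \<le> (2::nat) ^ (s + 1)" by simp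
  qed simp
  show ?thesis unfolding sigma_block_def 1 2 using False
    by (simp add: fun_eq_iff trig_poly_diff[symmetric] scoef_def algebra_simps)
qed

lemma Lp_le_sigma_block:
  fixes f :: "real^'d \<Rightarrow> complex"
  assumes "Lp_le p f a" "periodic_fun f" "1 \<le> p"
  shows "Lp_le p (sigma_block s f) (2 * 3 ^ CARD('d) * a)"
proof (cases "s = 0")
  case True
  have "0 \<le> a" using assms by (simp add: Lp_le_def)
  then have "3 ^ CARD('d) * a \<le> 2 * 3 ^ CARD('d) * a" by simp
  with Lp_le_mono[OF Lp_le_vp_op[OF assms(1,2) _ assms(3), of 1] this] True assms(3)
  show ?thesis by (simp add: sigma_block_def)
next
  case False
  have "Lp_le p (\<lambda>x. vp_op (2^s) f x - vp_op (2^(s-1)) f x) (3 ^ CARD('d) * a + 3 ^ CARD('d) * a)"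
    by (intro Lp_le_diff Lp_le_vp_op assms) auto
  then show ?thesis using False by (simp add: sigma_block_def mult_ac)
qed

text \<open>The two kernels both equal 1 up to 2^(s-1) and both vanish beyond 2^(s+1). Hence only
  neighbouring blocks share frequencies, as \<open>near_frequencies\<close> records.\<close>

lemma scoef_support:
  assumes "scoef s k \<noteq> 0"
  shows "k \<in> Box (2^(s+1))" "0 < s \<Longrightarrow> k \<notin> Box (2^(s-1))"
proof -
  show "k \<in> Box (2^(s+1))"
  proof (rule ccontr)
    assume k: "k \<notin> Box (2^(s+1))"
    then have 1: "vcoef (2^s) k = 0" by (intro vcoef_zero) auto
    have 2: "vcoef (2^(s-1)) k = 0" if "s \<noteq> 0"
    proof (rule vcoef_zero)
      have "2 * 2 ^ (s - 1) = (2::nat) ^ s" using that by (simp flip: power_Suc)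
      then have "Box (2 * 2^(s-1)) \<subseteq> (Box (2^(s+1)) :: (int^'a) set)" by (intro Box_mono) simp
      then show "k \<notin> Box (2 * 2^(s-1))" using k by blast
    qed simp
    show False using assms 1 2 by (cases "s = 0") (auto simp: scoef_def)
  qed
  show "k \<notin> Box (2^(s-1))" if s: "0 < s"
  proof
    assume k: "k \<in> Box (2^(s-1))"
    moreover have "k \<in> Box (2^s)" using k Box_mono[of "2^(s-1)" "2^s"] by (auto simp: power_increasing)
    ultimately have "scoef s k = 0" using s by (simp add: scoef_def vcoef_one)
    with assms show False by simp
  qed
qed

lemma sum_scoef: "(\<Sum>s\<le>S. scoef s k) = vcoef (2^S) k"
  by (induction S) (auto simp: scoef_def)

lemma vp_op_sum_sigma:
  "(\<lambda>x. \<Sum>s\<le>S. sigma_block s f x) = vp_op (2^S) f"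
  by (induction S) (auto simp: sigma_block_def fun_eq_iff)

lemma vp_op_diff:
  assumes "Lp_le 1 f a" "periodic_fun f" "Lp_le 1 g b" "periodic_fun g" "0 < l"
  shows "vp_op l (\<lambda>x. f x - g x) = (\<lambda>x. vp_op l f x - vp_op l g x)"
proof -
  have "vp_op l (\<lambda>x. f x - g x) = trig_poly (Box (2*l)) (\<lambda>k. of_real (vcoef l k) * fhat (\<lambda>x. f x - g x) k)"
    by (rule vp_op_trig_poly[OF Lp_le_diff[OF assms(1,3)] periodic_diff[OF assms(2,4)] assms(5)]) simp
  then show ?thesis
    unfolding vp_op_trig_poly[OF assms(1,2,5)] vp_op_trig_poly[OF assms(3,4,5)] fhat_diff[OF assms(1-4)]
    by (simp add: fun_eq_iff trig_poly_diff[symmetric] algebra_simps)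
qed

lemma tdeg_periodic: "tdeg n T \<Longrightarrow> periodic_fun T"
  by (auto simp: tdeg_def periodic_trig_poly)

lemma tdeg_vp_op: "tdeg n T \<Longrightarrow> n \<le> l \<Longrightarrow> 0 < l \<Longrightarrow> vp_op l T = T"
  by (auto simp: tdeg_def intro!: vp_op_id dest: Box_mono)

text \<open>The scale \<open>M\<close> in Jackson's inequality is chosen such that the degree is at most \<open>2^s\<close>; for small \<open>s\<close>
  the zero polynomial suffices.\<close>

lemma dyadic_approximation:
  fixes f :: "real^'d \<Rightarrow> complex"
  assumes f: "Lp_le p f 1" and per: "periodic_fun f" and p: "1 \<le> p" and r: "0 < r" and b: "r * p \<le> real (2*b)"
    and D: "\<And>h. Lp_le p (fdiff h k f) (D * norm h powr r)" and D0: "0 \<le> D"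
  obtains T where "tdeg (2^s) T"
    "Lp_le p (\<lambda>x. f x - T x) ((jackson_const CARD('d) b * D + 1) * (4 * real (b + 1)) powr r * 2 powr (- (r * real s)))"
proof -
  let ?L = "2 * (b + 1)" and ?J = "jackson_const CARD('d) b"
  let ?C = "(?J * D + 1) * (4 * real (b + 1)) powr r * 2 powr (- (r * real s))"
  have J: "1 \<le> ?J" by (rule jackson_const_ge_1)
  have s2: "2 powr (- (r * real s)) = (2 ^ s) powr (- r)"
    by (simp add: powr_powr mult.commute flip: powr_realpow)
  show ?thesis
  proof (cases "?L \<le> 2^s")
    case True
    define M where "M = 2^s div ?L"
    have M: "0 < M" using True by (simp add: M_def div_greater_zero_iff)
    have LM: "?L * M \<le> 2^s" unfolding M_def by (rule times_div_less_eq_dividend)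
    \<comment> \<open>Rounding down in M loses at most a factor 2; hence 4(b+1) in the constant
      where the degree has 2(b+1).\<close>
    have "2^s mod ?L < ?L" by simp
    then have "2^s < ?L * M + ?L" using mult_div_mod_eq[of ?L "2^s"] by (simp only: M_def)
    also have "?L * M + ?L \<le> ?L * M + ?L * M"
      using M by (cases M) auto
    also have "\<dots> = 2 * (?L * M)" by (simp only: mult_2)
    finally have "real (2^s) \<le> real (2 * (?L * M))" by (simp only: of_nat_le_iff less_imp_le)
    then have "2^s \<le> (4 * real (b + 1)) * real M" by (simp add: algebra_simps)
    then have le: "((4 * real (b + 1)) * real M) powr (- r) \<le> (2^s) powr (- r)"
      using r by (intro powr_mono2') auto
    have M2: "real M powr (- r) \<le> (4 * real (b + 1)) powr r * 2 powr (- (r * real s))"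
    proof -
      define c where "c = 4 * real (b + 1)"
      have "c > 0" by (simp add: c_def)
      then have "real M powr (- r) = c powr r * (c * real M) powr (- r)"
        by (simp add: powr_mult flip: powr_add mult.assoc)
      also have "\<dots> \<le> c powr r * (2^s) powr (- r)" using le by (intro mult_left_mono) (auto simp: c_def)
      finally show ?thesis by (simp only: s2 c_def)
    qed
    obtain T where T: "tdeg (?L * M) T" "Lp_le p (\<lambda>x. f x - T x) (?J * D * real M powr (-r))"
      using Jackson[OF f per p r b D D0 M] by blast
    have "?J * D * real M powr (-r) \<le> ?J * D * ((4 * real (b + 1)) powr r * 2 powr (- (r * real s)))"
      using J D0 M2 by (intro mult_left_mono) auto
    also have "\<dots> \<le> ?C" by (simp add: algebra_simps)
    finally have "Lp_le p (\<lambda>x. f x - T x) ?C" by (rule Lp_le_mono[OF T(2)]) (use p in simp)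
    then show ?thesis using that tdeg_mono[OF T(1) LM] by blast
  next
    case False
    have "tdeg (2^s) (\<lambda>x. 0)" by (rule tdeg_const)
    moreover have "Lp_le p (\<lambda>x. f x - 0) ?C"
    proof -
      have "2^s \<le> real ?L" using False by (metis not_le of_nat_le_iff of_nat_power of_nat_numeral less_imp_le)
      also have "\<dots> \<le> 4 * real (b + 1)" by simp
      finally have "(2^s) powr r \<le> (4 * real (b + 1)) powr r" using r by (intro powr_mono2) auto
      then have "1 \<le> (4 * real (b + 1)) powr r * 2 powr (- (r * real s))"
        unfolding s2 by (simp add: powr_minus field_simps)
      then have "1 * 1 \<le> (?J * D + 1) * ((4 * real (b + 1)) powr r * 2 powr (- (r * real s)))"
        using J D0 by (intro mult_mono) auto
      then show ?thesis using Lp_le_mono[OF f, of ?C] p by (simp add: mult.assoc)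
    qed
    ultimately show ?thesis by (rule that)
  qed
qed

text \<open>Lebesgue's argument: V = \<open>vp_op (2^s)\<close> reproduces T, so f - V f = (f - T) -
  V(f - T), and V is bounded on L_p uniformly in s.\<close>

lemma vp_op_approximation:
  fixes f :: "real^'d \<Rightarrow> complex"
  assumes f: "Lp_le p f 1" and per: "periodic_fun f" and p: "1 \<le> p"
    and T: "tdeg (2^s) T" "Lp_le p (\<lambda>x. f x - T x) C"
  shows "Lp_le p (\<lambda>x. f x - vp_op (2^s) f x) ((1 + 3 ^ CARD('d)) * C)"
proof -
  have f1: "Lp_le 1 f 1" by (rule Lp_le_exponent_mono[OF f]) (use p in auto)
  obtain c where c: "T = trig_poly (Box (2^s)) c" using T by (auto simp: tdeg_def)
  obtain a where T1: "Lp_le 1 T a" using Lp_le_trig_poly_trivial[of 1 "Box (2^s)" c] unfolding c by auto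
  have perT: "periodic_fun T" by (rule tdeg_periodic[OF T(1)])
  have "Lp_le p (\<lambda>x. (f x - T x) - vp_op (2^s) (\<lambda>x. f x - T x) x) (C + 3 ^ CARD('d) * C)"
    by (intro Lp_le_diff Lp_le_vp_op T(2) periodic_diff per perT p) auto
  moreover have "(f x - T x) - vp_op (2^s) (\<lambda>x. f x - T x) x = f x - vp_op (2^s) f x" for x
    unfolding vp_op_diff[OF f1 per T1 perT zero_less_power[OF zero_less_numeral]]
    by (simp add: tdeg_vp_op[OF T(1)])
  ultimately show ?thesis by (simp add: distrib_right)
qed

lemma block_decay:
  fixes k :: nat
  assumes p: "1 \<le> p" and r: "0 < r" and D0: "0 \<le> D"
  obtains C where "0 < C" "\<And>(f :: real^'d \<Rightarrow> complex) s. Lp_le p f 1 \<Longrightarrow> periodic_fun f \<Longrightarrow>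
      (\<And>h. Lp_le p (fdiff h k f) (D * norm h powr r)) \<Longrightarrow>
      Lp_le p (\<lambda>x. f x - vp_op (2^s) f x) (C * 2 powr (- (r * real s))) \<and>
      Lp_le p (sigma_block s f) (C * 2 powr (- (r * real s)))"
proof -
  let ?d = "CARD('d)"
  define b where "b = nat \<lceil>r * p\<rceil>"
  have "r * p \<le> real b" unfolding b_def by linarith
  then have b: "r * p \<le> real (2*b)" by simp
  define C0 where "C0 = (1 + 3 ^ ?d) * ((jackson_const ?d b * D + 1) * (4 * real (b + 1)) powr r)"
  have J: "1 \<le> jackson_const ?d b" by (rule jackson_const_ge_1)
  have "0 \<le> jackson_const ?d b * D" using J D0 by (intro mult_nonneg_nonneg) auto
  then have C00: "0 < C0" unfolding C0_def
    by (intro mult_pos_pos) (auto intro: add_pos_nonneg add_nonneg_pos)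
  \<comment> \<open>\<open>2 powr r\<close> pays for passing from s - 1 to s in a difference of two
    kernels; the summand 3^d covers s = 0, where the block is not a difference.\<close>
  define C where "C = C0 * (2 powr r + 1) + 3 ^ ?d"
  have CC: "0 < C" "C0 \<le> C" using C00 by (auto simp: C_def algebra_simps add_pos_pos intro!: add_nonneg_nonneg)
  have "Lp_le p (\<lambda>x. f x - vp_op (2^s) f x) (C * 2 powr (- (r * real s))) \<and>
      Lp_le p (sigma_block s f) (C * 2 powr (- (r * real s)))"
    if f: "Lp_le p f 1" and per: "periodic_fun f" and D: "\<And>h. Lp_le p (fdiff h k f) (D * norm h powr r)"
    for f :: "real^'d \<Rightarrow> complex" and s
  proof -
    have V: "Lp_le p (\<lambda>x. f x - vp_op (2^s) f x) (C0 * 2 powr (- (r * real s)))" for s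
    proof -
      obtain T where T: "tdeg (2^s) T"
        "Lp_le p (\<lambda>x. f x - T x) ((jackson_const ?d b * D + 1) * (4 * real (b + 1)) powr r * 2 powr (- (r * real s)))"
        using dyadic_approximation[OF f per p r b D D0] by blast
      from vp_op_approximation[OF f per p T] show ?thesis by (simp add: C0_def mult.assoc)
    qed
    have "Lp_le p (sigma_block s f) (C * 2 powr (- (r * real s)))"
    proof (cases "s = 0")
      case True
      have "Lp_le p (sigma_block s f) (3 ^ ?d * 1)"
        unfolding sigma_block_def using Lp_le_vp_op[OF f per, of 1] p True by simp
      then show ?thesis
        by (rule Lp_le_mono) (use True C00 p in \<open>auto simp: C_def\<close>)
    next
      case False
      have "Lp_le p (\<lambda>x. (f x - vp_op (2^(s-1)) f x) - (f x - vp_op (2^s) f x))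
         (C0 * 2 powr (- (r * real (s - 1))) + C0 * 2 powr (- (r * real s)))"
        by (intro Lp_le_diff V p)
      moreover have "(\<lambda>x. (f x - vp_op (2^(s-1)) f x) - (f x - vp_op (2^s) f x)) = sigma_block s f"
        using False by (simp add: sigma_block_def)
      moreover have "C0 * 2 powr (- (r * real (s - 1))) + C0 * 2 powr (- (r * real s)) \<le> C * 2 powr (- (r * real s))"
      proof -
        have "- (r * real (s - 1)) = r + - (r * real s)" using False by (simp add: algebra_simps of_nat_diff)
        then have "2 powr (- (r * real (s - 1))) = 2 powr r * 2 powr (- (r * real s))"
          by (simp only: powr_add)
        then have "C0 * 2 powr (- (r * real (s - 1))) + C0 * 2 powr (- (r * real s)) = C0 * (2 powr r + 1) * 2 powr (- (r * real s))"
          by (simp add: algebra_simps)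
        also have "\<dots> \<le> C * 2 powr (- (r * real s))"
          by (intro mult_right_mono) (auto simp: C_def)
        finally show ?thesis .
      qed
      ultimately show ?thesis using Lp_le_mono p by fastforce
    qed
    moreover have "Lp_le p (\<lambda>x. f x - vp_op (2^s) f x) (C * 2 powr (- (r * real s)))"
      by (rule Lp_le_mono[OF V]) (use CC p in \<open>auto intro!: mult_right_mono\<close>)
    ultimately show ?thesis by blast
  qed
  with CC(1) show ?thesis by (rule that)
qed

section \<open>Recovering a function from its blocks\<close>

lemma summable_two_powr:
  assumes "0 < \<beta>"
  shows "summable (\<lambda>s::nat. 2 powr (- (\<beta> * real s)))"
proof -
  have "2 powr (- (\<beta> * real s)) = (2 powr (- \<beta>)) ^ s" for s
    by (simp add: powr_powr mult.commute flip: powr_realpow)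
  moreover have "norm (2 powr (- \<beta>) :: real) < 1" using assms by (simp add: powr_less_one)
  ultimately show ?thesis by (simp only: summable_geometric)
qed

text \<open>The series of the |f - g_s|^p has a finite integral, so it converges almost everywhere
  and its terms tend to 0. Summable errors thus give convergence of the whole sequence rather than
  of a subsequence.\<close>

lemma AE_limit_of_summable_Lp:
  fixes f :: "real^'d \<Rightarrow> complex"
  assumes p: "0 < p" and L: "\<And>s. Lp_le p (\<lambda>x. f x - g s x) (a s)" and sum: "summable (\<lambda>s. a s powr p)"
  shows "AE x in tm. (\<lambda>s. g s x) \<longlonglongrightarrow> f x"
proof -
  let ?u = "\<lambda>s x. norm (f x - g s x) powr p"
  have [measurable]: "(\<lambda>x. f x - g s x) \<in> borel_measurable borel" for s using L by (auto simp: Lp_le_def)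
  have "(\<integral>\<^sup>+x. (\<Sum>s. ennreal (?u s x)) \<partial>tm) = (\<Sum>s. \<integral>\<^sup>+x. ennreal (?u s x) \<partial>tm)"
    by (rule nn_integral_suminf) measurable
  also have "\<dots> \<le> (\<Sum>s. ennreal (a s powr p))"
    using L by (intro suminf_le) (auto simp: Lp_le_def)
  also have "\<dots> = ennreal (\<Sum>s. a s powr p)" by (rule suminf_ennreal_eq) (use sum in \<open>auto simp: summable_sums\<close>)
  finally have "(\<integral>\<^sup>+x. (\<Sum>s. ennreal (?u s x)) \<partial>tm) \<noteq> \<infinity>" by (auto simp: top_unique)
  then have "AE x in tm. (\<Sum>s. ennreal (?u s x)) \<noteq> \<infinity>"
    by (rule nn_integral_PInf_AE[rotated]) measurable
  then show ?thesis
  proof eventually_elim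
    case (elim x)
    then have "summable (\<lambda>s. ?u s x)" by (intro summable_suminf_not_top) auto
    then have "(\<lambda>s. ?u s x) \<longlonglongrightarrow> 0" by (rule summable_LIMSEQ_zero)
    then have "(\<lambda>s. ?u s x powr (1/p)) \<longlonglongrightarrow> 0 powr (1/p)"
      by (rule tendsto_powr') (use p in auto)
    then have "(\<lambda>s. norm (f x - g s x)) \<longlonglongrightarrow> 0" using p by (simp add: powr_powr)
    then have "(\<lambda>s. f x - g s x) \<longlonglongrightarrow> 0" by (rule tendsto_norm_zero_cancel)
    from tendsto_diff[OF tendsto_const[of "f x"] this] show ?case by simp
  qed
qed

lemma Lp_le_Fatou:
  fixes f :: "real^'d \<Rightarrow> complex"
  assumes f[measurable]: "f \<in> borel_measurable borel" and lim: "AE x in tm. (\<lambda>s. g s x) \<longlonglongrightarrow> f x"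
    and g: "\<And>s. Lp_le q (g s) a" and q: "0 < q"
  shows "Lp_le q f a"
proof -
  have [measurable]: "g s \<in> borel_measurable borel" for s using g by (auto simp: Lp_le_def)
  have a: "0 \<le> a" using g[of 0] by (simp add: Lp_le_def)
  have "(\<integral>\<^sup>+x. ennreal (norm (f x) powr q) \<partial>tm) = (\<integral>\<^sup>+x. liminf (\<lambda>s. ennreal (norm (g s x) powr q)) \<partial>tm)"
  proof (rule nn_integral_cong_AE)
    from lim show "AE x in tm. ennreal (norm (f x) powr q) = liminf (\<lambda>s. ennreal (norm (g s x) powr q))"
    proof eventually_elim
      case (elim x)
      have "(\<lambda>s. norm (g s x) powr q) \<longlonglongrightarrow> norm (f x) powr q"
        by (rule tendsto_powr') (use elim q in \<open>auto intro: tendsto_norm\<close>)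
      then have "(\<lambda>s. ennreal (norm (g s x) powr q)) \<longlonglongrightarrow> ennreal (norm (f x) powr q)"
        by (rule tendsto_ennrealI)
      then show ?case by (intro lim_imp_Liminf[symmetric]) auto
    qed
  qed
  also have "\<dots> \<le> liminf (\<lambda>s. \<integral>\<^sup>+x. ennreal (norm (g s x) powr q) \<partial>tm)"
    by (rule nn_integral_liminf) measurable
  also have "\<dots> \<le> liminf (\<lambda>s::nat. ennreal (a powr q))"
    by (rule Liminf_mono) (use g in \<open>auto simp: Lp_le_def\<close>)
  also have "\<dots> = ennreal (a powr q)" by (rule Liminf_const) simp
  finally show ?thesis using f a by (simp add: Lp_le_def)
qed

text \<open>That f lies in L_q is not known beforehand. The partial sums converge to f almost
  everywhere by their rate in L_p and are bounded in L_q, so Fatou's lemma applies.\<close>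

lemma Lp_le_of_blocks:
  fixes f :: "real^'d \<Rightarrow> complex"
  assumes f: "Lp_le p f 1" and per: "periodic_fun f" and p: "1 \<le> p" and q: "1 \<le> q" and r: "0 < r"
    and V: "\<And>s. Lp_le p (\<lambda>x. f x - vp_op (2^s) f x) (C * 2 powr (- (r * real s)))"
    and S: "\<And>s. Lp_le q (sigma_block s f) (\<delta> s)" and \<delta>: "summable \<delta>"
  shows "Lp_le q f (\<Sum>s. \<delta> s)"
proof (rule Lp_le_Fatou)
  show "f \<in> borel_measurable borel" using f by (simp add: Lp_le_def)
  show "AE x in tm. (\<lambda>s. vp_op (2^s) f x) \<longlonglongrightarrow> f x"
  proof (rule AE_limit_of_summable_Lp[OF _ V])
    have "0 \<le> C * 2 powr (- (r * real 0))" using V[of 0] by (simp only: Lp_le_def)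
    then have C: "0 \<le> C" by simp
    have "(C * 2 powr (- (r * real s))) powr p = C powr p * 2 powr (- ((r * p) * real s))" for s
      using C by (simp add: powr_mult powr_powr mult_ac)
    moreover have "summable (\<lambda>s::nat. C powr p * 2 powr (- ((r * p) * real s)))"
      using r p by (intro summable_mult summable_two_powr) auto
    ultimately show "summable (\<lambda>s. (C * 2 powr (- (r * real s))) powr p)" by (simp only:)
  qed (use p in simp)
  have d0: "0 \<le> \<delta> s" for s using S[of s] by (simp add: Lp_le_def)
  show "Lp_le q (vp_op (2^s) f) (\<Sum>s. \<delta> s)" for s
  proof -
    have "Lp_le q (\<lambda>x. \<Sum>u\<le>s. sigma_block u f x) (\<Sum>u\<le>s. \<delta> u)"
      by (intro Lp_le_sum S q) simp
    then show ?thesis unfolding vp_op_sum_sigma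
      by (rule Lp_le_mono) (use \<delta> d0 q in \<open>auto intro!: sum_le_suminf\<close>)
  qed
qed (use q in simp)

section \<open>Greedy sparse approximation\<close>

text \<open>The recursion mirrors the induction in \<open>power_add_taylor\<close>: |y| \<le> 8 sqrt
  w gives y^2 \<le> 64 w and y \<le> 8 w, whence the 64 and the 9 = 1 + 8.\<close>

primrec taylor_const :: "nat \<Rightarrow> real" where
  "taylor_const 0 = 0"
| "taylor_const (Suc m) = 64 * real (Suc m) + 9 * taylor_const m"

lemma taylor_const_nonneg: "0 \<le> taylor_const m"
  by (induction m) auto

text \<open>Increments of size sqrt w are natural for w = 1 + |R|^2 when R changes by a bounded
  amount; the remainder then has one power of w less than the main term.\<close>

lemma power_add_taylor:
  fixes w y :: real
  assumes w: "1 \<le> w" and y: "\<bar>y\<bar> \<le> 8 * sqrt w" and wy: "0 \<le> w + y"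
  shows "(w + y) ^ Suc m \<le> w ^ Suc m + real (Suc m) * w ^ m * y + taylor_const m * w ^ m"
proof (induction m)
  case 0
  show ?case by simp
next
  case (Suc m)
  let ?C = "taylor_const m"
  have C: "0 \<le> ?C" by (rule taylor_const_nonneg)
  have y2: "y\<^sup>2 \<le> 64 * w"
  proof -
    have "y\<^sup>2 \<le> (8 * sqrt w)\<^sup>2" using y by (metis abs_ge_zero power2_abs power_mono)
    then show ?thesis using w by (simp add: power_mult_distrib)
  qed
  have "sqrt w \<le> w" using w by (intro real_le_lsqrt) (auto simp: power2_eq_square mult_le_cancel_left1)
  then have y1: "y \<le> 8 * w" using y by linarith
  have "(w + y) ^ Suc (Suc m) = (w + y) * (w + y) ^ Suc m" by simp
  also have "\<dots> \<le> (w + y) * (w ^ Suc m + real (Suc m) * w ^ m * y + ?C * w ^ m)"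
    by (rule mult_left_mono[OF Suc.IH wy])
  also have "\<dots> = w ^ Suc (Suc m) + real (Suc (Suc m)) * w ^ Suc m * y
      + (real (Suc m) * w ^ m) * y\<^sup>2 + ?C * w ^ Suc m + (?C * w ^ m) * y"
    by (simp add: algebra_simps power2_eq_square)
  also have "(real (Suc m) * w ^ m) * y\<^sup>2 \<le> (real (Suc m) * w ^ m) * (64 * w)"
    using w by (intro mult_left_mono y2) auto
  also have "(?C * w ^ m) * y \<le> (?C * w ^ m) * (8 * w)"
    using w C by (intro mult_left_mono y1) auto
  finally show ?case by (simp add: algebra_simps)
qed

text \<open>The second summand absorbs |b|^2 \<le> 4 in the first-order term, so that only the part
  linear in b remains.\<close>

definition greedy_const :: "nat \<Rightarrow> real" where
  "greedy_const m = taylor_const m + 4 * real (Suc m)"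

lemma greedy_const_nonneg: "0 \<le> greedy_const m"
  using taylor_const_nonneg[of m] by (simp add: greedy_const_def)

lemma norm_add_power_taylor:
  fixes R b :: complex
  assumes b: "norm b \<le> 2" and M: "0 < M"
  shows "(1 + (norm (R + b))\<^sup>2) ^ Suc m
     \<le> (1 + greedy_const m / real M) * (1 + (norm R)\<^sup>2) ^ Suc m
       + greedy_const m * real M ^ m + real (Suc m) * (1 + (norm R)\<^sup>2) ^ m * (2 * Re (R * cnj b))"
proof -
  define w where "w = 1 + (norm R)\<^sup>2"
  define z where "z = 2 * Re (R * cnj b)"
  define y where "y = z + (norm b)\<^sup>2"
  have w: "1 \<le> w" by (simp add: w_def)
  have eq: "1 + (norm (R + b))\<^sup>2 = w + y"
    unfolding w_def y_def z_def cmod_power2 by (simp add: power2_eq_square algebra_simps)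
  have "(norm R)\<^sup>2 \<le> w" by (simp add: w_def)
  then have R: "norm R \<le> sqrt w" by (rule real_le_rsqrt)
  have sw: "1 \<le> sqrt w" using w by simp
  have "\<bar>z\<bar> \<le> 2 * norm (R * cnj b)" unfolding z_def using abs_Re_le_cmod[of "R * cnj b"] by simp
  also have "\<dots> \<le> 2 * (sqrt w * 2)" unfolding norm_mult complex_mod_cnj
    using R b w by (intro mult_left_mono mult_mono) auto
  finally have z: "\<bar>z\<bar> \<le> 4 * sqrt w" by simp
  have b2: "(norm b)\<^sup>2 \<le> 4" using power_mono[OF b, of 2] by simp
  have y: "\<bar>y\<bar> \<le> 8 * sqrt w" unfolding y_def using z b2 sw by (smt (verit) zero_le_power2)
  have wy: "0 \<le> w + y" unfolding eq[symmetric] by simp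
  \<comment> \<open>The remainder is divided by comparing w with M. The first part is growth by a
    factor 1 + K/M, harmless over M steps; the second is an increment of order M^m, which adds up to
    M^(m+1).\<close>
  have "w ^ m \<le> w ^ Suc m / real M + real M ^ m"
  proof (cases "w \<le> real M")
    case True
    then have "w ^ m \<le> real M ^ m" using w by (intro power_mono) auto
    then show ?thesis using w by (smt (verit) divide_nonneg_nonneg of_nat_0_le_iff zero_le_power)
  next
    case False
    then have "w ^ m * real M \<le> w ^ m * w" using w by (intro mult_left_mono) auto
    then have "w ^ m \<le> w ^ Suc m / real M" using M by (simp add: field_simps)
    then show ?thesis using zero_le_power[of "real M" m] by linarith
  qed
  then have wm: "greedy_const m * w ^ m \<le> greedy_const m * (w ^ Suc m / real M + real M ^ m)"
    by (rule mult_left_mono) (rule greedy_const_nonneg)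
  have "real (Suc m) * w ^ m * y \<le> real (Suc m) * w ^ m * (z + 4)"
    unfolding y_def using w b2 by (intro mult_left_mono) auto
  with power_add_taylor[OF w y wy, of m]
  have "(w + y) ^ Suc m \<le> w ^ Suc m + real (Suc m) * w ^ m * (z + 4) + taylor_const m * w ^ m"
    by linarith
  also have "w ^ Suc m + real (Suc m) * w ^ m * (z + 4) + taylor_const m * w ^ m
     = w ^ Suc m + real (Suc m) * w ^ m * z + greedy_const m * w ^ m"
    by (simp add: greedy_const_def algebra_simps)
  also have "\<dots> \<le> w ^ Suc m + real (Suc m) * w ^ m * z + greedy_const m * (w ^ Suc m / real M + real M ^ m)"
    using wm by linarith
  also have "\<dots> = (1 + greedy_const m / real M) * w ^ Suc m + greedy_const m * real M ^ m + real (Suc m) * w ^ m * z"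
    by (simp add: distrib_left distrib_right)
  finally show ?thesis unfolding eq w_def z_def .
qed

text \<open>Averaged over \<open>k\<close> with the weights \<open>u k\<close>, the first-order term vanishes; so some \<open>k\<close> does at least
  as well as the average.\<close>

lemma greedy_step:
  fixes R :: "real^'d \<Rightarrow> complex" and \<phi> :: "'k \<Rightarrow> real^'d \<Rightarrow> complex"
  assumes fin: "finite \<Lambda>" and u: "\<And>k. k \<in> \<Lambda> \<Longrightarrow> 0 \<le> u k" "(\<Sum>k\<in>\<Lambda>. u k) = 1"
    and [measurable]: "R \<in> borel_measurable borel" "\<And>k. \<phi> k \<in> borel_measurable borel"
    and B: "\<And>x. norm (R x) \<le> B" and \<phi>: "\<And>k x. norm (\<phi> k x) \<le> 1"
    and g: "\<And>x. g x = (\<Sum>k\<in>\<Lambda>. of_real (u k) * \<phi> k x)" and M: "0 < M"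
  shows "\<exists>k\<in>\<Lambda>. (\<integral>x. (1 + (norm (R x + (\<phi> k x - g x)))\<^sup>2) ^ Suc m \<partial>tm)
      \<le> (1 + greedy_const m / real M) * (\<integral>x. (1 + (norm (R x))\<^sup>2) ^ Suc m \<partial>tm) + greedy_const m * real M ^ m"
proof (rule ccontr)
  let ?E = "(1 + greedy_const m / real M) * (\<integral>x. (1 + (norm (R x))\<^sup>2) ^ Suc m \<partial>tm) + greedy_const m * real M ^ m"
  let ?I = "\<lambda>k. (\<integral>x. (1 + (norm (R x + (\<phi> k x - g x)))\<^sup>2) ^ Suc m \<partial>tm)"
  assume "\<not> (\<exists>k\<in>\<Lambda>. ?I k \<le> ?E)"
  then have gt: "?E < ?I k" if "k \<in> \<Lambda>" for k using that by (meson not_le)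
  have gm[measurable]: "g \<in> borel_measurable borel" unfolding g[abs_def] by measurable
  have gn: "norm (g x) \<le> 1" for x
  proof -
    have "norm (g x) \<le> (\<Sum>k\<in>\<Lambda>. norm (of_real (u k) * \<phi> k x))" unfolding g by (rule norm_sum)
    also have "\<dots> \<le> (\<Sum>k\<in>\<Lambda>. u k)"
      using u \<phi> by (intro sum_mono) (auto simp: norm_mult intro!: mult_left_le)
    finally show ?thesis using u by simp
  qed
  have bn: "norm (\<phi> k x - g x) \<le> 2" for k x
    using norm_triangle_ineq4[of "\<phi> k x" "g x"] \<phi>[of k x] gn[of x] by linarith
  have B0: "0 \<le> B" using B[of 0] norm_ge_zero order_trans by blast
  have intI: "integrable tm (\<lambda>x. (1 + (norm (R x + (\<phi> k x - g x)))\<^sup>2) ^ Suc m)" for k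
  proof (rule integrable_tm_bounded[where B="(1 + (B + 2)\<^sup>2) ^ Suc m"])
    show "(\<lambda>x. (1 + (norm (R x + (\<phi> k x - g x)))\<^sup>2) ^ Suc m) \<in> borel_measurable borel" by measurable
    fix x
    have "norm (R x + (\<phi> k x - g x)) \<le> B + 2"
      using norm_triangle_ineq[of "R x" "\<phi> k x - g x"] B[of x] bn[of k x] by linarith
    then have "(1 + (norm (R x + (\<phi> k x - g x)))\<^sup>2) ^ Suc m \<le> (1 + (B + 2)\<^sup>2) ^ Suc m"
      by (intro power_mono add_left_mono) auto
    then show "norm ((1 + (norm (R x + (\<phi> k x - g x)))\<^sup>2) ^ Suc m) \<le> (1 + (B + 2)\<^sup>2) ^ Suc m"
      by (simp only: real_norm_def abs_of_nonneg zero_le_power add_nonneg_nonneg zero_le_one zero_le_power2)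
  qed
  have intR: "integrable tm (\<lambda>x. (1 + (norm (R x))\<^sup>2) ^ Suc m)"
  proof (rule integrable_tm_bounded[where B="(1 + B\<^sup>2) ^ Suc m"])
    show "(\<lambda>x. (1 + (norm (R x))\<^sup>2) ^ Suc m) \<in> borel_measurable borel" by measurable
    fix x
    have "(1 + (norm (R x))\<^sup>2) ^ Suc m \<le> (1 + B\<^sup>2) ^ Suc m"
      using B by (intro power_mono add_left_mono) auto
    then show "norm ((1 + (norm (R x))\<^sup>2) ^ Suc m) \<le> (1 + B\<^sup>2) ^ Suc m"
      by (simp only: real_norm_def abs_of_nonneg zero_le_power add_nonneg_nonneg zero_le_one zero_le_power2)
  qed
  have avg: "(\<Sum>k\<in>\<Lambda>. u k * (1 + (norm (R x + (\<phi> k x - g x)))\<^sup>2) ^ Suc m)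
     \<le> (1 + greedy_const m / real M) * (1 + (norm (R x))\<^sup>2) ^ Suc m + greedy_const m * real M ^ m" for x
  proof -
    let ?F = "(1 + greedy_const m / real M) * (1 + (norm (R x))\<^sup>2) ^ Suc m + greedy_const m * real M ^ m"
    let ?G = "real (Suc m) * (1 + (norm (R x))\<^sup>2) ^ m"
    have "(\<Sum>k\<in>\<Lambda>. u k * (1 + (norm (R x + (\<phi> k x - g x)))\<^sup>2) ^ Suc m)
       \<le> (\<Sum>k\<in>\<Lambda>. u k * (?F + ?G * (2 * Re (R x * cnj (\<phi> k x - g x)))))"
      using u norm_add_power_taylor[OF bn M] by (intro sum_mono mult_left_mono) auto
    also have "\<dots> = (\<Sum>k\<in>\<Lambda>. u k) * ?F + 2 * ?G * (\<Sum>k\<in>\<Lambda>. u k * Re (R x * cnj (\<phi> k x - g x)))"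
    proof -
      have "(\<Sum>k\<in>\<Lambda>. u k * (F + G * (2 * v k))) = (\<Sum>k\<in>\<Lambda>. u k) * F + 2 * G * (\<Sum>k\<in>\<Lambda>. u k * v k)" for F G v
        by (simp add: distrib_left sum.distrib sum_distrib_left sum_distrib_right mult_ac)
      then show ?thesis .
    qed
    also have "(\<Sum>k\<in>\<Lambda>. u k * Re (R x * cnj (\<phi> k x - g x))) = Re (R x * cnj (\<Sum>k\<in>\<Lambda>. of_real (u k) * (\<phi> k x - g x)))"
      unfolding cnj_sum sum_distrib_left Re_sum by (intro sum.cong refl) (simp add: algebra_simps)
    also have "(\<Sum>k\<in>\<Lambda>. of_real (u k) * (\<phi> k x - g x)) = g x - of_real (\<Sum>k\<in>\<Lambda>. u k) * g x"
      unfolding right_diff_distrib sum_subtractf g[symmetric] of_real_sum sum_distrib_right ..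
    finally show ?thesis using u(2) by simp
  qed
  have "(\<Sum>k\<in>\<Lambda>. u k * ?E) < (\<Sum>k\<in>\<Lambda>. u k * ?I k)"
  proof -
    obtain k where k: "k \<in> \<Lambda>" "u k \<noteq> 0" using u(2) by (metis sum.neutral zero_neq_one)
    then have uk: "0 < u k" using u(1)[of k] by simp
    show ?thesis
    proof (rule sum_strict_mono_ex1[OF fin])
      show "\<forall>k\<in>\<Lambda>. u k * ?E \<le> u k * ?I k"
        by (intro ballI) (rule mult_left_mono[OF less_imp_le[OF gt] u(1)])
      show "\<exists>k\<in>\<Lambda>. u k * ?E < u k * ?I k"
        by (rule bexI[of _ k]) (rule mult_strict_left_mono[OF gt[OF k(1)] uk], rule k(1))
    qed
  qed
  moreover have "(\<Sum>k\<in>\<Lambda>. u k * ?E) = ?E" 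
    unfolding sum_distrib_right[symmetric] u(2) by (rule mult_1_left)
  moreover have "(\<Sum>k\<in>\<Lambda>. u k * ?I k) \<le> ?E"
  proof -
    have "(\<Sum>k\<in>\<Lambda>. u k * ?I k) = (\<Sum>k\<in>\<Lambda>. \<integral>x. u k * (1 + (norm (R x + (\<phi> k x - g x)))\<^sup>2) ^ Suc m \<partial>tm)"
      by (simp only: integral_mult_right_zero)
    also have "\<dots> = (\<integral>x. (\<Sum>k\<in>\<Lambda>. u k * (1 + (norm (R x + (\<phi> k x - g x)))\<^sup>2) ^ Suc m) \<partial>tm)"
      by (rule Bochner_Integration.integral_sum[symmetric]) (intro integrable_mult_right intI)
    also have "\<dots> \<le> (\<integral>x. (1 + greedy_const m / real M) * (1 + (norm (R x))\<^sup>2) ^ Suc m + greedy_const m * real M ^ m \<partial>tm)"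
    proof (rule integral_mono[OF _ _ avg])
      show "integrable tm (\<lambda>x. \<Sum>k\<in>\<Lambda>. u k * (1 + (norm (R x + (\<phi> k x - g x)))\<^sup>2) ^ Suc m)"
        by (intro Bochner_Integration.integrable_sum integrable_mult_right intI)
      show "integrable tm (\<lambda>x. (1 + greedy_const m / real M) * (1 + (norm (R x))\<^sup>2) ^ Suc m + greedy_const m * real M ^ m)"
        by (intro Bochner_Integration.integrable_add integrable_mult_right intR) simp
    qed
    also have "\<dots> = ?E"
      by (subst Bochner_Integration.integral_add[OF integrable_mult_right[OF intR]]) (simp_all del: power_Suc)
    finally show ?thesis .
  qed
  ultimately show False by linarith
qed

text \<open>Division by A makes the polynomial a convex combination of the unimodular functions
  \<open>sgn (c k) * tchar k x\<close>, with weights |c k| / A. Every step adds one of them, so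
  after j steps the sum is compared with j times the average.\<close>

lemma greedy_sum:
  fixes c :: "int^'d \<Rightarrow> complex"
  assumes fin: "finite \<Lambda>" and A: "A = (\<Sum>k\<in>\<Lambda>. norm (c k))" "0 < A" and M: "0 < M"
  shows "\<exists>\<Theta> b. \<Theta> \<subseteq> \<Lambda> \<and> card \<Theta> \<le> j \<and>
    (\<integral>x. (1 + (norm (trig_poly \<Theta> b x - of_nat j * (trig_poly \<Lambda> c x / of_real A)))\<^sup>2) ^ Suc m \<partial>tm)
      \<le> (1 + greedy_const m / real M) ^ j * (1 + real j * (greedy_const m * real M ^ m))"
proof (induction j)
  case 0
  show ?case by (rule exI[of _ "{}"]) (simp add: trig_poly_def)
next
  case (Suc j)
  let ?K = "greedy_const m" and ?g = "\<lambda>x. trig_poly \<Lambda> c x / of_real A"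
  have K: "0 \<le> ?K" by (rule greedy_const_nonneg)
  from Suc obtain \<Theta> b where \<Theta>: "\<Theta> \<subseteq> \<Lambda>" "card \<Theta> \<le> j" and
    I: "(\<integral>x. (1 + (norm (trig_poly \<Theta> b x - of_nat j * ?g x))\<^sup>2) ^ Suc m \<partial>tm)
      \<le> (1 + ?K / real M) ^ j * (1 + real j * (?K * real M ^ m))" by blast
  have fin\<Theta>: "finite \<Theta>" using \<Theta>(1) fin by (rule finite_subset)
  let ?R = "\<lambda>x. trig_poly \<Theta> b x - of_nat j * ?g x"
  let ?\<phi> = "\<lambda>k x. sgn (c k) * tchar k x"
  have "\<exists>k\<in>\<Lambda>. (\<integral>x. (1 + (norm (?R x + (?\<phi> k x - ?g x)))\<^sup>2) ^ Suc m \<partial>tm)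
      \<le> (1 + ?K / real M) * (\<integral>x. (1 + (norm (?R x))\<^sup>2) ^ Suc m \<partial>tm) + ?K * real M ^ m"
  proof (rule greedy_step[OF fin, where u="\<lambda>k. norm (c k) / A" and B="(\<Sum>k\<in>\<Theta>. norm (b k)) + real j * ((\<Sum>k\<in>\<Lambda>. norm (c k)) / A)"])
    show "(\<Sum>k\<in>\<Lambda>. norm (c k) / A) = 1" using A by (simp flip: sum_divide_distrib)
    show "0 \<le> norm (c k) / A" for k using A by simp
    show "?R \<in> borel_measurable borel" by measurable
    show "?\<phi> k \<in> borel_measurable borel" for k by measurable
    show "norm (?\<phi> k x) \<le> 1" for k x by (simp add: norm_mult norm_sgn)
    show "norm (?R x) \<le> (\<Sum>k\<in>\<Theta>. norm (b k)) + real j * ((\<Sum>k\<in>\<Lambda>. norm (c k)) / A)" for x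
    proof -
      have "norm (?R x) \<le> norm (trig_poly \<Theta> b x) + norm (of_nat j * ?g x)" by (rule norm_triangle_ineq4)
      also have "norm (of_nat j * ?g x) = real j * (norm (trig_poly \<Lambda> c x) / A)"
        using A(2) by (simp add: norm_mult norm_divide)
      also have "norm (trig_poly \<Theta> b x) + real j * (norm (trig_poly \<Lambda> c x) / A)
         \<le> (\<Sum>k\<in>\<Theta>. norm (b k)) + real j * ((\<Sum>k\<in>\<Lambda>. norm (c k)) / A)"
        using A by (intro add_mono mult_left_mono divide_right_mono norm_trig_poly_le) auto
      finally show ?thesis .
    qed
    show "?g x = (\<Sum>k\<in>\<Lambda>. of_real (norm (c k) / A) * ?\<phi> k x)" for x
    proof -
      have "of_real (norm z) * sgn z = z" for z :: complex by (simp add: sgn_eq)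
      then have "of_real (norm z / A) * (sgn z * t) = z * t / of_real A" for z t :: complex
        by (simp add: mult.assoc[symmetric])
      then show ?thesis unfolding trig_poly_tchar sum_divide_distrib by (simp only:)
    qed
  qed (use M in auto)
  then obtain k where k: "k \<in> \<Lambda>" and Ik: "(\<integral>x. (1 + (norm (?R x + (?\<phi> k x - ?g x)))\<^sup>2) ^ Suc m \<partial>tm)
      \<le> (1 + ?K / real M) * (\<integral>x. (1 + (norm (?R x))\<^sup>2) ^ Suc m \<partial>tm) + ?K * real M ^ m" by blast
  \<comment> \<open>The selected frequency may have been chosen before; then its coefficient is
    increased and the set does not grow, which is why only an upper bound on
    \<open>card \<Theta>\<close> is claimed.\<close>
  define b' where "b' l = (if l \<in> \<Theta> then b l else 0) + (if l = k then sgn (c k) else 0)" for l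
  have tp: "trig_poly (insert k \<Theta>) b' x = trig_poly \<Theta> b x + ?\<phi> k x" for x
  proof -
    have "trig_poly (insert k \<Theta>) b' x = (\<Sum>l\<in>insert k \<Theta>. (if l \<in> \<Theta> then b l * tchar l x else 0))
       + (\<Sum>l\<in>insert k \<Theta>. (if l = k then sgn (c k) * tchar k x else 0))"
      unfolding trig_poly_tchar sum.distrib[symmetric] b'_def by (intro sum.cong refl) (auto simp: distrib_right)
    also have "(\<Sum>l\<in>insert k \<Theta>. (if l \<in> \<Theta> then b l * tchar l x else 0)) = (\<Sum>l\<in>\<Theta>. b l * tchar l x)"
      using fin\<Theta> by (intro sum.mono_neutral_cong_right) auto
    also have "(\<Sum>l\<in>insert k \<Theta>. (if l = k then sgn (c k) * tchar k x else 0)) = ?\<phi> k x"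
      using fin\<Theta> by (subst sum.delta) auto
    finally show ?thesis by (simp add: trig_poly_tchar)
  qed
  have eq: "trig_poly (insert k \<Theta>) b' x - of_nat (Suc j) * ?g x = ?R x + (?\<phi> k x - ?g x)" for x
    unfolding tp of_nat_Suc distrib_right by simp
  let ?q = "1 + ?K / real M"
  have q: "1 \<le> ?q" using K by simp
  have "(\<integral>x. (1 + (norm (?R x + (?\<phi> k x - ?g x)))\<^sup>2) ^ Suc m \<partial>tm)
     \<le> ?q * (?q ^ j * (1 + real j * (?K * real M ^ m))) + ?K * real M ^ m"
    using Ik mult_left_mono[OF I, of ?q] q by linarith
  also have "\<dots> \<le> ?q ^ Suc j * (1 + real j * (?K * real M ^ m)) + ?q ^ Suc j * (?K * real M ^ m)"
  proof -
    have "1 * (?K * real M ^ m) \<le> ?q ^ Suc j * (?K * real M ^ m)"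
      using K by (intro mult_right_mono one_le_power q) auto
    then show ?thesis by (simp add: mult.assoc)
  qed
  also have "\<dots> = ?q ^ Suc j * (1 + real (Suc j) * (?K * real M ^ m))"
  proof -
    have "Q * (1 + a * X) + Q * X = Q * (1 + (1 + a) * X)" for Q a X :: real by (simp add: algebra_simps)
    then show ?thesis unfolding of_nat_Suc .
  qed
  finally have "(\<integral>x. (1 + (norm (trig_poly (insert k \<Theta>) b' x - of_nat (Suc j) * ?g x))\<^sup>2) ^ Suc m \<partial>tm)
     \<le> ?q ^ Suc j * (1 + real (Suc j) * (?K * real M ^ m))" unfolding eq .
  moreover have "insert k \<Theta> \<subseteq> \<Lambda>" using k \<Theta> by simp
  moreover have "card (insert k \<Theta>) \<le> Suc j" using \<Theta>(2) fin\<Theta> by (simp add: card_insert_if)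
  ultimately show ?case by blast
qed

lemma m_term_approximation:
  fixes q :: real
  assumes q: "1 \<le> q"
  obtains G where "0 < G" "\<And>\<Lambda> (c :: int^'d \<Rightarrow> complex) M. finite \<Lambda> \<Longrightarrow> 0 < M \<Longrightarrow>
    \<exists>\<Theta> b. \<Theta> \<subseteq> \<Lambda> \<and> card \<Theta> \<le> M \<and>
      Lp_le q (\<lambda>x. trig_poly \<Lambda> c x - trig_poly \<Theta> b x) (G * real M powr (-1/2) * (\<Sum>k\<in>\<Lambda>. norm (c k)))"
proof -
  \<comment> \<open>The potential (1 + |R|^2)^(m+1) must dominate |R|^q after scaling by M, which
    asks for q/2 \<le> m + 1.\<close>
  define m where "m = nat \<lceil>q\<rceil>"
  have m: "q / 2 \<le> real (Suc m)" using q unfolding m_def by linarith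
  let ?K = "greedy_const m"
  have K: "0 \<le> ?K" by (rule greedy_const_nonneg)
  define G where "G = 1 + exp ?K * (1 + ?K)"
  have G1: "1 \<le> G" using K by (simp add: G_def)
  have main: "\<exists>\<Theta> b. \<Theta> \<subseteq> \<Lambda> \<and> card \<Theta> \<le> M \<and>
      Lp_le q (\<lambda>x. trig_poly \<Lambda> c x - trig_poly \<Theta> b x) (G * real M powr (-1/2) * (\<Sum>k\<in>\<Lambda>. norm (c k)))"
    if fin: "finite \<Lambda>" and M: "0 < M" for \<Lambda> and c :: "int^'d \<Rightarrow> complex" and M
  proof -
    define A where "A = (\<Sum>k\<in>\<Lambda>. norm (c k))"
    show ?thesis
    proof (cases "A = 0")
      case True
      then have "c k = 0" if "k \<in> \<Lambda>" for k
        using that fin unfolding A_def by (subst (asm) sum_nonneg_eq_0_iff) auto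
      then have "trig_poly \<Lambda> c x - trig_poly {} c x = 0" for x by (simp add: trig_poly_def)
      then show ?thesis using True Lp_le_zero[of q] q unfolding A_def[symmetric]
        by (intro exI[of _ "{}"] exI[of _ c]) simp
    next
      case False
      then have A: "0 < A" using sum_nonneg[of \<Lambda> "\<lambda>k. norm (c k)"] by (simp add: A_def)
      let ?g = "\<lambda>x. trig_poly \<Lambda> c x / of_real A"
      obtain \<Theta> b where \<Theta>: "\<Theta> \<subseteq> \<Lambda>" "card \<Theta> \<le> M" and
        I: "(\<integral>x. (1 + (norm (trig_poly \<Theta> b x - of_nat M * ?g x))\<^sup>2) ^ Suc m \<partial>tm)
          \<le> (1 + ?K / real M) ^ M * (1 + real M * (?K * real M ^ m))"
        using greedy_sum[OF fin A_def A M, of M m] by blast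
      let ?R = "\<lambda>x. trig_poly \<Theta> b x - of_nat M * ?g x"
      have Rm[measurable]: "?R \<in> borel_measurable borel" by measurable
      have RB: "norm (?R x) \<le> (\<Sum>k\<in>\<Theta>. norm (b k)) + real M" for x
      proof -
        have "norm (?R x) \<le> norm (trig_poly \<Theta> b x) + norm (of_nat M * ?g x)" by (rule norm_triangle_ineq4)
        also have "norm (of_nat M * ?g x) = real M * (norm (trig_poly \<Lambda> c x) / A)"
          using A by (simp add: norm_mult norm_divide)
        also have "norm (trig_poly \<Theta> b x) + real M * (norm (trig_poly \<Lambda> c x) / A)
           \<le> (\<Sum>k\<in>\<Theta>. norm (b k)) + real M * (A / A)"
          using A norm_trig_poly_le[of \<Lambda> c x] by (intro add_mono mult_left_mono divide_right_mono norm_trig_poly_le) (auto simp: A_def)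
        finally show ?thesis using A by simp
      qed
      have M1: "1 \<le> real M ^ Suc m" using M by (intro one_le_power) simp
      have "(1 + ?K / real M) ^ M \<le> exp (?K / real M) ^ M"
        using K by (intro power_mono exp_ge_add_one_self) (auto intro: add_nonneg_nonneg)
      also have "\<dots> = exp ?K" using M by (simp flip: exp_of_nat_mult)
      finally have "(1 + ?K / real M) ^ M * (1 + real M * (?K * real M ^ m)) \<le> exp ?K * (1 + ?K * real M ^ Suc m)"
        using K by (intro mult_mono) (auto simp: mult_ac)
      also have "\<dots> \<le> exp ?K * ((1 + ?K) * real M ^ Suc m)"
        using M1 by (intro mult_left_mono) (auto simp: distrib_right)
      finally have I2: "(\<integral>x. (1 + (norm (?R x))\<^sup>2) ^ Suc m \<partial>tm) \<le> exp ?K * ((1 + ?K) * real M ^ Suc m)"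
        using I by linarith
      have intR: "integrable tm (\<lambda>x. (1 + (norm (?R x))\<^sup>2) ^ Suc m)"
      proof (rule integrable_tm_bounded[where B="(1 + ((\<Sum>k\<in>\<Theta>. norm (b k)) + real M)\<^sup>2) ^ Suc m"])
        show "(\<lambda>x. (1 + (norm (?R x))\<^sup>2) ^ Suc m) \<in> borel_measurable borel" by measurable
        fix x
        have "(1 + (norm (?R x))\<^sup>2) ^ Suc m \<le> (1 + ((\<Sum>k\<in>\<Theta>. norm (b k)) + real M)\<^sup>2) ^ Suc m"
          using RB by (intro power_mono add_left_mono) auto
        then show "norm ((1 + (norm (?R x))\<^sup>2) ^ Suc m) \<le> (1 + ((\<Sum>k\<in>\<Theta>. norm (b k)) + real M)\<^sup>2) ^ Suc m"
          by (simp only: real_norm_def abs_of_nonneg zero_le_power add_nonneg_nonneg zero_le_one zero_le_power2)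
      qed
      have I3: "(\<integral>\<^sup>+x. ennreal ((1 + (norm (?R x))\<^sup>2) ^ Suc m) \<partial>tm) \<le> ennreal (exp ?K * ((1 + ?K) * real M ^ Suc m))"
        using I2 by (subst nn_integral_eq_integral[OF intR]) (auto simp del: power_Suc intro!: ennreal_leI)
      let ?s = "real M powr (q/2)"
      have "(\<integral>\<^sup>+x. ennreal (norm (?R x) powr q) \<partial>tm)
         \<le> ennreal ((?s / real M ^ Suc m) * (exp ?K * ((1 + ?K) * real M ^ Suc m)) + ?s * 1)"
      proof (rule nn_integral_tm_lincomb_le[where G="\<lambda>x. (1 + (norm (?R x))\<^sup>2) ^ Suc m" and H="\<lambda>x. 1"])
        fix x
        let ?n = "norm (?R x)"
        have "?n powr q = (?n\<^sup>2) powr (q/2)"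
          by (cases "?n = 0") (auto simp: powr_powr simp flip: powr_numeral)
        also have "\<dots> = ?s * (?n\<^sup>2 / real M) powr (q/2)"
          using M by (simp add: powr_divide)
        also have "\<dots> \<le> ?s * (1 + (?n\<^sup>2 / real M) ^ Suc m)"
          using q m by (intro mult_left_mono powr_le_one_plus_power) auto
        also have "(?n\<^sup>2 / real M) ^ Suc m \<le> (1 + ?n\<^sup>2) ^ Suc m / real M ^ Suc m"
          unfolding power_divide by (intro divide_right_mono power_mono) auto
        finally show "?n powr q \<le> ?s / real M ^ Suc m * (1 + ?n\<^sup>2) ^ Suc m + ?s * 1"
          by (simp add: distrib_left mult_left_mono del: power_Suc)
      qed (use I3 K in \<open>auto simp del: power_Suc\<close>)
      also have "(?s / real M ^ Suc m) * (exp ?K * ((1 + ?K) * real M ^ Suc m)) + ?s * 1 = ?s * G"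
        using M by (simp add: G_def algebra_simps del: power_Suc)
      also have "?s * G \<le> (sqrt (real M) * G) powr q"
      proof -
        have "(sqrt (real M)) powr q = ?s" by (simp add: powr_half_sqrt[symmetric] powr_powr)
        moreover have "G powr 1 \<le> G powr q" using G1 q by (intro powr_mono) auto
        ultimately show ?thesis using G1 by (simp add: powr_mult mult_left_mono)
      qed
      finally have "Lp_le q ?R (sqrt (real M) * G)"
        using G1 by (simp add: Lp_le_def ennreal_leI)
      \<comment> \<open>Rescaling by A / M turns the sum of M selected terms into an approximant of
        the original polynomial; the error sqrt M becomes M^(-1/2) A.\<close>
      from Lp_le_cmult[OF this, of "- of_real (A / real M)"] q
      have L: "Lp_le q (\<lambda>x. - of_real (A / real M) * ?R x) (A / real M * (sqrt (real M) * G))"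
        using A by (simp add: norm_mult norm_divide)
      have "- of_real (A / real M) * ?R x = trig_poly \<Lambda> c x - trig_poly \<Theta> (\<lambda>k. of_real (A / real M) * b k) x" for x
      proof -
        have "trig_poly \<Theta> (\<lambda>k. of_real (A / real M) * b k) x = of_real (A / real M) * trig_poly \<Theta> b x"
          by (simp add: trig_poly_def sum_distrib_left mult.assoc)
        moreover have "of_real (A / real M) * (of_nat M * ?g x) = trig_poly \<Lambda> c x"
          using A M by simp
        ultimately show ?thesis by (simp only: right_diff_distrib) (simp add: algebra_simps)
      qed
      moreover have "A / real M * (sqrt (real M) * G) = G * real M powr (-1/2) * A"
      proof -
        have "sqrt (real M) / real M = real M powr (-1/2)"
          using M powr_diff[of "real M" "1/2" 1] by (simp add: powr_half_sqrt)
        then show ?thesis by (metis mult.assoc mult.commute times_divide_eq_right)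
      qed
      ultimately have "Lp_le q (\<lambda>x. trig_poly \<Lambda> c x - trig_poly \<Theta> (\<lambda>k. of_real (A / real M) * b k) x) (G * real M powr (-1/2) * A)"
        using L by simp
      then show ?thesis using \<Theta> unfolding A_def[symmetric] by blast
    qed
  qed
  have "0 < G" using G1 by simp
  then show ?thesis using main by (rule that)
qed

section \<open>The norm of B_{q,1}\<close>

lemma set_integrable_torus_iff:
  fixes F :: "real^'d \<Rightarrow> 'b :: {banach, second_countable_topology}"
  assumes [measurable]: "F \<in> borel_measurable borel"
  shows "set_integrable lebesgue torus F \<longleftrightarrow> integrable tm F"
proof -
  have "integrable tm F \<longleftrightarrow> integrable lborel (\<lambda>x. (indicator torus x / (2*pi) ^ CARD('d)) *\<^sub>R F x)"
    unfolding tm_def by (rule integrable_density) auto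
  also have "(\<lambda>x. (indicator torus x / (2*pi) ^ CARD('d)) *\<^sub>R F x) = (\<lambda>x. (1 / (2*pi) ^ CARD('d)) *\<^sub>R (indicator torus x *\<^sub>R F x))"
    by simp
  also have "integrable lborel \<dots> \<longleftrightarrow> integrable lborel (\<lambda>x. indicator torus x *\<^sub>R F x)"
  proof
    assume "integrable lborel (\<lambda>x. (1 / (2*pi) ^ CARD('d)) *\<^sub>R (indicator torus x *\<^sub>R F x))"
    from integrable_scaleR_right[OF this, of "(2*pi) ^ CARD('d)"]
    show "integrable lborel (\<lambda>x. indicator torus x *\<^sub>R F x)" by simp
  qed (rule integrable_scaleR_right)
  also have "\<dots> \<longleftrightarrow> integrable lebesgue (\<lambda>x. indicator torus x *\<^sub>R F x)"
    by (rule integrable_completion[symmetric]) measurable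
  finally show ?thesis by (simp add: set_integrable_def)
qed

lemma Lp_norm_tm:
  fixes f :: "real^'d \<Rightarrow> complex"
  assumes [measurable]: "f \<in> borel_measurable borel"
  shows "Lp_norm p f = (\<integral>x. norm (f x) powr p \<partial>tm) powr (1/p)"
  unfolding Lp_norm_def by (subst integral_tm_lebesgue) auto

lemma Lp_le_integrable:
  assumes "Lp_le p f a"
  shows "integrable tm (\<lambda>x. norm (f x) powr p)"
proof (rule integrableI_bounded)
  show "(\<lambda>x. norm (f x) powr p) \<in> borel_measurable tm" using assms by (auto simp: Lp_le_def)
  show "(\<integral>\<^sup>+x. ennreal (norm (norm (f x) powr p)) \<partial>tm) < \<infinity>"
    using assms by (auto simp: Lp_le_def intro: le_less_trans)
qed

lemma Lp_norm_le:
  assumes "Lp_le p f a" "0 < p"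
  shows "Lp_norm p f \<le> a"
proof -
  have f: "f \<in> borel_measurable borel" and a: "0 \<le> a" using assms by (auto simp: Lp_le_def)
  have "ennreal (\<integral>x. norm (f x) powr p \<partial>tm) = (\<integral>\<^sup>+x. ennreal (norm (f x) powr p) \<partial>tm)"
    by (rule nn_integral_eq_integral[OF Lp_le_integrable[OF assms(1)], symmetric]) simp
  also have "\<dots> \<le> ennreal (a powr p)" using assms by (simp add: Lp_le_def)
  finally have "(\<integral>x. norm (f x) powr p \<partial>tm) \<le> a powr p" by (subst (asm) ennreal_le_iff) auto
  then have "(\<integral>x. norm (f x) powr p \<partial>tm) powr (1/p) \<le> (a powr p) powr (1/p)"
    using assms by (intro powr_mono2) auto
  then show ?thesis using f a assms by (simp add: Lp_norm_tm powr_powr)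
qed

lemma Lp_le_Lp_norm:
  fixes f :: "real^'d \<Rightarrow> complex"
  assumes f: "f \<in> borel_measurable borel" and int: "integrable tm (\<lambda>x. norm (f x) powr p)" and p: "0 < p"
  shows "Lp_le p f (Lp_norm p f)"
proof -
  have "(\<integral>\<^sup>+x. ennreal (norm (f x) powr p) \<partial>tm) = ennreal (\<integral>x. norm (f x) powr p \<partial>tm)"
    by (rule nn_integral_eq_integral[OF int]) simp
  then show ?thesis using f p by (simp add: Lp_le_def Lp_norm_tm powr_powr)
qed

lemma in_Lp_borel_iff:
  assumes "f \<in> borel_measurable borel" "periodic_fun f"
  shows "in_Lp p f \<longleftrightarrow> integrable tm (\<lambda>x. norm (f x) powr p)"
proof -
  have "f \<in> borel_measurable lebesgue" using assms(1) by (simp add: measurable_completion)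
  moreover have "(\<lambda>x. norm (f x) powr p) \<in> borel_measurable borel" using assms(1) by measurable
  ultimately show ?thesis using assms(2) by (simp add: in_Lp_def set_integrable_torus_iff)
qed

lemma Lp_norm_nonneg: "0 \<le> Lp_norm p f"
  by (simp add: Lp_norm_def)

lemma near_frequencies:
  assumes "scoef s k \<noteq> 0" "scoef u k \<noteq> 0"
  shows "s \<le> u + 1"
proof (rule ccontr)
  assume "\<not> s \<le> u + 1"
  then have su: "u + 1 \<le> s - 1" "0 < s" by auto
  have "Box (2^(u+1)) \<subseteq> (Box (2^(s-1)) :: (int^'a) set)"
    using su by (intro Box_mono power_increasing) auto
  then show False using scoef_support(1)[OF assms(2)] scoef_support(2)[OF assms(1) su(2)] by blast
qed

text \<open>If the approximant of each block uses only frequencies of that block, the multiplier of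
  index u annihilates all errors except those of the blocks u - 1, u and u + 1. Blockwise errors in
  L_q therefore control the norm of B_{q,1}.\<close>

lemma Lp_le_blocks_of_difference:
  fixes f :: "real^'d \<Rightarrow> complex" and c :: "nat \<Rightarrow> int^'d \<Rightarrow> complex"
  assumes f: "Lp_le q f a" and per: "periodic_fun f" and q: "1 \<le> q"
    and supp: "\<And>s k. c s k \<noteq> 0 \<Longrightarrow> scoef s k \<noteq> 0" and zero: "\<And>s k. S < s \<Longrightarrow> c s k = 0"
    and err: "\<And>s. Lp_le q (trig_poly (Box (2^(s+1))) (\<lambda>k. of_real (scoef s k) * fhat f k - c s k)) (\<delta> s)"
  shows "Lp_le q (sigma_block u (\<lambda>x. f x - trig_poly (Box (2^(S+1))) (\<lambda>k. \<Sum>s\<le>S. c s k) x))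
     (2 * 3 ^ CARD('d) * (\<Sum>s\<in>{u-1..u+1}. \<delta> s))"
proof -
  let ?T = "trig_poly (Box (2^(S+1))) (\<lambda>k. \<Sum>s\<le>S. c s k)"
  define e where "e s k = of_real (scoef s k) * fhat f k - c s k" for s k
  let ?E = "\<lambda>s. trig_poly (Box (2^(s+1))) (e s)"
  have f1: "Lp_le 1 f a" by (rule Lp_le_exponent_mono[OF f]) (use q in auto)
  have T1: "Lp_le 1 ?T (\<Sum>k\<in>Box (2^(S+1)). norm (\<Sum>s\<le>S. c s k))" by (rule Lp_le_trig_poly_trivial) simp
  have es: "scoef s k \<noteq> 0" if "e s k \<noteq> 0" for s k
    using that supp[of s k] by (auto simp: e_def)
  have E1: "Lp_le 1 (?E s) (\<Sum>k\<in>Box (2^(s+1)). norm (e s k))" for s by (rule Lp_le_trig_poly_trivial) simp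
  have fE: "fhat (?E s) k = e s k" for s k
    using es[of s k] scoef_support(1)[of s k] by (auto simp: fhat_trig_poly)
  have fT: "fhat ?T k = (\<Sum>s\<le>S. c s k)" for k
  proof (cases "k \<in> Box (2^(S+1))")
    case False
    have "c s k = 0" if "s \<le> S" for s
    proof (rule ccontr)
      assume "c s k \<noteq> 0"
      then have "k \<in> Box (2^(s+1))" using supp scoef_support(1) by blast
      moreover have "Box (2^(s+1)) \<subseteq> (Box (2^(S+1)) :: (int^'d) set)"
        using that by (intro Box_mono power_increasing) auto
      ultimately show False using False by blast
    qed
    then show ?thesis using False by (subst fhat_trig_poly) auto
  qed (simp add: fhat_trig_poly)
  have main: "of_real (scoef u k) * (fhat f k - fhat ?T k) = (\<Sum>s\<in>{u-1..u+1}. of_real (scoef u k) * fhat (?E s) k)"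
    if k: "k \<in> Box (2^(u+1))" for k
  proof -
    \<comment> \<open>Large enough to include all nonzero \<open>c s\<close> and, at the frequency
      k, to make the block multipliers sum to 1; then f and the approximant are sums over the same
      range of blocks.\<close>
    let ?m = "max S (u + 1)"
    have "Box (2^(u+1)) \<subseteq> (Box (2^?m) :: (int^'d) set)" by (intro Box_mono power_increasing) auto
    then have "k \<in> Box (2^?m)" using k by blast
    then have "(\<Sum>s\<le>?m. of_real (scoef s k)) = (1::complex)"
      using sum_scoef[of k ?m] by (simp add: vcoef_one flip: of_real_sum)
    then have "fhat f k = (\<Sum>s\<le>?m. of_real (scoef s k)) * fhat f k" by simp
    also have "\<dots> = (\<Sum>s\<le>?m. of_real (scoef s k) * fhat f k)" by (rule sum_distrib_right)
    finally have 1: "fhat f k = (\<Sum>s\<le>?m. of_real (scoef s k) * fhat f k)" .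
    have 2: "fhat ?T k = (\<Sum>s\<le>?m. c s k)"
      unfolding fT by (rule sum.mono_neutral_left) (auto intro: zero)
    have "of_real (scoef u k) * (fhat f k - fhat ?T k) = of_real (scoef u k) * (\<Sum>s\<le>?m. e s k)"
      unfolding e_def sum_subtractf 1[symmetric] 2[symmetric] ..
    also have "\<dots> = (\<Sum>s\<le>?m. of_real (scoef u k) * e s k)" by (rule sum_distrib_left)
    also have "\<dots> = (\<Sum>s\<in>{u-1..u+1}. of_real (scoef u k) * e s k)"
    proof (rule sum.mono_neutral_right)
      show "\<forall>s\<in>{..?m} - {u-1..u+1}. of_real (scoef u k) * e s k = 0"
      proof (intro ballI, rule ccontr)
        fix s assume s: "s \<in> {..?m} - {u-1..u+1}" and ne: "of_real (scoef u k) * e s k \<noteq> 0"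
        then have "scoef u k \<noteq> 0" "scoef s k \<noteq> 0" using es by auto
        then have "s \<le> u + 1" "u \<le> s + 1" using near_frequencies by blast+
        then show False using s by auto
      qed
    qed auto
    finally show ?thesis by (simp only: fE)
  qed
  have "sigma_block u (\<lambda>x. f x - ?T x) = trig_poly (Box (2^(u+1))) (\<lambda>k. of_real (scoef u k) * (fhat f k - fhat ?T k))"
    using sigma_block_trig_poly[OF Lp_le_diff[OF f1 T1] periodic_diff[OF per periodic_trig_poly]]
    by (simp only: fhat_diff[OF f1 per T1 periodic_trig_poly] order_refl)
  also have "\<dots> = trig_poly (Box (2^(u+1))) (\<lambda>k. \<Sum>s\<in>{u-1..u+1}. of_real (scoef u k) * fhat (?E s) k)"
    by (rule trig_poly_cong) (rule main)
  also have "\<dots> = (\<lambda>x. \<Sum>s\<in>{u-1..u+1}. sigma_block u (?E s) x)"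
  proof
    fix x
    have "trig_poly (Box (2^(u+1))) (\<lambda>k. \<Sum>s\<in>{u-1..u+1}. of_real (scoef u k) * fhat (?E s) k) x
       = (\<Sum>s\<in>{u-1..u+1}. trig_poly (Box (2^(u+1))) (\<lambda>k. of_real (scoef u k) * fhat (?E s) k) x)"
      unfolding trig_poly_tchar sum_distrib_right by (rule sum.swap)
    then show "trig_poly (Box (2^(u+1))) (\<lambda>k. \<Sum>s\<in>{u-1..u+1}. of_real (scoef u k) * fhat (?E s) k) x
       = (\<Sum>s\<in>{u-1..u+1}. sigma_block u (?E s) x)"
      by (simp only: sigma_block_trig_poly[OF E1 periodic_trig_poly])
  qed
  finally have eq: "sigma_block u (\<lambda>x. f x - ?T x) = (\<lambda>x. \<Sum>s\<in>{u-1..u+1}. sigma_block u (?E s) x)" .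
  have "Lp_le q (\<lambda>x. \<Sum>s\<in>{u-1..u+1}. sigma_block u (?E s) x) (\<Sum>s\<in>{u-1..u+1}. 2 * 3 ^ CARD('d) * \<delta> s)"
    by (intro Lp_le_sum Lp_le_sigma_block periodic_trig_poly q) (use err in \<open>auto simp: e_def[abs_def]\<close>)
  then show ?thesis unfolding eq by (simp only: sum_distrib_left)
qed

lemma Bq1_norm_le_suminf:
  fixes g :: "real^'d \<Rightarrow> complex"
  assumes g: "Lp_le q g a" and per: "periodic_fun g" and q: "1 \<le> q"
    and blk: "\<And>u. Lp_le q (sigma_block u g) (K * (\<Sum>s\<in>{u-1..u+1}. \<delta> s))"
    and \<delta>: "\<And>s. 0 \<le> \<delta> s" "summable \<delta>" and K: "0 \<le> K"
  shows "Bq1_norm q g \<le> ennreal (4 * K * (\<Sum>s. \<delta> s))"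
proof -
  have gm: "g \<in> borel_measurable borel" using g by (simp add: Lp_le_def)
  have inLp: "in_Lp q g" using in_Lp_borel_iff[OF gm per] Lp_le_integrable[OF g] by blast
  define \<eta> where "\<eta> u = \<delta> (u - 1) + \<delta> u + \<delta> (u + 1)" for u
  have sum1: "summable (\<lambda>u. \<delta> (u - 1))"
    by (rule iffD1[OF summable_Suc_iff]) (use \<delta> in simp)
  have sum2: "summable (\<lambda>u. \<delta> (u + 1))" using \<delta> by (simp add: summable_Suc_iff)
  have sum: "summable \<eta>" unfolding \<eta>_def by (intro summable_add sum1 sum2 \<delta>)
  have \<eta>0: "0 \<le> \<eta> u" for u using \<delta> by (simp add: \<eta>_def)
  have "(\<Sum>u. \<eta> u) = (\<Sum>u. \<delta> (u - 1)) + (\<Sum>u. \<delta> u) + (\<Sum>u. \<delta> (u + 1))"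
    unfolding \<eta>_def by (simp only: suminf_add[symmetric] summable_add sum1 sum2 \<delta>)
  \<comment> \<open>Truncated subtraction counts \<open>\<delta> 0\<close> twice in this shifted
    sum; the other shifted sum omits it, and the two effects cancel.\<close>
  also have "(\<Sum>u. \<delta> (u - 1)) = (\<Sum>u. \<delta> u) + \<delta> 0"
    using suminf_split_head[OF sum1] by simp
  also have "(\<Sum>u. \<delta> (u + 1)) = (\<Sum>u. \<delta> u) - \<delta> 0"
    using suminf_split_head[OF \<delta>(2)] by simp
  finally have tot: "(\<Sum>u. \<eta> u) \<le> 4 * (\<Sum>s. \<delta> s)"
    using suminf_nonneg[OF \<delta>(2)] \<delta>(1) by simp
  have le: "(\<Sum>s\<in>{u-1..u+1}. \<delta> s) \<le> \<eta> u" for u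
  proof (cases u)
    case 0
    then show ?thesis using \<delta>(1) by (simp add: \<eta>_def atLeast0_atMost_Suc numeral_eq_Suc)
  next
    case (Suc v)
    have "{v..v + 2} = {v, v + 1, v + 2}" by auto
    then show ?thesis unfolding Suc \<eta>_def by (simp add: add.commute)
  qed
  have "(\<Sum>u. ennreal (Lp_norm q (sigma_block u g))) \<le> (\<Sum>u. ennreal (K * \<eta> u))"
  proof (rule suminf_le)
    fix u
    have "Lp_norm q (sigma_block u g) \<le> K * (\<Sum>s\<in>{u-1..u+1}. \<delta> s)"
      by (rule Lp_norm_le[OF blk]) (use q in simp)
    also have "\<dots> \<le> K * \<eta> u" by (rule mult_left_mono[OF le K])
    finally show "ennreal (Lp_norm q (sigma_block u g)) \<le> ennreal (K * \<eta> u)" by (rule ennreal_leI)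
  qed auto
  also have "\<dots> = ennreal (\<Sum>u. K * \<eta> u)"
    by (rule suminf_ennreal_eq) (use K \<eta>0 sum in \<open>auto intro!: summable_sums summable_mult\<close>)
  also have "(\<Sum>u. K * \<eta> u) = K * (\<Sum>u. \<eta> u)" by (rule suminf_mult[OF sum])
  also have "ennreal (K * (\<Sum>u. \<eta> u)) \<le> ennreal (4 * K * (\<Sum>s. \<delta> s))"
    using mult_left_mono[OF tot K] by (intro ennreal_leI) (simp add: mult_ac)
  finally show ?thesis using inLp by (simp add: Bq1_norm_def)
qed

lemma Bq1_norm_difference_le:
  fixes f :: "real^'d \<Rightarrow> complex" and c :: "nat \<Rightarrow> int^'d \<Rightarrow> complex"
  assumes f: "Lp_le q f a" and per: "periodic_fun f" and q: "1 \<le> q"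
    and supp: "\<And>s k. c s k \<noteq> 0 \<Longrightarrow> scoef s k \<noteq> 0" and zero: "\<And>s k. S < s \<Longrightarrow> c s k = 0"
    and err: "\<And>s. Lp_le q (trig_poly (Box (2^(s+1))) (\<lambda>k. of_real (scoef s k) * fhat f k - c s k)) (\<delta> s)"
    and \<delta>: "summable \<delta>"
  shows "Bq1_norm q (\<lambda>x. f x - trig_poly (Box (2^(S+1))) (\<lambda>k. \<Sum>s\<le>S. c s k) x)
     \<le> ennreal (8 * 3 ^ CARD('d) * (\<Sum>s. \<delta> s))"
proof -
  let ?T = "trig_poly (Box (2^(S+1))) (\<lambda>k. \<Sum>s\<le>S. c s k)"
  have T: "Lp_le q ?T (\<Sum>k\<in>Box (2^(S+1)). norm (\<Sum>s\<le>S. c s k))"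
    by (rule Lp_le_trig_poly_trivial) (use q in simp)
  have "Bq1_norm q (\<lambda>x. f x - ?T x) \<le> ennreal (4 * (2 * 3 ^ CARD('d)) * (\<Sum>s. \<delta> s))"
    by (rule Bq1_norm_le_suminf[OF Lp_le_diff[OF f T q] periodic_diff[OF per periodic_trig_poly] q
          Lp_le_blocks_of_difference[OF f per q supp zero err] _ \<delta>])
      (use err in \<open>auto simp: Lp_le_def\<close>)
  then show ?thesis by simp
qed

section \<open>Besov classes\<close>

lemma lebesgue_affine_map_measurable:
  fixes t :: "'a::euclidean_space"
  assumes "c \<noteq> 0"
  shows "(\<lambda>x. t + c *\<^sub>R x) \<in> lebesgue \<rightarrow>\<^sub>M lebesgue"
proof -
  have "(\<lambda>x. t + (\<Sum>j\<in>Basis. (c * (x \<bullet> j)) *\<^sub>R j)) = (\<lambda>x. t + c *\<^sub>R x)"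
    unfolding scaleR_scaleR[symmetric] scaleR_sum_right[symmetric] euclidean_representation ..
  then show ?thesis using lebesgue_affine_measurable[of "\<lambda>_. c" t] assms by simp
qed

lemma AE_lebesgue_affine:
  fixes t :: "'a::euclidean_space"
  assumes "AE x in lebesgue. P x" "c \<noteq> 0"
  shows "AE x in lebesgue. P (t + c *\<^sub>R x)"
proof -
  have "AE x in lborel. P x" using assms by (simp add: AE_completion_iff)
  then have "AE x in density (distr lborel borel (\<lambda>x. t + c *\<^sub>R x)) (\<lambda>_. \<bar>c\<bar>^DIM('a)). P x"
    by (subst lborel_affine[OF assms(2), of t, symmetric])
  then have "AE x in distr lborel borel (\<lambda>x. t + c *\<^sub>R x). P x"
    using assms(2) by (subst (asm) AE_density) auto
  then have "AE x in lborel. P (t + c *\<^sub>R x)"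
    by (rule AE_distrD[rotated]) measurable
  then show ?thesis by (simp add: AE_completion_iff)
qed

text \<open>An arbitrary Borel version need not be periodic, so it is composed with
  \<open>wrap\<close>. Agreement almost everywhere survives because the countably many lattice
  translates of a null set form a null set.\<close>

lemma borel_version:
  fixes f :: "real^'d \<Rightarrow> complex"
  assumes f: "f \<in> borel_measurable lebesgue" and per: "periodic_fun f"
  obtains g where "g \<in> borel_measurable borel" "periodic_fun g" "AE x in lebesgue. f x = g x"
proof -
  have "(\<lambda>x. Re (f x)) \<in> borel_measurable lebesgue" using f by measurable
  from completion_ex_borel_measurable_real[OF this] obtain u
    where u: "u \<in> borel_measurable lborel" "AE x in lborel. Re (f x) = u x" by blast
  have "(\<lambda>x. Im (f x)) \<in> borel_measurable lebesgue" using f by measurable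
  from completion_ex_borel_measurable_real[OF this] obtain v
    where v: "v \<in> borel_measurable lborel" "AE x in lborel. Im (f x) = v x" by blast
  define g where "g x = Complex (u (wrap x)) (v (wrap x))" for x
  have [measurable]: "u \<in> borel_measurable borel" "v \<in> borel_measurable borel" using u v by auto
  have "g \<in> borel_measurable borel"
    unfolding g_def Complex_eq by measurable
  moreover have "periodic_fun g"
  proof -
    have "wrap (x + (2*pi) *\<^sub>R axis i 1) = wrap x" for x :: "real^'d" and i
    proof -
      have "\<lfloor>(x + (2*pi) *\<^sub>R axis i 1 :: real^'d) $ j / (2*pi)\<rfloor> = \<lfloor>x $ j / (2*pi)\<rfloor> + (if j = i then 1 else 0)" for j
        by (auto simp: axis_def add_divide_distrib)
      then show ?thesis by (auto simp: wrap_def lat_def vec_eq_iff axis_def algebra_simps)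
    qed
    then show ?thesis by (simp add: periodic_fun_def g_def)
  qed
  moreover have "AE x in lebesgue. f x = g x"
  proof -
    have "AE x in lborel. f x = Complex (u x) (v x)"
      using u(2) v(2) by eventually_elim (simp add: complex_eq_iff)
    then have ae: "AE x in lebesgue. f x = Complex (u x) (v x)" by (rule AE_completion)
    have "AE x in lebesgue. f (lat k + 1 *\<^sub>R x) = Complex (u (lat k + 1 *\<^sub>R x)) (v (lat k + 1 *\<^sub>R x))" for k :: "int^'d"
      by (rule AE_lebesgue_affine[OF ae]) simp
    then have "AE x in lebesgue. \<forall>k. f (lat k + 1 *\<^sub>R x) = Complex (u (lat k + 1 *\<^sub>R x)) (v (lat k + 1 *\<^sub>R x))"
      by (subst AE_all_countable) simp
    then show ?thesis
    proof eventually_elim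
      case (elim x)
      let ?k = "- (\<chi> i. \<lfloor>x$i / (2*pi)\<rfloor>)"
      have "lat ?k + 1 *\<^sub>R x = wrap x" by (simp add: wrap_def lat_def vec_eq_iff)
      then have "f (wrap x) = g x" using elim[rule_format, of ?k] by (simp add: g_def)
      then show ?case by (simp add: periodic_fun_wrap[OF per])
    qed
  qed
  ultimately show ?thesis by (rule that)
qed

lemma in_Lp_cong_AE:
  assumes "f \<in> borel_measurable lebesgue" "periodic_fun f" "AE x in lebesgue. f x = g x" "in_Lp p g"
  shows "in_Lp p f"
proof -
  have g: "g \<in> borel_measurable lebesgue" "set_integrable lebesgue torus (\<lambda>x. norm (g x) powr p)"
    using assms by (auto simp: in_Lp_def)
  have [measurable]: "torus \<in> sets lebesgue" using torus_borel by auto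
  have "set_integrable lebesgue torus (\<lambda>x. norm (f x) powr p)"
    unfolding set_integrable_def
  proof (rule integrable_cong_AE_imp[OF g(2)[unfolded set_integrable_def]])
    show "(\<lambda>x. indicator torus x *\<^sub>R norm (f x) powr p) \<in> borel_measurable lebesgue"
      using assms(1) by measurable
    show "AE x in lebesgue. indicator torus x *\<^sub>R norm (g x) powr p = indicator torus x *\<^sub>R norm (f x) powr p"
      using assms(3) by eventually_elim simp
  qed
  then show ?thesis using assms by (simp add: in_Lp_def)
qed

lemma Lp_norm_cong_AE:
  assumes "f \<in> borel_measurable lebesgue" "g \<in> borel_measurable lebesgue" "AE x in lebesgue. f x = g x"
  shows "Lp_norm p f = Lp_norm p g"
proof -
  have [measurable]: "torus \<in> sets lebesgue" using torus_borel by auto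
  have "(LINT x:torus|lebesgue. norm (f x) powr p) = (LINT x:torus|lebesgue. norm (g x) powr p)"
    unfolding set_lebesgue_integral_def
  proof (rule integral_cong_AE)
    show "AE x in lebesgue. indicator torus x *\<^sub>R norm (f x) powr p = indicator torus x *\<^sub>R norm (g x) powr p"
      using assms(3) by eventually_elim simp
  qed (use assms(1,2) in measurable)
  then show ?thesis by (simp add: Lp_norm_def)
qed

lemma fdiff_lebesgue_measurable:
  assumes "f \<in> borel_measurable lebesgue"
  shows "fdiff h k f \<in> borel_measurable lebesgue"
proof (induction k)
  case (Suc k)
  have "(\<lambda>x. fdiff h k f (h + 1 *\<^sub>R x)) \<in> borel_measurable lebesgue"
    by (rule measurable_compose[OF lebesgue_affine_map_measurable Suc.IH]) simp
  then have "(\<lambda>x. fdiff h k f (x + h)) \<in> borel_measurable lebesgue" by (simp add: add.commute)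
  then show ?case using Suc.IH by (simp add: fdiff1_def)
qed (use assms in simp)

lemma fdiff_cong_AE:
  assumes "AE x in lebesgue. f x = g x"
  shows "AE x in lebesgue. fdiff h k f x = fdiff h k g x"
proof (induction k)
  case (Suc k)
  have "AE x in lebesgue. fdiff h k f (h + 1 *\<^sub>R x) = fdiff h k g (h + 1 *\<^sub>R x)"
    by (rule AE_lebesgue_affine[OF Suc.IH]) simp
  then show ?case using Suc.IH by eventually_elim (simp add: fdiff1_def add.commute)
qed (use assms in simp)

lemma besov_ball_cong_AE:
  assumes f: "f \<in> besov_ball k r p \<theta>" and g: "g \<in> borel_measurable borel" "periodic_fun g"
    and ae: "AE x in lebesgue. f x = g x"
  shows "g \<in> besov_ball k r p \<theta>"
proof -
  have fm: "f \<in> borel_measurable lebesgue" and fLp: "in_Lp p f"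
    using f by (auto simp: besov_ball_def in_Lp_def)
  have gm: "g \<in> borel_measurable lebesgue" using g(1) by (simp add: measurable_completion)
  have "AE x in lebesgue. g x = f x" using ae by eventually_elim simp
  then have inLp: "in_Lp p g" by (rule in_Lp_cong_AE[OF gm g(2) _ fLp])
  have "Lp_norm p (fdiff h k g) = Lp_norm p (fdiff h k f)" for h
    using Lp_norm_cong_AE[OF fdiff_lebesgue_measurable[OF fm] fdiff_lebesgue_measurable[OF gm] fdiff_cong_AE[OF ae]] by simp
  then have m: "modulus k p g = modulus k p f" by (simp add: modulus_def fun_eq_iff)
  have n: "Lp_norm p g = Lp_norm p f" using Lp_norm_cong_AE[OF fm gm ae] by simp
  have "besov_norm k r p \<theta> g = besov_norm k r p \<theta> f"
    unfolding besov_norm_def besov_semi_def m n ..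
  then show ?thesis using f inLp by (simp add: besov_ball_def)
qed

lemma tconv_cong_AE:
  fixes f g K :: "real^'d \<Rightarrow> complex"
  assumes f: "f \<in> borel_measurable lebesgue" and g: "g \<in> borel_measurable lebesgue"
    and K: "K \<in> borel_measurable borel" and ae: "AE x in lebesgue. f x = g x"
  shows "tconv f K = tconv g K"
proof
  fix x
  have tor[measurable]: "torus \<in> sets lebesgue" using torus_borel by auto
  have K': "K \<in> borel_measurable lebesgue" using K by (simp add: measurable_completion)
  have m: "(\<lambda>y. u (x - y)) \<in> borel_measurable lebesgue" if "u \<in> borel_measurable lebesgue" for u :: "real^'d \<Rightarrow> complex"
    using measurable_compose[OF lebesgue_affine_map_measurable[of "-1" x] that] by simp
  have ae': "AE y in lebesgue. f (x - y) = g (x - y)"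
    using AE_lebesgue_affine[OF ae, of "-1" x] by simp
  have "(CLINT y:torus|lebesgue. f (x - y) * K y) = (CLINT y:torus|lebesgue. g (x - y) * K y)"
    unfolding set_lebesgue_integral_def
  proof (rule integral_cong_AE)
    show "AE y in lebesgue. indicator torus y *\<^sub>R (f (x - y) * K y) = indicator torus y *\<^sub>R (g (x - y) * K y)"
      using ae' by eventually_elim simp
  qed (use m[OF f] m[OF g] K' in measurable)
  then show "tconv f K x = tconv g K x" by (simp add: tconv_def)
qed

lemma Bq1_norm_cong_AE:
  fixes f g :: "real^'d \<Rightarrow> complex"
  assumes "f \<in> borel_measurable lebesgue" "periodic_fun f" "g \<in> borel_measurable lebesgue"
    and ae: "AE x in lebesgue. f x = g x"
  shows "Bq1_norm q f \<le> Bq1_norm q g"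
proof (cases "in_Lp q g")
  case True
  have "in_Lp q f" by (rule in_Lp_cong_AE[OF assms(1,2) ae True])
  moreover have "sigma_block s f = sigma_block s g" for s
    unfolding sigma_block_def vp_op_def
    by (simp add: tconv_cong_AE[OF assms(1,3) vp_measurable ae])
  ultimately show ?thesis using True by (simp add: Bq1_norm_def)
qed (simp add: Bq1_norm_def)

section \<open>The modulus of smoothness on a Besov ball\<close>

lemma periodic_translate: "periodic_fun f \<Longrightarrow> periodic_fun (\<lambda>x. f (x + h))"
  unfolding periodic_fun_def by (metis add.assoc add.commute)

lemma periodic_fdiff:
  assumes "periodic_fun f"
  shows "periodic_fun (fdiff h k f)"
proof (induction k)
  case (Suc k)
  then show ?case
    using periodic_diff[OF periodic_translate[OF Suc.IH, of h] Suc.IH] by (simp add: fdiff1_def[abs_def])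
qed (use assms in simp)

lemma Lp_le_fdiff:
  assumes "Lp_le p f a" "periodic_fun f" "1 \<le> p"
  shows "Lp_le p (fdiff h k f) (2 ^ k * a)"
proof (induction k)
  case (Suc k)
  have "Lp_le p (\<lambda>x. fdiff h k f (x + h) - fdiff h k f x) (2 ^ k * a + 2 ^ k * a)"
    by (intro Lp_le_diff Lp_le_translate Suc.IH periodic_fdiff assms)
  then show ?case by (simp add: fdiff1_def[abs_def] mult_ac)
qed (use assms in simp)

lemma bdd_above_modulus:
  assumes "Lp_le p f a" "periodic_fun f" "1 \<le> p"
  shows "bdd_above ((\<lambda>h. Lp_norm p (fdiff h k f)) ` H)"
  using Lp_norm_le[OF Lp_le_fdiff[OF assms]] assms(3) by (intro bdd_aboveI2[where M="2 ^ k * a"]) auto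

lemma modulus_mono:
  assumes "Lp_le p f a" "periodic_fun f" "1 \<le> p" "0 \<le> s" "s \<le> t"
  shows "modulus k p f s \<le> modulus k p f t"
  unfolding modulus_def
proof (rule cSUP_subset_mono)
  show "{h. norm h \<le> s} \<noteq> ({} :: (real^'a) set)" using assms(4) by (auto intro!: exI[of _ 0])
qed (use bdd_above_modulus[OF assms(1-3)] assms in auto)

lemma modulus_nonneg:
  assumes "Lp_le p f a" "periodic_fun f" "1 \<le> p" "0 \<le> t"
  shows "0 \<le> modulus k p f t"
  unfolding modulus_def
  by (rule cSUP_upper2[where x=0]) (use bdd_above_modulus[OF assms(1-3)] assms Lp_norm_nonneg in auto)

text \<open>Each ball embeds into the one for \<theta> = \<infinity>. For finite \<theta>,
  monotonicity of the modulus bounds the integrand on [t, 2t] from below by its data at t; the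
  factor \<open>2 powr r\<close> comes from replacing t by 2t, and the 2 from 2^(1/\<theta>) \<le>
  2.\<close>

lemma modulus_le_of_besov_semi:
  assumes f: "Lp_le p f a" and per: "periodic_fun f" and p: "1 \<le> p" and r: "0 < r" and \<theta>: "1 \<le> \<theta>"
    and semi: "besov_semi k r p \<theta> f \<le> 1" and t: "0 < t"
  shows "modulus k p f t \<le> 2 * 2 powr r * t powr r"
proof (cases "\<theta> = \<infinity>")
  case True
  have "ennreal (t powr (-r) * modulus k p f t) \<le> (SUP t\<in>{0<..}. ennreal (t powr (-r) * modulus k p f t))"
    using t by (intro SUP_upper) auto
  also have "\<dots> \<le> 1" using semi True by (simp add: besov_semi_def)
  finally have "t powr (-r) * modulus k p f t \<le> 1" by simp
  then have "t powr r * (t powr (-r) * modulus k p f t) \<le> t powr r * 1" by (rule mult_left_mono) simp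
  then have "modulus k p f t \<le> t powr r" using t by (simp flip: powr_add mult.assoc)
  also have "\<dots> \<le> 2 * 2 powr r * t powr r"
    using powr_mono[of 0 r 2] r by (simp add: mult_le_cancel_right1)
  finally show ?thesis .
next
  case False
  define \<tau> where "\<tau> = real_of_ereal \<theta>"
  have \<tau>: "1 \<le> \<tau>" using \<theta> False unfolding \<tau>_def by (cases \<theta>) auto
  let ?m = "modulus k p f"
  let ?F = "\<lambda>u. ennreal ((u powr (-r) * ?m u) powr \<tau> / u)"
  define X where "X = set_nn_integral lborel {0<..} ?F"
  have eX: "enn_powr X (1/\<tau>) \<le> 1" using semi False by (simp add: besov_semi_def X_def \<tau>_def)
  then have Xfin: "X \<noteq> \<infinity>" by (auto simp: enn_powr_def top_unique)
  then have "enn2real X powr (1/\<tau>) \<le> 1" using eX by (simp add: enn_powr_def)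
  then have "(enn2real X powr (1/\<tau>)) powr \<tau> \<le> 1 powr \<tau>" using \<tau> by (intro powr_mono2) auto
  then have "enn2real X \<le> 1" using \<tau> by (simp add: powr_powr)
  then have X1: "X \<le> 1" using Xfin by (metis enn2real_nonneg ennreal_enn2real ennreal_le_1 infinity_ennreal_def top.not_eq_extremum)
  define y where "y = (2 * t) powr (-r) * ?m t"
  have y0: "0 \<le> y" using modulus_nonneg[OF f per p, of t] t by (simp add: y_def)
  have "ennreal (y powr \<tau> / 2) = (\<integral>\<^sup>+u. ennreal (y powr \<tau> / (2 * t)) * indicator {t..2*t} u \<partial>lborel)"
    using t by (subst nn_integral_cmult_indicator) (auto simp flip: ennreal_mult)
  also have "\<dots> \<le> X" unfolding X_def
  proof (rule nn_integral_mono)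
    fix u :: real
    show "ennreal (y powr \<tau> / (2 * t)) * indicator {t..2*t} u \<le> ?F u * indicator {0<..} u"
    proof (cases "u \<in> {t..2*t}")
      case True
      then have u: "t \<le> u" "u \<le> 2 * t" "0 < u" using t by auto
      have "y \<le> u powr (-r) * ?m u" unfolding y_def
        using u t r modulus_mono[OF f per p, of t u] modulus_nonneg[OF f per p, of t]
        by (intro mult_mono powr_mono2') auto
      then have "y powr \<tau> / (2 * t) \<le> (u powr (-r) * ?m u) powr \<tau> / u"
        using y0 \<tau> u by (intro frac_le powr_mono2) auto
      then show ?thesis using True u by (simp add: ennreal_leI)
    qed simp
  qed
  finally have "ennreal (y powr \<tau> / 2) \<le> 1" using X1 by (rule order_trans)
  then have "y powr \<tau> \<le> 2" by simp
  then have "(y powr \<tau>) powr (1/\<tau>) \<le> 2 powr (1/\<tau>)" using \<tau> by (intro powr_mono2) auto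
  also have "\<dots> \<le> 2 powr 1" using \<tau> by (intro powr_mono) auto
  finally have "y \<le> 2" using \<tau> y0 by (simp add: powr_powr)
  then have "(2 * t) powr r * y \<le> (2 * t) powr r * 2" by (rule mult_left_mono) simp
  moreover have "(2 * t) powr r * y = ?m t" using t by (simp add: y_def flip: powr_add mult.assoc)
  ultimately have "?m t \<le> (2 * t) powr r * 2" by simp
  also have "\<dots> = 2 * 2 powr r * t powr r" using t by (simp add: powr_mult)
  finally show ?thesis .
qed

lemma fdiff_zero: "0 < k \<Longrightarrow> fdiff 0 k f = (\<lambda>_. 0)"
  by (cases k) (auto simp: fdiff1_def)

lemma besov_ball_imp:
  assumes g: "g \<in> besov_ball k r p \<theta>" "g \<in> borel_measurable borel"
    and p: "1 \<le> p" and r: "0 < r" and \<theta>: "1 \<le> \<theta>" and k: "0 < k"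
  shows "periodic_fun g" "Lp_le p g 1" "Lp_le p (fdiff h k g) (2 * 2 powr r * norm h powr r)"
proof -
  have gLp: "in_Lp p g" and norm1: "ennreal (Lp_norm p g) + besov_semi k r p \<theta> g \<le> 1"
    using g by (auto simp: besov_ball_def besov_norm_def)
  show per: "periodic_fun g" using gLp by (simp add: in_Lp_def)
  have "integrable tm (\<lambda>x. norm (g x) powr p)" using in_Lp_borel_iff[OF g(2) per] gLp by blast
  then have "Lp_le p g (Lp_norm p g)" using Lp_le_Lp_norm[OF g(2)] p by auto
  moreover have "ennreal (Lp_norm p g) \<le> 1" using norm1 by (meson le_iff_add order_trans)
  then have "Lp_norm p g \<le> 1" by simp
  ultimately show g1: "Lp_le p g 1" using Lp_le_mono p by fastforce
  have semi: "besov_semi k r p \<theta> g \<le> 1" using norm1 by (metis add.commute le_iff_add order_trans)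
  show "Lp_le p (fdiff h k g) (2 * 2 powr r * norm h powr r)"
  proof (cases "h = 0")
    case True
    then show ?thesis using Lp_le_zero[of p] p r by (simp add: fdiff_zero[OF k])
  next
    case False
    have L: "Lp_le p (fdiff h k g) (2 ^ k * 1)" by (rule Lp_le_fdiff[OF g1 per p])
    have "Lp_le p (fdiff h k g) (Lp_norm p (fdiff h k g))"
      by (rule Lp_le_Lp_norm[OF Lp_le_measurable[OF L] Lp_le_integrable[OF L]]) (use p in simp)
    moreover have "Lp_norm p (fdiff h k g) \<le> modulus k p g (norm h)"
      unfolding modulus_def by (rule cSUP_upper) (use bdd_above_modulus[OF g1 per p] in auto)
    moreover have "modulus k p g (norm h) \<le> 2 * 2 powr r * norm h powr r"
      by (rule modulus_le_of_besov_semi[OF g1 per p r \<theta> semi]) (use False in simp)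
    ultimately show ?thesis using Lp_le_mono[of p "fdiff h k g"] p by fastforce
  qed
qed

section \<open>The upper bound\<close>

text \<open>The point is that Z does not depend on the centre t, since the scale that dominates the
  error moves with m.\<close>

lemma two_sided_geometric:
  fixes \<kappa> :: real
  assumes "0 < \<kappa>"
  obtains Z where "0 < Z" "\<And>t::nat. summable (\<lambda>s. 2 powr (- (\<kappa> * \<bar>real s - real t\<bar>)))"
    "\<And>t::nat. (\<Sum>s. 2 powr (- (\<kappa> * \<bar>real s - real t\<bar>))) \<le> Z"
proof -
  define g :: "nat \<Rightarrow> real" where "g i = 2 powr (- (\<kappa> * real i))" for i
  have sg: "summable g" unfolding g_def by (rule summable_two_powr[OF assms])
  have g0: "0 < g i" for i by (simp add: g_def)
  have gpos: "0 < suminf g" by (rule suminf_pos[OF sg g0])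
  have F: "summable (\<lambda>s. 2 powr (- (\<kappa> * \<bar>real s - real t\<bar>))) \<and> (\<Sum>s. 2 powr (- (\<kappa> * \<bar>real s - real t\<bar>))) \<le> 2 * suminf g" for t :: nat
  proof -
    let ?F = "\<lambda>s. 2 powr (- (\<kappa> * \<bar>real s - real t\<bar>)) :: real"
    have sh: "(\<lambda>s. ?F (s + t)) = g" by (simp add: fun_eq_iff g_def)
    have sF: "summable ?F" using summable_iff_shift[of ?F t] sg unfolding sh by blast
    have "(\<Sum>s. ?F s) = (\<Sum>s. ?F (s + t)) + (\<Sum>s<t. ?F s)" by (rule suminf_split_initial_segment[OF sF])
    also have "(\<Sum>s. ?F (s + t)) = suminf g" by (simp only: sh)
    also have "(\<Sum>s<t. ?F s) = (\<Sum>s<t. g (Suc (t - Suc s)))"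
    proof (rule sum.cong[OF refl])
      fix s assume "s \<in> {..<t}"
      then have "\<bar>real s - real t\<bar> = real (Suc (t - Suc s))" by (simp add: of_nat_diff Suc_diff_Suc)
      then show "?F s = g (Suc (t - Suc s))" unfolding g_def by (simp only:)
    qed
    also have "\<dots> = (\<Sum>s<t. g (Suc s))" by (rule sum.nat_diff_reindex)
    also have "\<dots> \<le> (\<Sum>s<Suc t. g s)" using g0[of 0] by (simp add: sum.lessThan_Suc_shift del: sum.lessThan_Suc)
    also have "\<dots> \<le> suminf g" by (rule sum_le_suminf[OF sg]) (auto intro: less_imp_le g0)
    finally show ?thesis using sF by simp
  qed
  have "0 < 2 * suminf g" using gpos by simp
  then show ?thesis using F by (intro that[of "2 * suminf g"]) auto
qed

lemma two_power_Suc_powr: "real (2^(s+1)) powr y = 2 powr ((real s + 1) * y)"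
proof -
  have "real (2^(s+1)) = 2 powr (real s + 1)"
    using powr_realpow[of 2 "s+1"] by (simp add: add.commute)
  then show ?thesis by (simp only: powr_powr)
qed

text \<open>Nikol'skii from L_p to L_2, then Cauchy-Schwarz over about 2^(sd) frequencies: the
  exponents d(1/p - 1/2) and d/2 add up to d/p. In 12 = 3 * 4 the 3 is Nikol'skii's constant, and
  the 4 absorbs the size of the boxes.\<close>

lemma block_coeff_sum:
  fixes f :: "real^'d \<Rightarrow> complex"
  assumes f1: "Lp_le 1 f a" and per: "periodic_fun f" and p: "1 < p" "p \<le> 2"
    and blk: "Lp_le p (sigma_block s f) (C * 2 powr (- (r * real s)))"
  shows "(\<Sum>k\<in>Box (2^(s+1)). norm (of_real (scoef s k) * fhat f k)) \<le> 12 ^ CARD('d) * C * 2 powr (- ((r - CARD('d) / p) * real s))"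
proof -
  let ?d = "CARD('d)"
  have C0: "0 \<le> C * 2 powr (- (r * real s))" using blk by (simp add: Lp_le_def)
  then have C: "0 \<le> C" by (simp add: zero_le_mult_iff)
  let ?a = "3 ^ ?d * real (2^(s+1)) powr (?d * (1/p - 1/2)) * (C * 2 powr (- (r * real s)))"
  have "Lp_le 2 (trig_poly (Box (2^(s+1))) (\<lambda>k. of_real (scoef s k) * fhat f k)) ?a"
    by (rule Nikolskii[OF order_refl _ _ p]) (use blk in \<open>simp_all only: sigma_block_trig_poly[OF f1 per]\<close>, simp)
  then have "(\<Sum>k\<in>Box (2^(s+1)). norm (of_real (scoef s k) * fhat f k)) \<le> sqrt (card (Box (2^(s+1)) :: (int^'d) set)) * ?a"
    by (intro Lp_le_2_trig_poly_coeff) auto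
  also have "\<dots> \<le> 2 powr ((real s + 3) * ?d / 2) * ?a"
  proof (rule mult_right_mono)
    have "card {- int a..int a} = 2 * a + 1" for a by simp
    then have "card {- int (2^(s+1))..int (2^(s+1))} = 2 * 2^(s+1) + 1" .
    also have "\<dots> \<le> 2 ^ (s+3)" by (simp add: power_add)
    finally have "card (Box (2^(s+1)) :: (int^'d) set) \<le> (2 ^ (s+3)) ^ ?d"
      by (simp only: card_cube finite_atLeastAtMost_int) (rule power_mono, simp_all)
    then have "real (card (Box (2^(s+1)) :: (int^'d) set)) \<le> real ((2 ^ (s+3)) ^ ?d)" by (simp only: of_nat_le_iff)
    also have "\<dots> = 2 powr ((real s + 3) * ?d)"
      by (simp add: powr_realpow[symmetric] powr_powr)
    finally have "sqrt (card (Box (2^(s+1)) :: (int^'d) set)) \<le> sqrt (2 powr ((real s + 3) * ?d))" by (rule real_sqrt_le_mono)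
    also have "\<dots> = 2 powr ((real s + 3) * ?d / 2)"
      by (simp add: powr_half_sqrt[symmetric] powr_powr)
    finally show "sqrt (card (Box (2^(s+1)) :: (int^'d) set)) \<le> 2 powr ((real s + 3) * ?d / 2)" .
    show "0 \<le> ?a" using C0 by simp
  qed
  also have "\<dots> = 3 ^ ?d * C * 2 powr (((real s + 3) * ?d / 2) + (real s + 1) * (?d * (1/p - 1/2)) + (- (r * real s)))"
    by (simp only: powr_add two_power_Suc_powr) (simp only: mult_ac)
  also have "\<dots> \<le> 3 ^ ?d * C * 2 powr (real ?d * 2 + - ((r - ?d / p) * real s))"
  proof (intro mult_left_mono powr_mono)
    have "((real s + 3) * ?d / 2) + (real s + 1) * (?d * (1/p - 1/2)) + (- (r * real s))
       = real ?d * (1 + 1/p) + - ((r - ?d / p) * real s)" by (simp add: algebra_simps add_divide_distrib)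
    also have "\<dots> \<le> real ?d * 2 + - ((r - ?d / p) * real s)"
    proof (intro add_right_mono mult_left_mono)
      show "1 + 1/p \<le> 2" using p by simp
    qed simp
    finally show "((real s + 3) * ?d / 2) + (real s + 1) * (?d * (1/p - 1/2)) + (- (r * real s)) \<le> real ?d * 2 + - ((r - ?d / p) * real s)" .
  qed (use C in auto)
  also have "\<dots> = 12 ^ ?d * C * 2 powr (- ((r - ?d / p) * real s))"
  proof -
    have "2 powr (real ?d * 2) = (4::real) ^ ?d" using powr_powr[of 2 2 "real ?d"] by (simp add: mult.commute powr_realpow)
    moreover have "(12::real) ^ ?d = 3 ^ ?d * 4 ^ ?d" by (simp flip: power_mult_distrib)
    ultimately show ?thesis by (simp only: powr_add) (simp only: mult_ac)
  qed
  finally show ?thesis .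
qed

text \<open>Nikol'skii's inequality; in 6 = 3 * 2 the 2 absorbs the degree \<open>2^(s+1)\<close> in
  place of 2^s.\<close>

lemma block_Lq:
  fixes f :: "real^'d \<Rightarrow> complex"
  assumes f1: "Lp_le 1 f a" and per: "periodic_fun f" and p: "1 < p" "p \<le> q"
    and blk: "Lp_le p (sigma_block s f) (C * 2 powr (- (r * real s)))"
  shows "Lp_le q (sigma_block s f) (6 ^ CARD('d) * C * 2 powr (- ((r - CARD('d) * (1/p - 1/q)) * real s)))"
proof -
  let ?d = "CARD('d)" and ?g = "1/p - 1/q"
  have C0: "0 \<le> C * 2 powr (- (r * real s))" using blk by (simp add: Lp_le_def)
  then have C: "0 \<le> C" by (simp add: zero_le_mult_iff)
  have "1/p \<le> 1" "0 \<le> 1/q" using p by auto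
  then have g: "?g \<le> 1" by linarith
  let ?a = "3 ^ ?d * real (2^(s+1)) powr (?d * ?g) * (C * 2 powr (- (r * real s)))"
  have "Lp_le q (trig_poly (Box (2^(s+1))) (\<lambda>k. of_real (scoef s k) * fhat f k)) ?a"
    by (rule Nikolskii[OF order_refl _ _ p]) (use blk in \<open>simp_all only: sigma_block_trig_poly[OF f1 per]\<close>, simp)
  then have "Lp_le q (sigma_block s f) ?a" by (simp only: sigma_block_trig_poly[OF f1 per])
  moreover have "?a \<le> 6 ^ ?d * C * 2 powr (- ((r - ?d * ?g) * real s))"
  proof -
    have "?a = 3 ^ ?d * C * 2 powr ((real s + 1) * (?d * ?g) + (- (r * real s)))"
      by (simp only: powr_add two_power_Suc_powr) (simp only: mult_ac)
    also have "(real s + 1) * (?d * ?g) + (- (r * real s)) = ?d * ?g + (- ((r - ?d * ?g) * real s))"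
      by (simp add: algebra_simps add_divide_distrib)
    also have "3 ^ ?d * C * 2 powr (?d * ?g + (- ((r - ?d * ?g) * real s))) \<le> 3 ^ ?d * C * 2 powr (?d * 1 + (- ((r - ?d * ?g) * real s)))"
    proof (rule mult_left_mono)
      have "real ?d * ?g \<le> real ?d * 1" by (rule mult_left_mono[OF g]) simp
      then show "2 powr (?d * ?g + (- ((r - ?d * ?g) * real s))) \<le> 2 powr (?d * 1 + (- ((r - ?d * ?g) * real s)))"
        by (intro powr_mono add_right_mono) simp_all
    qed (use C in simp)
    also have "\<dots> = 6 ^ ?d * C * 2 powr (- ((r - ?d * ?g) * real s))"
    proof -
      have "(6::real) ^ ?d = 3 ^ ?d * 2 ^ ?d" by (simp flip: power_mult_distrib)
      then show ?thesis by (simp only: powr_add) (simp add: powr_realpow mult_ac)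
    qed
    finally show ?thesis .
  qed
  ultimately show ?thesis by (rule Lp_le_mono) (use p in simp)
qed

lemma m_term_construction:
  fixes f :: "real^'d \<Rightarrow> complex" and N :: "nat \<Rightarrow> nat"
  assumes f: "Lp_le q f a" and per: "periodic_fun f" and q: "1 \<le> q"
    and G: "\<And>\<Lambda> (c :: int^'d \<Rightarrow> complex) M. finite \<Lambda> \<Longrightarrow> 0 < M \<Longrightarrow>
      \<exists>\<Theta> b. \<Theta> \<subseteq> \<Lambda> \<and> card \<Theta> \<le> M \<and>
        Lp_le q (\<lambda>x. trig_poly \<Lambda> c x - trig_poly \<Theta> b x) (G * real M powr (-1/2) * (\<Sum>k\<in>\<Lambda>. norm (c k)))"
    and N: "\<And>s. 0 < N s"
    and mid: "\<And>s. s0 < s \<Longrightarrow> s \<le> s1 \<Longrightarrow>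
       G * real (N s) powr (-1/2) * (\<Sum>k\<in>Box (2^(s+1)). norm (of_real (scoef s k) * fhat f k)) \<le> \<delta> s"
    and tail: "\<And>s. s1 < s \<Longrightarrow> Lp_le q (sigma_block s f) (\<delta> s)"
    and \<delta>: "\<And>s. 0 \<le> \<delta> s" "summable \<delta>" and s01: "s0 \<le> s1"
  shows "\<exists>\<Theta> c. finite \<Theta> \<and> card \<Theta> \<le> card (Box (2^(s0+1)) :: (int^'d) set) + (\<Sum>s\<in>{s0<..s1}. N s) \<and>
    Bq1_norm q (\<lambda>x. f x - trig_poly \<Theta> c x) \<le> ennreal (8 * 3 ^ CARD('d) * (\<Sum>s. \<delta> s))"
proof -
  have f1: "Lp_le 1 f a" by (rule Lp_le_exponent_mono[OF f]) (use q in auto)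
  let ?p = "\<lambda>s k. complex_of_real (scoef s k) * fhat f k"
  \<comment> \<open>The greedy approximants are confined to frequencies where the block multiplier
    is nonzero; this is the locality that \<open>Bq1_norm_difference_le\<close> asks for.\<close>
  let ?\<Lambda> = "\<lambda>s. {k \<in> Box (2^(s+1)) :: (int^'d) set. scoef s k \<noteq> 0}"
  define Pr where "Pr s \<Theta> b \<longleftrightarrow> \<Theta> \<subseteq> ?\<Lambda> s \<and> card \<Theta> \<le> N s \<and>
     Lp_le q (\<lambda>x. trig_poly (?\<Lambda> s) (?p s) x - trig_poly \<Theta> b x) (G * real (N s) powr (-1/2) * (\<Sum>k\<in>?\<Lambda> s. norm (?p s k)))" for s \<Theta> b
  have "\<forall>s. \<exists>\<Theta> b. Pr s \<Theta> b" unfolding Pr_def by (intro allI G[OF _ N]) simp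
  then obtain \<Theta> b where "\<And>s. Pr s (\<Theta> s) (b s)" by metis
  then have \<Theta>: "\<And>s. \<Theta> s \<subseteq> ?\<Lambda> s" "\<And>s. card (\<Theta> s) \<le> N s"
    and err: "\<And>s. Lp_le q (\<lambda>x. trig_poly (?\<Lambda> s) (?p s) x - trig_poly (\<Theta> s) (b s) x) (G * real (N s) powr (-1/2) * (\<Sum>k\<in>?\<Lambda> s. norm (?p s k)))"
    unfolding Pr_def by blast+
  define c where "c s k = (if s \<le> s0 then ?p s k else if s \<le> s1 \<and> k \<in> \<Theta> s then b s k else 0)" for s k
  let ?T = "trig_poly (Box (2^(s1+1))) (\<lambda>k. \<Sum>s\<le>s1. c s k)"
  have bound: "Bq1_norm q (\<lambda>x. f x - ?T x) \<le> ennreal (8 * 3 ^ CARD('d) * (\<Sum>s. \<delta> s))"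
  proof (rule Bq1_norm_difference_le[OF f per q _ _ _ \<delta>(2)])
    show "scoef s k \<noteq> 0" if "c s k \<noteq> 0" for s k
      using that \<Theta>(1)[of s] by (auto simp: c_def split: if_splits)
    show "c s k = 0" if "s1 < s" for s k using that s01 by (simp add: c_def)
    show "Lp_le q (trig_poly (Box (2^(s+1))) (\<lambda>k. ?p s k - c s k)) (\<delta> s)" for s
    proof -
      consider "s \<le> s0" | "s0 < s" "s \<le> s1" | "s1 < s" by linarith
      then show ?thesis
      proof cases
        case 1
        then have "trig_poly (Box (2^(s+1))) (\<lambda>k. ?p s k - c s k) = (\<lambda>_. 0)" by (simp add: c_def trig_poly_def fun_eq_iff)
        then show ?thesis using Lp_le_mono[OF Lp_le_zero[of q] \<delta>(1)[of s]] q by simp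
      next
        case 2
        have 1: "trig_poly (Box (2^(s+1))) (?p s) = trig_poly (?\<Lambda> s) (?p s)"
          by (rule trig_poly_mono_neutral[symmetric]) auto
        have 2: "trig_poly (Box (2^(s+1))) (c s) = trig_poly (\<Theta> s) (b s)"
        proof -
          have "trig_poly (\<Theta> s) (b s) = trig_poly (\<Theta> s) (c s)"
            by (rule trig_poly_cong) (use \<open>s0 < s\<close> \<open>s \<le> s1\<close> in \<open>simp add: c_def\<close>)
          also have "\<dots> = trig_poly (Box (2^(s+1))) (c s)"
            by (rule trig_poly_mono_neutral) (use \<Theta>(1)[of s] \<open>s0 < s\<close> in \<open>auto simp: c_def\<close>)
          finally show ?thesis by simp
        qed
        have le: "G * real (N s) powr (-1/2) * (\<Sum>k\<in>?\<Lambda> s. norm (?p s k)) \<le> \<delta> s"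
        proof -
          have "(\<Sum>k\<in>?\<Lambda> s. norm (?p s k)) = (\<Sum>k\<in>Box (2^(s+1)). norm (?p s k))"
            by (rule sum.mono_neutral_left) auto
          then show ?thesis using mid[OF \<open>s0 < s\<close> \<open>s \<le> s1\<close>] by simp
        qed
        have "trig_poly (Box (2^(s+1))) (\<lambda>k. ?p s k - c s k) = (\<lambda>x. trig_poly (?\<Lambda> s) (?p s) x - trig_poly (\<Theta> s) (b s) x)"
          unfolding 1[symmetric] 2[symmetric] by (simp only: fun_eq_iff trig_poly_diff) simp
        then show ?thesis using Lp_le_mono[OF err le] q by simp
      next
        case 3
        then have "trig_poly (Box (2^(s+1))) (\<lambda>k. ?p s k - c s k) = sigma_block s f"
          using s01 by (simp add: c_def sigma_block_trig_poly[OF f1 per])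
        then show ?thesis using tail[OF 3] by simp
      qed
    qed
  qed
  \<comment> \<open>The blocks kept in full share one box, so their frequencies are counted once;
    only the middle blocks contribute their budgets.\<close>
  define U where "U = Box (2^(s0+1)) \<union> (\<Union>s\<in>{s0<..s1}. \<Theta> s)"
  have finU: "finite U" unfolding U_def
    by (intro finite_UnI finite_UN_I) (auto intro: finite_subset[OF \<Theta>(1)])
  have TU: "?T = trig_poly U (\<lambda>k. \<Sum>s\<le>s1. c s k)"
  proof (rule trig_poly_mono_neutral[symmetric])
    show "U \<subseteq> Box (2^(s1+1))"
    proof -
      have "Box (2^(s+1)) \<subseteq> (Box (2^(s1+1)) :: (int^'d) set)" if "s \<le> s1" for s
        using that by (intro Box_mono power_increasing) auto
      then show ?thesis using \<Theta>(1) s01 unfolding U_def by fastforce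
    qed
    fix k assume k: "k \<in> Box (2^(s1+1)) - U"
    have "c s k = 0" if "s \<le> s1" for s
    proof (cases "s \<le> s0")
      case True
      have "Box (2^(s+1)) \<subseteq> (Box (2^(s0+1)) :: (int^'d) set)"
        using True by (intro Box_mono power_increasing) auto
      then have "k \<notin> Box (2^(s+1))" using k unfolding U_def by blast
      then have "scoef s k = 0" using scoef_support(1) by blast
      then show ?thesis using True by (simp add: c_def)
    next
      case False
      then have "k \<notin> \<Theta> s" using k that unfolding U_def by auto
      then show ?thesis using False by (simp add: c_def)
    qed
    then show "(\<Sum>s\<le>s1. c s k) = 0" by simp
  qed simp
  have "card U \<le> card (Box (2^(s0+1)) :: (int^'d) set) + (\<Sum>s\<in>{s0<..s1}. N s)"
  proof -
    have "card U \<le> card (Box (2^(s0+1)) :: (int^'d) set) + card (\<Union>s\<in>{s0<..s1}. \<Theta> s)"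
      unfolding U_def by (rule card_Un_le)
    also have "card (\<Union>s\<in>{s0<..s1}. \<Theta> s) \<le> (\<Sum>s\<in>{s0<..s1}. card (\<Theta> s))" by (rule card_UN_le) simp
    also have "\<dots> \<le> (\<Sum>s\<in>{s0<..s1}. N s)" by (intro sum_mono \<Theta>)
    finally show ?thesis by simp
  qed
  then show ?thesis using finU bound unfolding TU
    by (intro exI[of _ U] exI[of _ "\<lambda>k. \<Sum>s\<le>s1. c s k"] conjI)
qed

text \<open>With \<open>m = 2 powr (d x)\<close>, the low blocks are those up to \<open>x\<close> and the high blocks those beyond \<open>q x / 2\<close>.
  The number of terms spent on a middle block decays away from the end \<open>t\<close> of the middle range that
  dominates the error: the upper end if \<open>r < d/p\<close>, the lower end if \<open>r > d/p\<close>.\<close>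

lemma dyadic_parameters:
  fixes A B q e :: real and d m :: nat
  assumes d: "0 < d" and m: "1 \<le> m" and q: "2 < q" and B: "B = A + real d / q" "0 < B"
    and e: "(A < 0 \<and> real d * e = - (q/2) * B) \<or> (0 < A \<and> real d * e = - A - real d / 2)"
  obtains s0 s1 t :: nat where "s0 \<le> s1" "2 powr (real d * real s0) \<le> real m" "real s1 \<le> q / 2 * real m"
    "\<And>s. s0 < s \<Longrightarrow> s \<le> s1 \<Longrightarrow> - (A * real s) = - (A * real t) - \<bar>A\<bar> * \<bar>real s - real t\<bar>"
    "real m powr (-1/2) * 2 powr (- (A * real t)) \<le> 2 powr \<bar>A\<bar> * real m powr e"
    "2 powr (- (B * real s1)) \<le> 2 powr B * real m powr e"
proof -
  define x where "x = log 2 m / real d"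
  have x0: "0 \<le> x" using m d by (simp add: x_def)
  have mx: "real m powr y = 2 powr (real d * x * y)" for y
  proof -
    have "real m = 2 powr (real d * x)" using m d by (simp add: x_def)
    then show ?thesis by (simp only: powr_powr)
  qed
  define s0 where "s0 = nat \<lfloor>x\<rfloor>"
  define s1 where "s1 = nat \<lfloor>q / 2 * x\<rfloor>"
  have xq: "x \<le> q / 2 * x" using mult_right_mono[of 1 "q / 2" x] x0 q by simp
  have s0: "real s0 \<le> x" "x < real s0 + 1" using x0 unfolding s0_def by linarith+
  have s1: "real s1 \<le> q / 2 * x" "q / 2 * x < real s1 + 1"
    using x0 xq unfolding s1_def by linarith+
  \<comment> \<open>At the level q x / 2 the L_q bound for the dropped blocks equals the bound on
    the coefficient sum times m^(-1/2). This identity fixes the upper end of the middle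
    range.\<close>
  have Bx: "B * (q / 2 * x) = A * (q / 2 * x) + real d * x / 2"
    using q unfolding B(1) by (simp add: field_simps)
  show ?thesis
  proof (rule that[of s0 s1 "if A < 0 then s1 else s0"])
    show s01: "s0 \<le> s1" unfolding s0_def s1_def by (intro nat_mono floor_mono xq)
    show "2 powr (real d * real s0) \<le> real m"
    proof -
      have "2 powr (real d * real s0) \<le> 2 powr (real d * x)"
        using s0 by (intro powr_mono mult_left_mono) auto
      also have "\<dots> = real m" using mx[of 1] m by simp
      finally show ?thesis .
    qed
    \<comment> \<open>Deliberately crude: rounding the budgets up costs at most one term per middle
      block, and there are only logarithmically many of these.\<close>
    show "real s1 \<le> q / 2 * real m"
    proof -
      have "log 2 m \<le> real m"
      proof -
        have "real m \<le> 2 powr real m"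
          using less_exp[of m] by (simp add: powr_realpow less_imp_le)
        then show ?thesis using m by (subst log_le_iff) auto
      qed
      moreover have "x \<le> log 2 m" using m d by (simp add: x_def divide_le_eq mult_le_cancel_left1)
      ultimately have "x \<le> real m" by simp
      then have "q / 2 * x \<le> q / 2 * real m" using q by (intro mult_left_mono) auto
      then show ?thesis using s1 by simp
    qed
    show "- (A * real s) = - (A * real (if A < 0 then s1 else s0)) - \<bar>A\<bar> * \<bar>real s - real (if A < 0 then s1 else s0)\<bar>"
      if "s0 < s" "s \<le> s1" for s
      using that by (auto simp: abs_if algebra_simps)
    show "real m powr (-1/2) * 2 powr (- (A * real (if A < 0 then s1 else s0))) \<le> 2 powr \<bar>A\<bar> * real m powr e"
    proof (cases "A < 0")
      case True
      have "real m powr (-1/2) * 2 powr (- (A * real s1)) = 2 powr (real d * x * (-1/2) + - (A * real s1))"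
        unfolding mx powr_add ..
      also have "\<dots> \<le> 2 powr (\<bar>A\<bar> + real d * x * e)"
      proof (rule powr_mono)
        have "real d * x * e = x * (real d * e)" by simp
        also have "\<dots> = - (B * (q / 2 * x))" using True e by simp
        also have "\<dots> = - (A * (q / 2 * x)) - real d * x / 2" unfolding Bx by simp
        finally have E: "real d * x * e = - (A * (q / 2 * x)) - real d * x / 2" .
        have "(-A) * real s1 \<le> (-A) * (q / 2 * x)" using True s1 by (intro mult_left_mono) auto
        then show "real d * x * (-1/2) + - (A * real s1) \<le> \<bar>A\<bar> + real d * x * e" unfolding E by simp
      qed simp
      finally show ?thesis using True by (simp only: if_True mx[of e] powr_add)
    next
      case False
      then have A: "0 < A" using e by auto
      have "real m powr (-1/2) * 2 powr (- (A * real s0)) = 2 powr (real d * x * (-1/2) + - (A * real s0))"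
        unfolding mx powr_add ..
      also have "\<dots> \<le> 2 powr (\<bar>A\<bar> + real d * x * e)"
      proof (rule powr_mono)
        have "real d * x * e = x * (real d * e)" by simp
        also have "real d * e = - A - real d / 2" using A e by auto
        also have "x * (- A - real d / 2) = - (A * x) - real d * x / 2" by (simp add: algebra_simps)
        finally have E: "real d * x * e = - (A * x) - real d * x / 2" .
        have "A * x \<le> A * (real s0 + 1)" using A s0 by (intro mult_left_mono) auto
        then show "real d * x * (-1/2) + - (A * real s0) \<le> \<bar>A\<bar> + real d * x * e"
          unfolding E using A by (simp add: algebra_simps)
      qed simp
      finally show ?thesis using False by (simp only: if_False mx[of e] powr_add)
    qed
    show "2 powr (- (B * real s1)) \<le> 2 powr B * real m powr e"
    proof -
      have "- (B * real s1) \<le> B + real d * x * e"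
      proof -
        have 1: "B * (q / 2 * x) \<le> B * (real s1 + 1)" using B(2) s1 by (intro mult_left_mono) auto
        have 2: "- (B * (q / 2 * x)) \<le> real d * x * e"
        proof (cases "A < 0")
          case True
          have "real d * x * e = x * (real d * e)" by simp
          also have "\<dots> = - (B * (q / 2 * x))" using True e by simp
          finally show ?thesis by simp
        next
          case False
          then have A: "0 < A" using e by auto
          have "real d * x * e = x * (real d * e)" by simp
          also have "real d * e = - A - real d / 2" using A e by auto
        also have "x * (- A - real d / 2) = - (A * x) - real d * x / 2" by (simp add: algebra_simps)
          finally have E: "real d * x * e = - (A * x) - real d * x / 2" .
          have "A * x \<le> A * (q / 2 * x)" using A xq by (intro mult_left_mono) auto
          then show ?thesis unfolding E Bx by simp
        qed
        have "B * (real s1 + 1) = B * real s1 + B" by (simp add: distrib_left)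
        then show ?thesis using 1 2 by linarith
      qed
      then have "2 powr (- (B * real s1)) \<le> 2 powr (B + real d * x * e)" by (intro powr_mono) auto
      then show ?thesis by (simp only: powr_add mx)
    qed
  qed
qed

text \<open>The constant K in the number of terms is removed afterwards by rescaling m; the last
  claim, for the zero approximant, serves the finitely many m below K.\<close>

lemma upper_core:
  fixes k :: nat and p q r e D :: real
  defines "d \<equiv> real CARD('d::finite)"
  assumes p: "1 < p" "p \<le> 2" and q: "2 < q" and r: "0 < r" and D0: "0 \<le> D"
    and B: "0 < r - d * (1/p - 1/q)"
    and e: "(r - d/p < 0 \<and> d * e = - (q/2) * (r - d * (1/p - 1/q))) \<or> (0 < r - d/p \<and> d * e = - (r - d/p) - d / 2)"
  obtains K :: nat and C :: real where "0 < K" "0 < C"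
    "\<And>(f :: real^'d \<Rightarrow> complex) m. Lp_le p f 1 \<Longrightarrow> periodic_fun f \<Longrightarrow>
      (\<And>h. Lp_le p (fdiff h k f) (D * norm h powr r)) \<Longrightarrow> 1 \<le> m \<Longrightarrow>
      \<exists>\<Theta> c. finite \<Theta> \<and> card \<Theta> \<le> K * m \<and> Bq1_norm q (\<lambda>x. f x - trig_poly \<Theta> c x) \<le> ennreal (C * real m powr e)"
    "\<And>f :: real^'d \<Rightarrow> complex. Lp_le p f 1 \<Longrightarrow> periodic_fun f \<Longrightarrow>
      (\<And>h. Lp_le p (fdiff h k f) (D * norm h powr r)) \<Longrightarrow> Bq1_norm q f \<le> ennreal C"
proof -
  let ?d = "CARD('d)"
  define A where "A = r - d/p"
  define B' where "B' = r - d * (1/p - 1/q)"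
  have BA: "B' = A + d / q" by (simp add: A_def B'_def algebra_simps)
  have B0: "0 < B'" using B by (simp add: B'_def)
  have A0: "A \<noteq> 0" using e by (auto simp: A_def)
  \<comment> \<open>Budgets decay like 2^(-|A| |s - t|), which costs only 2^(|A| |s - t| / 2) in the
    error. Against the decay |A| of the coefficient sums half of the rate remains, so both the
    numbers of terms and the errors are geometric around t.\<close>
  define \<kappa> where "\<kappa> = \<bar>A\<bar> / 2"
  have \<kappa>: "0 < \<kappa>" using A0 by (simp add: \<kappa>_def)
  obtain C0 where C0: "0 < C0" and dec: "\<And>(f :: real^'d \<Rightarrow> complex) s. Lp_le p f 1 \<Longrightarrow> periodic_fun f \<Longrightarrow>
      (\<And>h. Lp_le p (fdiff h k f) (D * norm h powr r)) \<Longrightarrow>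
      Lp_le p (\<lambda>x. f x - vp_op (2^s) f x) (C0 * 2 powr (- (r * real s))) \<and>
      Lp_le p (sigma_block s f) (C0 * 2 powr (- (r * real s)))"
    by (rule block_decay[of p r D k, where 'd='d]) (use p r D0 in auto)
  obtain G where G0: "0 < G" and G: "\<And>\<Lambda> (c :: int^'d \<Rightarrow> complex) M. finite \<Lambda> \<Longrightarrow> 0 < M \<Longrightarrow>
    \<exists>\<Theta> b. \<Theta> \<subseteq> \<Lambda> \<and> card \<Theta> \<le> M \<and>
      Lp_le q (\<lambda>x. trig_poly \<Lambda> c x - trig_poly \<Theta> b x) (G * real M powr (-1/2) * (\<Sum>k\<in>\<Lambda>. norm (c k)))"
    by (rule m_term_approximation[of q, where 'd='d]) (use q in auto)
  obtain Z1 where Z1: "0 < Z1" "\<And>t::nat. summable (\<lambda>s. 2 powr (- (\<kappa> * \<bar>real s - real t\<bar>)))"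
    "\<And>t::nat. (\<Sum>s. 2 powr (- (\<kappa> * \<bar>real s - real t\<bar>))) \<le> Z1"
    by (rule two_sided_geometric[OF \<kappa>]) (rule that)
  obtain Z2 where Z2: "0 < Z2" "\<And>t::nat. summable (\<lambda>s. 2 powr (- (B' * \<bar>real s - real t\<bar>)))"
    "\<And>t::nat. (\<Sum>s. 2 powr (- (B' * \<bar>real s - real t\<bar>))) \<le> Z2"
    by (rule two_sided_geometric[OF B0]) (rule that)
  obtain Z3 where Z3: "0 < Z3" "\<And>t::nat. summable (\<lambda>s. 2 powr (- (\<bar>A\<bar> * \<bar>real s - real t\<bar>)))"
    "\<And>t::nat. (\<Sum>s. 2 powr (- (\<bar>A\<bar> * \<bar>real s - real t\<bar>))) \<le> Z3"
    by (rule two_sided_geometric[of "\<bar>A\<bar>"]) (use A0 in simp, rule that)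
  \<comment> \<open>8^d counts the box of the blocks kept in full, Z3 the geometric budgets, and q/2
    the rounding up of budgets.\<close>
  define K where "K = nat \<lceil>8 ^ ?d + Z3 + q / 2\<rceil>"
  have K: "8 ^ ?d + Z3 + q / 2 \<le> real K" unfolding K_def by linarith
  have "0 < 8 ^ ?d + Z3 + q / 2" using Z3(1) q by (intro add_pos_pos) auto
  then have K0: "0 < K" using K by linarith
  define H where "H = G * (12 ^ ?d * C0) * 2 powr \<bar>A\<bar> * Z1 + 6 ^ ?d * C0 * 2 powr B' * Z2"
  have H0: "0 < H" unfolding H_def using G0 C0 Z1(1) Z2(1) by (intro add_pos_pos mult_pos_pos) auto
  define C where "C = 8 * 3 ^ ?d * H + 8 * 3 ^ ?d * (6 ^ ?d * C0 * Z2)"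
  have Cpos: "0 < C" unfolding C_def using H0 C0 Z2(1) by (intro add_pos_pos mult_pos_pos) auto
  have C1: "8 * 3 ^ ?d * H \<le> C" and C2: "8 * 3 ^ ?d * (6 ^ ?d * C0 * Z2) \<le> C"
    unfolding C_def using H0 C0 Z2(1) by auto
  have blkq: "Lp_le q (sigma_block s f) (6 ^ ?d * C0 * 2 powr (- (B' * real s)))"
    and blkl: "(\<Sum>k\<in>Box (2^(s+1)). norm (of_real (scoef s k) * fhat f k)) \<le> 12 ^ ?d * C0 * 2 powr (- (A * real s))"
    and fq: "Lp_le q f (\<Sum>s. 6 ^ ?d * C0 * 2 powr (- (B' * real s)))"
    if f: "Lp_le p f 1" and per: "periodic_fun f" and D: "\<And>h. Lp_le p (fdiff h k f) (D * norm h powr r)"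
    for f :: "real^'d \<Rightarrow> complex" and s
  proof -
    have f1: "Lp_le 1 f 1" by (rule Lp_le_exponent_mono[OF f]) (use p in auto)
    have blk: "Lp_le p (sigma_block s f) (C0 * 2 powr (- (r * real s)))" for s using dec[OF f per D] by blast
    show bq: "Lp_le q (sigma_block s f) (6 ^ ?d * C0 * 2 powr (- (B' * real s)))" for s
      unfolding B'_def d_def by (rule block_Lq[OF f1 per p(1) _ blk]) (use p q in simp)
    show "(\<Sum>k\<in>Box (2^(s+1)). norm (of_real (scoef s k) * fhat f k)) \<le> 12 ^ ?d * C0 * 2 powr (- (A * real s))"
      unfolding A_def d_def by (rule block_coeff_sum[OF f1 per p blk])
    show "Lp_le q f (\<Sum>s. 6 ^ ?d * C0 * 2 powr (- (B' * real s)))"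
      by (rule Lp_le_of_blocks[OF f per _ _ r conjunct1[OF dec[OF f per D]] bq])
        (use p q in \<open>auto intro!: summable_mult summable_two_powr[OF B0]\<close>)
  qed
  show ?thesis
  proof (rule that[OF K0 Cpos])
    fix f :: "real^'d \<Rightarrow> complex" and m :: nat
    assume f: "Lp_le p f 1" and per: "periodic_fun f" and D: "\<And>h. Lp_le p (fdiff h k f) (D * norm h powr r)"
      and m: "1 \<le> m"
    obtain s0 s1 t :: nat where s01: "s0 \<le> s1" and s0: "2 powr (d * real s0) \<le> real m"
      and s1: "real s1 \<le> q / 2 * real m"
      and At: "\<And>s. s0 < s \<Longrightarrow> s \<le> s1 \<Longrightarrow> - (A * real s) = - (A * real t) - \<bar>A\<bar> * \<bar>real s - real t\<bar>"
      and E1: "real m powr (-1/2) * 2 powr (- (A * real t)) \<le> 2 powr \<bar>A\<bar> * real m powr e"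
      and E2: "2 powr (- (B' * real s1)) \<le> 2 powr B' * real m powr e"
      unfolding d_def
      by (rule dyadic_parameters[of ?d m q B' A e]) (use m q BA B0 e in \<open>auto simp: d_def A_def B'_def\<close>)
    define N where "N s = nat \<lceil>real m * 2 powr (- (\<bar>A\<bar> * \<bar>real s - real t\<bar>))\<rceil>" for s :: nat
    let ?y = "\<lambda>s. real m * 2 powr (- (\<bar>A\<bar> * \<bar>real s - real t\<bar>))"
    have ypos: "0 < ?y s" for s using m by simp
    have Nge: "?y s \<le> real (N s)" and Nle: "real (N s) \<le> ?y s + 1" for s
      using ypos[of s] unfolding N_def by linarith+
    have Npos: "0 < N s" for s using Nge[of s] ypos[of s] by linarith
    let ?H1 = "G * (12 ^ ?d * C0) * (real m powr (-1/2) * 2 powr (- (A * real t)))"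
    let ?H2 = "6 ^ ?d * C0 * 2 powr (- (B' * real s1))"
    \<comment> \<open>The first summand, centred at t, bounds the middle blocks; the second, centred
      at s1, bounds the dropped ones. Both are taken for all s, so that one summable sequence serves
      throughout.\<close>
    define \<delta> where "\<delta> s = ?H1 * 2 powr (- (\<kappa> * \<bar>real s - real t\<bar>)) + ?H2 * 2 powr (- (B' * \<bar>real s - real s1\<bar>))" for s :: nat
    have H10: "0 \<le> ?H1" and H20: "0 \<le> ?H2" using G0 C0 by auto
    have \<delta>0: "0 \<le> \<delta> s" for s unfolding \<delta>_def using H10 H20 by (simp del: zero_le_mult_iff)
    have \<delta>s: "summable \<delta>" unfolding \<delta>_def by (intro summable_add summable_mult Z1 Z2)
    have "\<exists>\<Theta> c. finite \<Theta> \<and> card \<Theta> \<le> card (Box (2^(s0+1)) :: (int^'d) set) + (\<Sum>s\<in>{s0<..s1}. N s) \<and>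
      Bq1_norm q (\<lambda>x. f x - trig_poly \<Theta> c x) \<le> ennreal (8 * 3 ^ ?d * (\<Sum>s. \<delta> s))"
    proof (rule m_term_construction[OF fq[OF f per D] per _ G Npos _ _ \<delta>0 \<delta>s s01])
      fix s assume s: "s0 < s" "s \<le> s1"
      let ?z = "\<bar>real s - real t\<bar>"
      have "real (N s) powr (-1/2) \<le> ?y s powr (-1/2)"
        using Nge[of s] ypos[of s] by (intro powr_mono2') auto
      also have "\<dots> = real m powr (-1/2) * 2 powr (\<kappa> * ?z)"
        by (simp add: powr_mult powr_powr \<kappa>_def)
      finally have n: "real (N s) powr (-1/2) \<le> real m powr (-1/2) * 2 powr (\<kappa> * ?z)" .
      have "G * real (N s) powr (-1/2) * (\<Sum>k\<in>Box (2^(s+1)). norm (of_real (scoef s k) * fhat f k))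
         \<le> G * (real m powr (-1/2) * 2 powr (\<kappa> * ?z)) * (12 ^ ?d * C0 * 2 powr (- (A * real s)))"
        using G0 by (intro mult_mono mult_left_mono n blkl[OF f per D]) (auto intro!: sum_nonneg)
      also have "2 powr (- (A * real s)) = 2 powr (- (A * real t)) * 2 powr (- (\<bar>A\<bar> * ?z))"
        unfolding At[OF s] by (simp flip: powr_add)
      also have "G * (real m powr (-1/2) * 2 powr (\<kappa> * ?z)) * (12 ^ ?d * C0 * (2 powr (- (A * real t)) * 2 powr (- (\<bar>A\<bar> * ?z))))
         = ?H1 * (2 powr (\<kappa> * ?z) * 2 powr (- (\<bar>A\<bar> * ?z)))" by (simp only: mult_ac)
      also have "2 powr (\<kappa> * ?z) * 2 powr (- (\<bar>A\<bar> * ?z)) = 2 powr (- (\<kappa> * ?z))"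
        unfolding powr_add[symmetric] by (rule arg_cong[of _ _ "\<lambda>u. 2 powr u"]) (simp add: \<kappa>_def)
      also have "?H1 * 2 powr (- (\<kappa> * ?z)) \<le> \<delta> s" unfolding \<delta>_def using H20 by simp
      finally show "G * real (N s) powr (-1/2) * (\<Sum>k\<in>Box (2^(s+1)). norm (of_real (scoef s k) * fhat f k)) \<le> \<delta> s" .
    next
      fix s assume s: "s1 < s"
      have "6 ^ ?d * C0 * 2 powr (- (B' * real s)) = ?H2 * 2 powr (- (B' * \<bar>real s - real s1\<bar>))"
      proof -
        have "- (B' * real s) = - (B' * real s1) + - (B' * \<bar>real s - real s1\<bar>)" using s by (simp add: algebra_simps)
        then show ?thesis by (simp only: powr_add mult.assoc)
      qed
      also have "\<dots> \<le> \<delta> s" unfolding \<delta>_def using H10 by simp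
      finally show "Lp_le q (sigma_block s f) (\<delta> s)"
        by (rule Lp_le_mono[OF blkq[OF f per D]]) (use q in simp)
    qed (use q in auto)
    then obtain \<Theta> c where \<Theta>: "finite \<Theta>" "card \<Theta> \<le> card (Box (2^(s0+1)) :: (int^'d) set) + (\<Sum>s\<in>{s0<..s1}. N s)"
      and bnd: "Bq1_norm q (\<lambda>x. f x - trig_poly \<Theta> c x) \<le> ennreal (8 * 3 ^ ?d * (\<Sum>s. \<delta> s))" by blast
    have "(\<Sum>s. \<delta> s) \<le> H * real m powr e"
    proof -
      have "(\<Sum>s. \<delta> s) = ?H1 * (\<Sum>s. 2 powr (- (\<kappa> * \<bar>real s - real t\<bar>))) + ?H2 * (\<Sum>s. 2 powr (- (B' * \<bar>real s - real s1\<bar>)))"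
        unfolding \<delta>_def by (simp only: suminf_add[symmetric] suminf_mult[symmetric] summable_mult Z1 Z2)
      also have "\<dots> \<le> ?H1 * Z1 + ?H2 * Z2"
        by (intro add_mono mult_left_mono Z1 Z2 H10 H20)
      also have "\<dots> \<le> G * (12 ^ ?d * C0) * (2 powr \<bar>A\<bar> * real m powr e) * Z1 + 6 ^ ?d * C0 * (2 powr B' * real m powr e) * Z2"
        using G0 C0 Z1(1) Z2(1) by (intro add_mono mult_right_mono mult_left_mono E1 E2) auto
      also have "\<dots> = H * real m powr e" unfolding H_def by (simp add: algebra_simps)
      finally show ?thesis .
    qed
    then have "8 * 3 ^ ?d * (\<Sum>s. \<delta> s) \<le> 8 * 3 ^ ?d * (H * real m powr e)" by (intro mult_left_mono) auto
    also have "\<dots> = 8 * 3 ^ ?d * H * real m powr e" by simp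
    also have "\<dots> \<le> C * real m powr e" by (intro mult_right_mono C1) simp
    finally have "Bq1_norm q (\<lambda>x. f x - trig_poly \<Theta> c x) \<le> ennreal (C * real m powr e)"
      using bnd by (meson ennreal_leI order_trans)
    moreover have "card \<Theta> \<le> K * m"
    proof -
      have "real (card (Box (2^(s0+1)) :: (int^'d) set)) \<le> 8 ^ ?d * real m"
      proof -
        have "card {- int a..int a} = 2 * a + 1" for a by simp
        then have "card {- int (2^(s0+1))..int (2^(s0+1))} = 2 * 2^(s0+1) + 1" .
        also have "\<dots> \<le> 8 * 2 ^ s0" by simp
        finally have "card (Box (2^(s0+1)) :: (int^'d) set) \<le> (8 * 2 ^ s0) ^ ?d"
          by (simp only: card_cube finite_atLeastAtMost_int) (rule power_mono, simp_all)
        then have "real (card (Box (2^(s0+1)) :: (int^'d) set)) \<le> real ((8 * 2 ^ s0) ^ ?d)" by (simp only: of_nat_le_iff)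
        also have "\<dots> = 8 ^ ?d * (2 ^ s0) ^ ?d" by (simp add: power_mult_distrib)
        also have "(2 ^ s0) ^ ?d = 2 powr (d * real s0)"
          by (simp add: d_def powr_realpow[symmetric] powr_powr mult.commute)
        also have "8 ^ ?d * 2 powr (d * real s0) \<le> 8 ^ ?d * real m" by (rule mult_left_mono[OF s0]) simp
        finally show ?thesis .
      qed
      moreover have "real (\<Sum>s\<in>{s0<..s1}. N s) \<le> Z3 * real m + q / 2 * real m"
      proof -
        have "real (\<Sum>s\<in>{s0<..s1}. N s) = (\<Sum>s\<in>{s0<..s1}. real (N s))" by simp
        also have "\<dots> \<le> (\<Sum>s\<in>{s0<..s1}. ?y s + 1)" by (intro sum_mono Nle)
        also have "\<dots> = real m * (\<Sum>s\<in>{s0<..s1}. 2 powr (- (\<bar>A\<bar> * \<bar>real s - real t\<bar>))) + real (s1 - s0)"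
          by (simp add: sum.distrib sum_distrib_left)
        also have "\<dots> \<le> real m * Z3 + real s1"
        proof (intro add_mono mult_left_mono)
          have "(\<Sum>s\<in>{s0<..s1}. 2 powr (- (\<bar>A\<bar> * \<bar>real s - real t\<bar>))) \<le> (\<Sum>s. 2 powr (- (\<bar>A\<bar> * \<bar>real s - real t\<bar>)))"
            by (rule sum_le_suminf[OF Z3(2)]) auto
          also note Z3(3)
          finally show "(\<Sum>s\<in>{s0<..s1}. 2 powr (- (\<bar>A\<bar> * \<bar>real s - real t\<bar>))) \<le> Z3" .
        qed auto
        finally show ?thesis using s1 by (simp add: mult.commute)
      qed
      ultimately have "real (card \<Theta>) \<le> (8 ^ ?d + Z3 + q / 2) * real m"
        using of_nat_mono[OF \<Theta>(2), where 'a=real] by (simp only: of_nat_add distrib_right)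
      also have "\<dots> \<le> real K * real m" by (rule mult_right_mono[OF K]) simp
      finally show ?thesis by (simp only: of_nat_mult[symmetric] of_nat_le_iff)
    qed
    ultimately show "\<exists>\<Theta> c. finite \<Theta> \<and> card \<Theta> \<le> K * m \<and> Bq1_norm q (\<lambda>x. f x - trig_poly \<Theta> c x) \<le> ennreal (C * real m powr e)"
      using \<Theta>(1) by blast
  next
    fix f :: "real^'d \<Rightarrow> complex"
    assume f: "Lp_le p f 1" and per: "periodic_fun f" and D: "\<And>h. Lp_le p (fdiff h k f) (D * norm h powr r)"
    have f1: "Lp_le 1 f 1" by (rule Lp_le_exponent_mono[OF f]) (use p in auto)
    have sum: "summable (\<lambda>s::nat. 2 powr (- (B' * real s)))" by (rule summable_two_powr[OF B0])
    have "Bq1_norm q (\<lambda>x. f x - trig_poly (Box (2^(0+1))) (\<lambda>k. \<Sum>s\<le>0::nat. 0) x)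
       \<le> ennreal (8 * 3 ^ ?d * (\<Sum>s. 6 ^ ?d * C0 * 2 powr (- (B' * real s))))"
    proof (rule Bq1_norm_difference_le[OF fq[OF f per D] per, where c="\<lambda>_ _. 0"])
      show "Lp_le q (trig_poly (Box (2^(s+1))) (\<lambda>k. of_real (scoef s k) * fhat f k - 0)) (6 ^ ?d * C0 * 2 powr (- (B' * real s)))" for s
        using blkq[OF f per D, of s] by (simp add: sigma_block_trig_poly[OF f1 per])
    qed (use q sum in \<open>auto intro: summable_mult\<close>)
    moreover have "trig_poly (Box (2^(0+1))) (\<lambda>k. \<Sum>s\<le>0::nat. 0) x = 0" for x :: "real^'d" by (simp add: trig_poly_def)
    ultimately have "Bq1_norm q f \<le> ennreal (8 * 3 ^ ?d * (\<Sum>s. 6 ^ ?d * C0 * 2 powr (- (B' * real s))))" by simp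
    also have "\<dots> \<le> ennreal C"
    proof (rule ennreal_leI)
      have "(\<Sum>s. 6 ^ ?d * C0 * 2 powr (- (B' * real s))) = 6 ^ ?d * C0 * (\<Sum>s. 2 powr (- (B' * real s)))"
        by (rule suminf_mult[OF sum])
      also have "(\<Sum>s. 2 powr (- (B' * real s))) \<le> Z2" using Z2(3)[of 0] by simp
      then have "6 ^ ?d * C0 * (\<Sum>s. 2 powr (- (B' * real s))) \<le> 6 ^ ?d * C0 * Z2" using C0 by (intro mult_left_mono) auto
      finally have "8 * 3 ^ ?d * (\<Sum>s. 6 ^ ?d * C0 * 2 powr (- (B' * real s))) \<le> 8 * 3 ^ ?d * (6 ^ ?d * C0 * Z2)"
        by (intro mult_left_mono) auto
      then show "8 * 3 ^ ?d * (\<Sum>s. 6 ^ ?d * C0 * 2 powr (- (B' * real s))) \<le> C" using C2 by linarith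
    qed
    finally show "Bq1_norm q f \<le> ennreal C" .
  qed
qed

text \<open>Exactly m frequencies are prescribed in \<open>best_mterm_Bq1\<close>, so a smaller set
  is padded with fresh frequencies carrying zero coefficients.\<close>

lemma best_mterm_le:
  fixes f :: "real^'d \<Rightarrow> complex"
  assumes "finite \<Theta>" "card \<Theta> \<le> m" "Bq1_norm q (\<lambda>x. f x - trig_poly \<Theta> c x) \<le> E"
  shows "best_mterm_Bq1 q m f \<le> E"
proof -
  have "infinite (UNIV :: (int^'d) set)"
  proof
    assume "finite (UNIV :: (int^'d) set)"
    then have "finite (range (\<lambda>j::int. (\<chi> i. j) :: int^'d))" by (rule rev_finite_subset) simp
    moreover have "inj (\<lambda>j::int. (\<chi> i. j) :: int^'d)" by (auto simp: inj_def vec_eq_iff)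
    ultimately have "finite (UNIV :: int set)" by (rule finite_imageD)
    then show False using infinite_UNIV_int by simp
  qed
  then have "infinite (UNIV - \<Theta>)" using assms(1) by (rule Diff_infinite_finite[rotated])
  then obtain \<Xi> where \<Xi>: "finite \<Xi>" "card \<Xi> = m - card \<Theta>" "\<Xi> \<subseteq> UNIV - \<Theta>"
    using infinite_arbitrarily_large by blast
  let ?U = "\<Theta> \<union> \<Xi>" and ?c = "\<lambda>k. if k \<in> \<Theta> then c k else 0"
  have "card ?U = m" using \<Xi> assms by (subst card_Un_disjoint) auto
  then have U: "?U \<in> {\<Theta>. finite \<Theta> \<and> card \<Theta> = m}" using \<Xi> assms by simp
  have "trig_poly \<Theta> c = trig_poly \<Theta> ?c" by (rule trig_poly_cong) simp
  also have "\<dots> = trig_poly ?U ?c" by (rule trig_poly_mono_neutral) (use \<Xi> assms in auto)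
  finally have "Bq1_norm q (\<lambda>x. f x - trig_poly ?U ?c x) \<le> E" using assms(3) by simp
  then show ?thesis unfolding best_mterm_Bq1_def
    by (intro INF_lower2[OF U] INF_lower2[of ?c]) auto
qed

lemma upper_bound:
  fixes k :: nat and p q r e :: real and \<theta> :: ereal
  defines "d \<equiv> real CARD('d::finite)"
  assumes p: "1 < p" "p \<le> 2" and q: "2 < q" and \<theta>: "1 \<le> \<theta>" and r: "0 < r" and k: "0 < k"
    and B: "0 < r - d * (1/p - 1/q)"
    and e: "(r - d/p < 0 \<and> d * e = - (q/2) * (r - d * (1/p - 1/q))) \<or> (0 < r - d/p \<and> d * e = - (r - d/p) - d / 2)"
  obtains C where "0 < C" "\<And>m. 1 \<le> m \<Longrightarrow>
    best_mterm_class_Bq1 q m (besov_ball k r p \<theta> :: (real^'d \<Rightarrow> complex) set) \<le> ennreal (C * real m powr e)"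
proof -
  have e0: "e < 0"
  proof -
    have d0: "0 < d" by (simp add: d_def)
    have "d * e < 0"
    proof (cases "r - d/p < 0")
      case True
      have "0 < q/2 * (r - d * (1/p - 1/q))" using q B by (intro mult_pos_pos) auto
      then show ?thesis using True e by auto
    next
      case False
      then show ?thesis using e d0 by auto
    qed
    then show ?thesis using d0 by (simp add: mult_less_0_iff)
  qed
  have p1: "1 \<le> p" using p by simp
  have D0: "0 \<le> 2 * 2 powr r" by simp
  obtain K C where K: "0 < K" and C: "0 < C" and
    core: "\<And>(f :: real^'d \<Rightarrow> complex) m. Lp_le p f 1 \<Longrightarrow> periodic_fun f \<Longrightarrow>
      (\<And>h. Lp_le p (fdiff h k f) (2 * 2 powr r * norm h powr r)) \<Longrightarrow> 1 \<le> m \<Longrightarrow>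
      \<exists>\<Theta> c. finite \<Theta> \<and> card \<Theta> \<le> K * m \<and> Bq1_norm q (\<lambda>x. f x - trig_poly \<Theta> c x) \<le> ennreal (C * real m powr e)"
    and triv: "\<And>f :: real^'d \<Rightarrow> complex. Lp_le p f 1 \<Longrightarrow> periodic_fun f \<Longrightarrow>
      (\<And>h. Lp_le p (fdiff h k f) (2 * 2 powr r * norm h powr r)) \<Longrightarrow> Bq1_norm q f \<le> ennreal C"
    by (rule upper_core[OF p q r D0 B[unfolded d_def] e[unfolded d_def], of k]) (use that in auto)
  \<comment> \<open>With m' = m div K one has m \<le> 2 K m'; as e is negative, replacing m by m'
    costs the factor (2K)^(-e).\<close>
  define C' where "C' = C * (2 * real K) powr (- e)"
  have C': "0 < C'" using C K by (simp add: C'_def)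
  have "best_mterm_Bq1 q m f \<le> ennreal (C' * real m powr e)"
    if m: "1 \<le> m" and f: "f \<in> besov_ball k r p \<theta>" for m and f :: "real^'d \<Rightarrow> complex"
  proof -
    have fm: "f \<in> borel_measurable lebesgue" and fper: "periodic_fun f"
      using f by (auto simp: besov_ball_def in_Lp_def)
    obtain g where g: "g \<in> borel_measurable borel" "periodic_fun g" "AE x in lebesgue. f x = g x"
      by (rule borel_version[OF fm fper]) (rule that)
    have gb: "g \<in> besov_ball k r p \<theta>" by (rule besov_ball_cong_AE[OF f g])
    note gp = besov_ball_imp[OF gb g(1) p1 r \<theta> k]
    \<comment> \<open>The approximant found for the Borel representative serves f as well:
      convolutions and integrals ignore null sets.\<close>
    have trans: "Bq1_norm q (\<lambda>x. f x - trig_poly \<Theta> c x) \<le> Bq1_norm q (\<lambda>x. g x - trig_poly \<Theta> c x)" for \<Theta> c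
    proof (rule Bq1_norm_cong_AE)
      have T: "trig_poly \<Theta> c \<in> borel_measurable lebesgue" by (simp add: measurable_completion)
      have G: "g \<in> borel_measurable lebesgue" using g(1) by (simp add: measurable_completion)
      show "(\<lambda>x. f x - trig_poly \<Theta> c x) \<in> borel_measurable lebesgue" using fm T by measurable
      show "(\<lambda>x. g x - trig_poly \<Theta> c x) \<in> borel_measurable lebesgue" using G T by measurable
      show "periodic_fun (\<lambda>x. f x - trig_poly \<Theta> c x)" by (rule periodic_diff[OF fper periodic_trig_poly])
      show "AE x in lebesgue. f x - trig_poly \<Theta> c x = g x - trig_poly \<Theta> c x" using g(3) by eventually_elim simp
    qed
    have scale: "C * (real m / (2 * real K)) powr e = C' * real m powr e"
      using m K by (simp add: C'_def powr_divide powr_minus_divide)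
    show ?thesis
    proof (cases "K \<le> m")
      case True
      define m' where "m' = m div K"
      have m': "1 \<le> m'" using True K by (simp add: m'_def Suc_le_eq div_greater_zero_iff)
      have Km: "K * m' \<le> m" by (simp add: m'_def)
      obtain \<Theta> c where \<Theta>: "finite \<Theta>" "card \<Theta> \<le> K * m'" and
        b: "Bq1_norm q (\<lambda>x. g x - trig_poly \<Theta> c x) \<le> ennreal (C * real m' powr e)"
        using core[OF gp(2) gp(1) gp(3) m'] by blast
      have "real m \<le> 2 * real K * real m'"
      proof -
        have "m mod K < K" using K by simp
        then have "m < K * m' + K" using mult_div_mod_eq[of K m] unfolding m'_def by linarith
        also have "\<dots> \<le> K * m' + K * m'" using m' by (intro add_left_mono) simp
        finally have "m \<le> 2 * (K * m')" by simp
        then have "real m \<le> real (2 * (K * m'))" by (simp only: of_nat_le_iff)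
        then show ?thesis by simp
      qed
      then have "real m / (2 * real K) \<le> real m'" using K by (simp add: divide_le_eq mult_ac)
      then have "real m' powr e \<le> (real m / (2 * real K)) powr e"
        using m K e0 by (intro powr_mono2') auto
      then have "C * real m' powr e \<le> C' * real m powr e"
        unfolding scale[symmetric] using C by (intro mult_left_mono) auto
      then have "Bq1_norm q (\<lambda>x. f x - trig_poly \<Theta> c x) \<le> ennreal (C' * real m powr e)"
        using trans[of \<Theta> c] b by (meson ennreal_leI order_trans)
      then show ?thesis using best_mterm_le[OF \<Theta>(1)] \<Theta>(2) Km by (meson order_trans)
    next
      case False
      have z: "trig_poly {} (\<lambda>_. 0) x = 0" for x :: "real^'d" by (simp add: trig_poly_def)
      have "Bq1_norm q g \<le> ennreal C" by (rule triv[OF gp(2) gp(1) gp(3)])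
      moreover have "C \<le> C' * real m powr e"
      proof -
        have "(real m / (2 * real K)) \<le> 1" using False K by (simp add: divide_le_eq)
        then have "1 powr e \<le> (real m / (2 * real K)) powr e"
          using m K e0 by (intro powr_mono2') auto
        then have "C * 1 \<le> C * (real m / (2 * real K)) powr e" using C by (intro mult_left_mono) auto
        then show ?thesis by (simp only: scale)
      qed
      ultimately have "Bq1_norm q (\<lambda>x. f x - trig_poly {} (\<lambda>_. 0) x) \<le> ennreal (C' * real m powr e)"
        using trans[of "{}" "\<lambda>_. 0"] by (simp only: z diff_zero) (meson ennreal_leI order_trans)
      then show ?thesis by (intro best_mterm_le) auto
    qed
  qed
  then have "best_mterm_class_Bq1 q m (besov_ball k r p \<theta> :: (real^'d \<Rightarrow> complex) set) \<le> ennreal (C' * real m powr e)" if "1 \<le> m" for m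
    unfolding best_mterm_class_Bq1_def using that by (intro SUP_least) auto
  with C' show ?thesis by (rule that)
qed

section \<open>The lower bound\<close>

lemma besov_semi_le:
  fixes f :: "real^'d \<Rightarrow> complex"
  assumes r: "0 < r" and k: "r < real k" and \<theta>: "1 \<le> \<theta>" and l: "0 < l" and Q: "0 \<le> Q"
    and mod: "\<And>t. 0 < t \<Longrightarrow> 0 \<le> modulus k p f t \<and> modulus k p f t \<le> Q * min 1 ((l * t) ^ k)"
  shows "besov_semi k r p \<theta> f \<le> ennreal (Q * l powr r * (1 + (1 / (real k - r) + 1 / r)))"
proof -
  let ?m = "modulus k p f"
  define Y where "Y = 1 / (real k - r) + 1 / r"
  have Y: "0 < Y" using r k by (simp add: Y_def add_pos_pos)
  have small: "t powr (-r) * ?m t \<le> Q * l powr real k * t powr (real k - r)" if "0 < t" for t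
  proof -
    have "t powr (-r) * ?m t \<le> t powr (-r) * (Q * (l * t) ^ k)"
      using mod[OF that] mult_left_mono[OF min.cobounded2[of 1 "(l * t) ^ k"] Q] by (intro mult_left_mono) auto
    also have "(l * t) ^ k = l powr real k * t powr real k"
      using l that by (simp add: power_mult_distrib powr_realpow)
    also have "t powr (-r) * (Q * (l powr real k * t powr real k)) = Q * l powr real k * (t powr real k * t powr (-r))"
      by (simp only: mult_ac)
    also have "t powr real k * t powr (-r) = t powr (real k - r)" by (simp flip: powr_add)
    finally show ?thesis .
  qed
  have large: "t powr (-r) * ?m t \<le> Q * t powr (-r)" if "0 < t" for t
  proof -
    have "?m t \<le> Q * 1"
      using mod[OF that] mult_left_mono[OF min.cobounded1[of 1 "(l * t) ^ k"] Q] by linarith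
    then show ?thesis using mult_left_mono[of "?m t" Q "t powr (-r)"] by (simp add: mult.commute)
  qed
  show ?thesis
  proof (cases "\<theta> = \<infinity>")
    case True
    have "ennreal (t powr (-r) * ?m t) \<le> ennreal (Q * l powr r * (1 + Y))" if "0 < t" for t
    proof (rule ennreal_leI)
      have "t powr (-r) * ?m t \<le> Q * l powr r"
      proof (cases "t \<le> 1 / l")
        case True
        have "Q * l powr real k * t powr (real k - r) \<le> Q * l powr real k * (1 / l) powr (real k - r)"
          using Q that k True by (intro mult_left_mono powr_mono2) auto
        also have "\<dots> = Q * (l powr real k * (1 / l) powr (real k - r))" by (simp only: mult.assoc)
        also have "l powr real k * (1 / l) powr (real k - r) = l powr r"
          using l by (simp add: powr_divide powr_diff)
        finally show ?thesis by (rule order_trans[OF small[OF that]])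
      next
        case False
        have "Q * t powr (-r) \<le> Q * (1 / l) powr (-r)"
          using Q l r False by (intro mult_left_mono powr_mono2') auto
        also have "(1 / l) powr (-r) = l powr r" using l by (simp add: powr_divide powr_minus_divide)
        finally show ?thesis using large[OF that] by simp
      qed
      also have "\<dots> \<le> Q * l powr r * (1 + Y)" using Q Y by (simp add: distrib_left)
      finally show "t powr (-r) * ?m t \<le> Q * l powr r * (1 + Y)" .
    qed
    then show ?thesis using True unfolding besov_semi_def Y_def by (auto intro!: SUP_least)
  next
    case False
    define \<tau> where "\<tau> = real_of_ereal \<theta>"
    have \<tau>: "1 \<le> \<tau>" using \<theta> False unfolding \<tau>_def by (cases \<theta>) auto
    let ?b1 = "(real k - r) * \<tau>" and ?b2 = "r * \<tau>"
    have b1: "0 < ?b1" and b2: "0 < ?b2" using k r \<tau> by auto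
    define X where "X = set_nn_integral lborel {0<..} (\<lambda>t. ennreal ((t powr (-r) * ?m t) powr \<tau> / t))"
    let ?c1 = "Q powr \<tau> * l powr (real k * \<tau>)" and ?c2 = "Q powr \<tau>"
    let ?F1 = "\<lambda>t::real. ennreal (t powr (?b1 - 1)) * indicator {0..1/l} t"
    let ?F2 = "\<lambda>t::real. ennreal (t powr (- ?b2 - 1)) * indicator {1/l..} t"
    have "X \<le> (\<integral>\<^sup>+t. ennreal ?c1 * ?F1 t + ennreal ?c2 * ?F2 t \<partial>lborel)"
      unfolding X_def
    proof (rule nn_integral_mono)
      fix t :: real
      show "ennreal ((t powr (-r) * ?m t) powr \<tau> / t) * indicator {0<..} t \<le> ennreal ?c1 * ?F1 t + ennreal ?c2 * ?F2 t"
      proof (cases "0 < t")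
        case True
        have m0: "0 \<le> t powr (-r) * ?m t" using mod[OF True] by simp
        have div: "t powr y / t = t powr (y - 1)" for y using True by (simp add: powr_diff)
        show ?thesis
        proof (cases "t \<le> 1 / l")
          case t: True
          have "(t powr (-r) * ?m t) powr \<tau> / t \<le> (Q * l powr real k * t powr (real k - r)) powr \<tau> / t"
            using small[OF True] m0 \<tau> True by (intro divide_right_mono powr_mono2) auto
          also have "\<dots> = ?c1 * t powr (?b1 - 1)"
            using Q by (simp add: powr_mult powr_powr flip: div)
          finally have "ennreal ((t powr (-r) * ?m t) powr \<tau> / t) \<le> ennreal ?c1 * ennreal (t powr (?b1 - 1))"
            by (simp add: ennreal_leI flip: ennreal_mult)
          also have "\<dots> \<le> ennreal ?c1 * ?F1 t + ennreal ?c2 * ?F2 t"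
            using True t by (simp add: add_increasing2)
          finally show ?thesis using True by simp
        next
          case t: False
          have "(t powr (-r) * ?m t) powr \<tau> / t \<le> (Q * t powr (-r)) powr \<tau> / t"
            using large[OF True] m0 \<tau> True by (intro divide_right_mono powr_mono2) auto
          also have "\<dots> = ?c2 * t powr (- ?b2 - 1)"
            using Q by (simp add: powr_mult powr_powr flip: div)
          finally have "ennreal ((t powr (-r) * ?m t) powr \<tau> / t) \<le> ennreal ?c2 * ennreal (t powr (- ?b2 - 1))"
            by (simp add: ennreal_leI flip: ennreal_mult)
          also have "\<dots> \<le> ennreal ?c1 * ?F1 t + ennreal ?c2 * ?F2 t"
            using True t by (simp add: add_increasing)
          finally show ?thesis using True by simp
        qed
      qed simp
    qed
    also have "\<dots> = ennreal ?c1 * (\<integral>\<^sup>+t. ?F1 t \<partial>lborel) + ennreal ?c2 * (\<integral>\<^sup>+t. ?F2 t \<partial>lborel)"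
      by (subst nn_integral_add) (auto simp: nn_integral_cmult)
    also have "(\<integral>\<^sup>+t. ?F1 t \<partial>lborel) = ennreal ((1/l) powr ?b1 / ?b1)"
    proof (rule nn_integral_has_integral_lebesgue')
      show "((\<lambda>t. t powr (?b1 - 1)) has_integral (1/l) powr ?b1 / ?b1) {0..1/l}"
        using has_integral_powr_from_0[of "?b1 - 1" "1/l"] b1 l by simp
    qed simp
    also have "(\<integral>\<^sup>+t. ?F2 t \<partial>lborel) = ennreal ((1/l) powr (- ?b2) / ?b2)"
    proof (rule nn_integral_has_integral_lebesgue')
      show "((\<lambda>t. t powr (- ?b2 - 1)) has_integral (1/l) powr (- ?b2) / ?b2) {1/l..}"
        using has_integral_powr_to_inf[of "- ?b2 - 1" "1/l"] b2 l by simp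
    qed simp
    also have "ennreal ?c1 * ennreal ((1/l) powr ?b1 / ?b1) + ennreal ?c2 * ennreal ((1/l) powr (- ?b2) / ?b2)
        = ennreal ((Q * l powr r) powr \<tau> * (1 / ?b1 + 1 / ?b2))"
    proof -
      have "l powr (real k * \<tau>) * (1/l) powr ?b1 = l powr ?b2"
        using l by (simp add: powr_divide left_diff_distrib powr_diff)
      moreover have "(1/l) powr (- ?b2) = l powr ?b2" using l by (simp add: powr_divide powr_minus_divide)
      moreover have "(Q * l powr r) powr \<tau> = Q powr \<tau> * l powr ?b2" using Q by (simp add: powr_mult powr_powr)
      ultimately have "?c1 * ((1/l) powr ?b1 / ?b1) + ?c2 * ((1/l) powr (- ?b2) / ?b2) = (Q * l powr r) powr \<tau> * (1 / ?b1 + 1 / ?b2)"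
        by (simp only: distrib_left mult.assoc times_divide_eq_right mult_1_right)
      moreover have "0 \<le> (1/l) powr ?b1 / ?b1" "0 \<le> (1/l) powr (- ?b2) / ?b2" using b1 b2 by auto
      ultimately show ?thesis
        by (simp add: ennreal_mult[symmetric] ennreal_plus[symmetric] del: ennreal_plus times_divide_eq_right)
    qed
    finally have X: "X \<le> ennreal ((Q * l powr r) powr \<tau> * (1 / ?b1 + 1 / ?b2))" .
    have YY: "0 \<le> 1 / ?b1 + 1 / ?b2" "1 / ?b1 + 1 / ?b2 \<le> 1 + Y"
    proof -
      show "0 \<le> 1 / ?b1 + 1 / ?b2" using b1 b2 by auto
      have "real k - r \<le> ?b1" "r \<le> ?b2" using k r \<tau> by (auto simp: mult_le_cancel_left1)
      then have "1 / ?b1 \<le> 1 / (real k - r)" "1 / ?b2 \<le> 1 / r" using k r by (auto intro!: divide_left_mono mult_pos_pos b1 b2)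
      then show "1 / ?b1 + 1 / ?b2 \<le> 1 + Y" by (simp add: Y_def)
    qed
    have Xfin: "X \<noteq> \<infinity>" using X by (auto simp: top_unique)
    have "enn2real X \<le> (Q * l powr r) powr \<tau> * (1 / ?b1 + 1 / ?b2)"
      using enn2real_mono[OF X] YY(1) by simp
    then have "enn2real X powr (1/\<tau>) \<le> ((Q * l powr r) powr \<tau> * (1 / ?b1 + 1 / ?b2)) powr (1/\<tau>)"
      using \<tau> by (intro powr_mono2) auto
    also have "\<dots> = Q * l powr r * (1 / ?b1 + 1 / ?b2) powr (1/\<tau>)"
      using \<tau> Q YY(1) by (simp add: powr_mult powr_powr)
    also have "\<dots> \<le> Q * l powr r * (1 + Y)"
    proof (rule mult_left_mono)
      have "(1 / ?b1 + 1 / ?b2) powr (1/\<tau>) \<le> (1 + Y) powr (1/\<tau>)" using YY \<tau> by (intro powr_mono2) auto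
      also have "\<dots> \<le> (1 + Y) powr 1" using Y \<tau> by (intro powr_mono) auto
      finally show "(1 / ?b1 + 1 / ?b2) powr (1/\<tau>) \<le> 1 + Y" using Y by simp
    qed (use Q in simp)
    finally have "enn_powr X (1/\<tau>) \<le> ennreal (Q * l powr r * (1 + Y))"
      using Xfin by (simp add: enn_powr_def ennreal_leI)
    then show ?thesis using False unfolding besov_semi_def Y_def X_def \<tau>_def by simp
  qed
qed

lemma fdiff_trig_poly:
  "fdiff h k (trig_poly \<Lambda> c) = trig_poly \<Lambda> (\<lambda>j. c j * (tchar j h - 1) ^ k)"
  by (induction k) (simp_all add: fdiff1_trig_poly mult.assoc mult.commute[of "tchar _ _ - 1"])

lemma Lp_le_fdiff_trig_poly:
  fixes \<Lambda> :: "(int^'d) set"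
  assumes \<Lambda>: "\<Lambda> \<subseteq> Box l" and l: "0 < l" and P: "Lp_le p (trig_poly \<Lambda> c) a" and p: "1 \<le> p"
  shows "Lp_le p (fdiff h k (trig_poly \<Lambda> c)) ((4 * real CARD('d) * 3 ^ CARD('d) * real l * norm h) ^ k * a)"
proof (induction k)
  case (Suc k)
  have "Lp_le p (fdiff1 h (fdiff h k (trig_poly \<Lambda> c)))
     (4 * real CARD('d) * 3 ^ CARD('d) * real l * norm h * ((4 * real CARD('d) * 3 ^ CARD('d) * real l * norm h) ^ k * a))"
    unfolding fdiff_trig_poly by (rule Bernstein_difference[OF \<Lambda> l _ p]) (use Suc.IH in \<open>simp only: fdiff_trig_poly\<close>)
  then show ?case by (simp only: fdiff.simps power_Suc mult.assoc)
qed (use P in simp)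

text \<open>The leading 1 accounts for the L_p norm itself, the k-th power for k applications of
  \<open>Bernstein_difference\<close>, the last factor for \<open>besov_semi_le\<close>.\<close>

definition besov_const :: "nat \<Rightarrow> real \<Rightarrow> nat \<Rightarrow> real" where
  "besov_const k r d = 1 + (4 * real d * 3 ^ d) ^ k * (1 + (1 / (real k - r) + 1 / r))"

lemma besov_ball_trig_poly:
  fixes \<Lambda> :: "(int^'d) set"
  assumes \<Lambda>: "\<Lambda> \<subseteq> Box l" and l: "0 < l" and P: "Lp_le p (trig_poly \<Lambda> c) a" and p: "1 \<le> p"
    and r: "0 < r" and k: "r < real k" and \<theta>: "1 \<le> \<theta>"
    and small: "a * real l powr r * besov_const k r CARD('d) \<le> 1"
  shows "trig_poly \<Lambda> c \<in> besov_ball k r p \<theta>"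
proof -
  let ?P = "trig_poly \<Lambda> c" and ?b = "4 * real CARD('d) * 3 ^ CARD('d)"
  let ?Y = "1 + (1 / (real k - r) + 1 / r)"
  have a: "0 \<le> a" using P by (simp add: Lp_le_def)
  \<comment> \<open>Lets the Bernstein constant also dominate the factor 2 of the triangle
    inequality for a difference, so that one constant covers both entries of the minimum.\<close>
  have b: "2 \<le> ?b"
  proof -
    have "1 * 1 \<le> real CARD('d) * 3 ^ CARD('d)" by (intro mult_mono one_le_power) (auto simp: Suc_le_eq)
    then show ?thesis by simp
  qed
  have per: "periodic_fun ?P" by (rule periodic_trig_poly)
  have inLp: "in_Lp p ?P" using in_Lp_borel_iff[OF trig_poly_measurable per] Lp_le_integrable[OF P] by blast
  have semi: "besov_semi k r p \<theta> ?P \<le> ennreal ((a * ?b ^ k) * real l powr r * ?Y)"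
  proof (rule besov_semi_le[OF r k \<theta>])
    fix t :: real assume t: "0 < t"
    have "modulus k p ?P t \<le> a * ?b ^ k * min 1 ((real l * t) ^ k)"
      unfolding modulus_def
    proof (rule cSUP_least)
      show "{h :: real^'d. norm h \<le> t} \<noteq> {}" using t by (auto intro!: exI[of _ 0])
      fix h :: "real^'d" assume "h \<in> {h. norm h \<le> t}"
      then have h: "norm h \<le> t" by simp
      have "Lp_norm p (fdiff h k ?P) \<le> (?b * real l * norm h) ^ k * a"
        by (rule Lp_norm_le[OF Lp_le_fdiff_trig_poly[OF \<Lambda> l P p]]) (use p in simp)
      also have "\<dots> \<le> (?b * (real l * t)) ^ k * a"
        unfolding mult.assoc[of ?b] using a h by (intro mult_right_mono power_mono mult_left_mono) auto
      also have "\<dots> = a * ?b ^ k * (real l * t) ^ k" by (simp only: power_mult_distrib mult_ac)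
      finally have 1: "Lp_norm p (fdiff h k ?P) \<le> a * ?b ^ k * (real l * t) ^ k" .
      have "Lp_norm p (fdiff h k ?P) \<le> 2 ^ k * a"
        by (rule Lp_norm_le[OF Lp_le_fdiff[OF P per p]]) (use p in simp)
      also have "\<dots> \<le> ?b ^ k * a" using a b by (intro mult_right_mono power_mono) auto
      finally have 2: "Lp_norm p (fdiff h k ?P) \<le> a * ?b ^ k * 1" by (simp only: mult.commute mult_1_left)
      show "Lp_norm p (fdiff h k ?P) \<le> a * ?b ^ k * min 1 ((real l * t) ^ k)"
        using 1 2 unfolding min_def by presburger
    qed
    moreover have "0 \<le> modulus k p ?P t" by (rule modulus_nonneg[OF P per p]) (use t in simp)
    ultimately show "0 \<le> modulus k p ?P t \<and> modulus k p ?P t \<le> a * ?b ^ k * min 1 ((real l * t) ^ k)" by blast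
  qed (use l a in auto)
  have Y: "0 \<le> ?Y" using r k by (intro add_nonneg_nonneg) auto
  have s0: "0 \<le> (a * ?b ^ k) * real l powr r * ?Y" using a Y by (intro mult_nonneg_nonneg) auto
  have "besov_norm k r p \<theta> ?P \<le> ennreal a + ennreal ((a * ?b ^ k) * real l powr r * ?Y)"
    unfolding besov_norm_def using Lp_norm_le[OF P] p semi by (intro add_mono ennreal_leI) auto
  also have "\<dots> = ennreal (a + (a * ?b ^ k) * real l powr r * ?Y)" using a s0 by (simp only: ennreal_plus)
  also have "\<dots> \<le> ennreal 1"
  proof (rule ennreal_leI)
    have "1 \<le> real l powr r" using l r by (intro ge_one_powr_ge_zero) auto
    then have "a * 1 \<le> a * real l powr r" using a by (intro mult_left_mono) auto
    then have "a + (a * ?b ^ k) * real l powr r * ?Y \<le> a * real l powr r + (a * ?b ^ k) * real l powr r * ?Y" by simp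
    also have "\<dots> = a * real l powr r * besov_const k r CARD('d)"
      unfolding besov_const_def by (simp only: distrib_left mult_1_right mult_ac)
    also note small
    finally show "a + (a * ?b ^ k) * real l powr r * ?Y \<le> 1" .
  qed
  finally show ?thesis using inLp by (simp add: besov_ball_def)
qed

text \<open>Duality: the test function is the kernel with the frequencies in \<open>\<Theta>\<close> removed, so it does not see
  the approximant.\<close>

lemma Bq1_norm_vp_lower:
  fixes \<Theta> :: "(int^'d) set" and s m :: nat and \<gamma> q :: real
  assumes q: "2 < q" and fin: "finite \<Theta>" "card \<Theta> = m" and m: "2 * real m \<le> real (2^s) ^ CARD('d)" and \<gamma>: "0 \<le> \<gamma>"
    and R: "R = (\<lambda>x. trig_poly (Box (2 * 2^s)) (\<lambda>k. of_real (\<gamma> * vcoef (2^s) k)) x - trig_poly \<Theta> c x)"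
  shows "ennreal (\<gamma> * (real (2^s) ^ CARD('d) / 2) / (3 ^ CARD('d) * real (2^s) powr (CARD('d) / q) + sqrt (real m))) \<le> Bq1_norm q R"
proof -
  let ?n = "2^s :: nat" and ?d = "CARD('d)"
  let ?F = "trig_poly (Box (2 * ?n)) (\<lambda>k. of_real (\<gamma> * vcoef ?n k)) :: real^'d \<Rightarrow> complex"
  let ?T = "trig_poly \<Theta> c"
  define q' where "q' = q / (q - 1)"
  have q': "1 < q'" "q' \<le> 2" "1/q + 1/q' = 1" "1 - 1/q' = 1/q"
    using q by (auto simp: q'_def field_simps)
  obtain aF aT where F1: "Lp_le 1 ?F aF" and T1: "Lp_le 1 ?T aT"
    using Lp_le_trig_poly_trivial[of 1] by (metis zero_less_one)
  have perR: "periodic_fun R" unfolding R by (intro periodic_diff periodic_trig_poly)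
  have R1: "Lp_le 1 R (aF + aT)" unfolding R by (rule Lp_le_diff[OF F1 T1]) simp
  have fR: "fhat R k = (if k \<in> Box (2 * ?n) then of_real (\<gamma> * vcoef ?n k) else 0) - (if k \<in> \<Theta> then c k else 0)" for k
    unfolding R fhat_diff[OF F1 periodic_trig_poly T1 periodic_trig_poly] using fin(1) by (simp add: fhat_trig_poly)
  \<comment> \<open>R is tested through the blocks up to s + 1, that is through the kernel of order
    2^(s+1): its multiplier is 1 at all frequencies of the kernel of order 2^s, whose coefficients
    thus come out unchanged.\<close>
  let ?L = "Box (2 * 2^(s+1)) :: (int^'d) set"
  define u where "u k = (if k \<in> \<Theta> \<or> k \<notin> Box (2 * ?n) then 0 else complex_of_real (vcoef ?n k))" for k :: "int^'d"
  define g where "g = trig_poly ?L u"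
  have BL: "Box (2 * ?n) \<subseteq> ?L" by (rule Box_mono) simp
  have gq: "Lp_le q' g (3 ^ ?d * real ?n powr (?d / q) + sqrt (real m))"
  proof -
    have g_eq: "g = (\<lambda>x. vp ?n x - trig_poly (Box (2 * ?n) \<inter> \<Theta>) (\<lambda>k. of_real (vcoef ?n k)) x)"
    proof -
      let ?w = "\<lambda>k. if k \<in> \<Theta> then complex_of_real (vcoef ?n k) else 0"
      have "g = trig_poly (Box (2 * ?n)) u" unfolding g_def
        by (rule trig_poly_mono_neutral[symmetric]) (use BL in \<open>auto simp: u_def\<close>)
      also have "\<dots> = trig_poly (Box (2 * ?n)) (\<lambda>k. of_real (vcoef ?n k) - ?w k)"
        by (rule trig_poly_cong) (auto simp: u_def)
      also have "\<dots> = (\<lambda>x. trig_poly (Box (2 * ?n)) (\<lambda>k. of_real (vcoef ?n k)) x - trig_poly (Box (2 * ?n)) ?w x)"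
        by (simp only: fun_eq_iff trig_poly_diff) simp
      also have "trig_poly (Box (2 * ?n)) ?w = trig_poly (Box (2 * ?n) \<inter> \<Theta>) ?w"
        by (rule trig_poly_mono_neutral[symmetric]) auto
      also have "\<dots> = trig_poly (Box (2 * ?n) \<inter> \<Theta>) (\<lambda>k. of_real (vcoef ?n k))"
        by (rule trig_poly_cong) auto
      also have "trig_poly (Box (2 * ?n)) (\<lambda>k. of_real (vcoef ?n k)) = vp ?n"
        by (rule vp_trig_poly[symmetric]) simp
      finally show ?thesis .
    qed
    have 1: "Lp_le q' (vp ?n :: real^'d \<Rightarrow> complex) (3 ^ ?d * real ?n powr (?d / q))"
      using Lp_le_vp[of ?n q', where 'd='d] q' by simp
    \<comment> \<open>The removed part has at most m coefficients, each of modulus at most 1, so its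
      L_2 norm is at most sqrt m; this suffices because q' \<le> 2.\<close>
    let ?S = "\<Sum>k\<in>Box (2 * ?n) \<inter> \<Theta>. (norm (complex_of_real (vcoef ?n k)))\<^sup>2"
    have "?S \<le> (\<Sum>k\<in>Box (2 * ?n) \<inter> \<Theta>. 1)"
      using power_le_one[OF vcoef_bounds, of ?n _ 2] by (intro sum_mono) simp
    also have "\<dots> \<le> real m" using card_mono[OF fin(1), of "Box (2 * ?n) \<inter> \<Theta>"] fin(2) by simp
    finally have "sqrt ?S \<le> sqrt (real m)" by (rule real_sqrt_le_mono)
    moreover have "Lp_le 2 (trig_poly (Box (2 * ?n) \<inter> \<Theta>) (\<lambda>k. of_real (vcoef ?n k))) (sqrt ?S)"
      by (rule Lp_le_2_trig_poly) simp
    ultimately have "Lp_le 2 (trig_poly (Box (2 * ?n) \<inter> \<Theta>) (\<lambda>k. of_real (vcoef ?n k))) (sqrt (real m))"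
      by (auto intro: Lp_le_mono)
    then have 2: "Lp_le q' (trig_poly (Box (2 * ?n) \<inter> \<Theta>) (\<lambda>k. of_real (vcoef ?n k))) (sqrt (real m))"
      by (rule Lp_le_exponent_mono) (use q' in auto)
    show ?thesis unfolding g_eq by (rule Lp_le_diff[OF 1 2]) (use q' in simp)
  qed
  let ?b = "3 ^ ?d * real ?n powr (?d / q) + sqrt (real m)"
  have b: "0 < ?b" by (intro add_pos_nonneg mult_pos_pos) auto
  have gcq: "Lp_le q' (\<lambda>x. cnj (g x)) ?b" by (rule Lp_le_cnj[OF gq])
  have sig: "Lp_le q (sigma_block j R) (Lp_norm q (sigma_block j R))" for j
  proof -
    have L: "Lp_le q (sigma_block j R) (\<Sum>k\<in>Box (2^(j+1)). norm (of_real (scoef j k) * fhat R k))"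
      unfolding sigma_block_trig_poly[OF R1 perR] by (rule Lp_le_trig_poly_trivial) (use q in simp)
    show ?thesis
      by (rule Lp_le_Lp_norm[OF Lp_le_measurable[OF L] Lp_le_integrable[OF L]]) (use q in simp)
  qed
  let ?I = "\<lambda>j. \<integral>x. sigma_block j R x * cnj (g x) \<partial>tm"
  have Hol: "Lp_le 1 (\<lambda>x. sigma_block j R x * cnj (g x)) (Lp_norm q (sigma_block j R) * ?b)" for j
    by (rule Lp_le_Holder[OF sig gcq]) (use q q' in auto)
  have "(\<integral>x. vp_op (2^(s+1)) R x * cnj (g x) \<partial>tm) = (\<integral>x. (\<Sum>j\<le>s+1. sigma_block j R x * cnj (g x)) \<partial>tm)"
    unfolding vp_op_sum_sigma[symmetric] sum_distrib_right ..
  also have "\<dots> = (\<Sum>j\<le>s+1. ?I j)"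
    by (rule Bochner_Integration.integral_sum) (rule Lp_le_1_integral(1)[OF Hol])
  finally have "norm (\<integral>x. vp_op (2^(s+1)) R x * cnj (g x) \<partial>tm) \<le> (\<Sum>j\<le>s+1. norm (?I j))"
    by (simp only: norm_sum)
  also have "\<dots> \<le> (\<Sum>j\<le>s+1. Lp_norm q (sigma_block j R) * ?b)"
    by (intro sum_mono Lp_le_1_integral(2) Hol)
  finally have up: "norm (\<integral>x. vp_op (2^(s+1)) R x * cnj (g x) \<partial>tm) \<le> (\<Sum>j\<le>s+1. Lp_norm q (sigma_block j R)) * ?b"
    by (simp only: sum_distrib_right)
  have low: "\<gamma> * (real ?n ^ ?d / 2) \<le> norm (\<integral>x. vp_op (2^(s+1)) R x * cnj (g x) \<partial>tm)"
  proof -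
    have "(\<integral>x. vp_op (2^(s+1)) R x * cnj (g x) \<partial>tm) = (\<Sum>k\<in>?L. of_real (vcoef (2^(s+1)) k) * fhat R k * cnj (u k))"
      unfolding vp_op_trig_poly[OF R1 perR zero_less_power[OF zero_less_numeral]] g_def
      by (rule integral_trig_poly_mult_cnj) simp
    also have "\<dots> = (\<Sum>k\<in>?L. of_real (if k \<in> \<Theta> \<or> k \<notin> Box (2 * ?n) then 0 else \<gamma> * (vcoef ?n k)\<^sup>2))"
    proof (rule sum.cong[OF refl])
      fix k :: "int^'d"
      show "of_real (vcoef (2^(s+1)) k) * fhat R k * cnj (u k) = of_real (if k \<in> \<Theta> \<or> k \<notin> Box (2 * ?n) then 0 else \<gamma> * (vcoef ?n k)\<^sup>2)"
      proof (cases "k \<in> \<Theta> \<or> k \<notin> Box (2 * ?n)")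
        case False
        then have "vcoef (2^(s+1)) k = 1" using vcoef_one[of k "2^(s+1)"] by simp
        then show ?thesis using False by (simp add: fR u_def power2_eq_square)
      qed (simp add: u_def)
    qed
    also have "\<dots> = of_real (\<Sum>k\<in>?L. if k \<in> \<Theta> \<or> k \<notin> Box (2 * ?n) then 0 else \<gamma> * (vcoef ?n k)\<^sup>2)"
      by (simp only: of_real_sum)
    finally have "norm (\<integral>x. vp_op (2^(s+1)) R x * cnj (g x) \<partial>tm)
       = \<bar>\<Sum>k\<in>?L. if k \<in> \<Theta> \<or> k \<notin> Box (2 * ?n) then 0 else \<gamma> * (vcoef ?n k)\<^sup>2\<bar>" by (simp only: norm_of_real)
    moreover have "\<gamma> * (real ?n ^ ?d / 2) \<le> (\<Sum>k\<in>?L. if k \<in> \<Theta> \<or> k \<notin> Box (2 * ?n) then 0 else \<gamma> * (vcoef ?n k)\<^sup>2)"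
    proof -
      \<comment> \<open>Removing m frequencies leaves at least half of n^d frequencies in
        \<open>Box ?n\<close>, where the multiplier equals 1.\<close>
      have "real ?n ^ ?d - real m \<le> real (card (Box ?n - \<Theta> :: (int^'d) set))"
      proof -
        have "card {- int a..int a} = 2 * a + 1" for a by simp
        then have "card {- int ?n..int ?n} = 2 * ?n + 1" .
        then have "real ?n \<le> real (card {- int ?n..int ?n})" by simp
        then have "real ?n ^ ?d \<le> real (card (Box ?n :: (int^'d) set))"
          by (simp only: card_cube finite_atLeastAtMost_int of_nat_power) (rule power_mono, simp_all)
        moreover have "card (Box ?n :: (int^'d) set) \<le> card (Box ?n - \<Theta> :: (int^'d) set) + card \<Theta>"
          using diff_card_le_card_Diff[OF fin(1), of "Box ?n"] by linarith
        ultimately show ?thesis using fin(2) by linarith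
      qed
      then have "real ?n ^ ?d / 2 \<le> real (card (Box ?n - \<Theta> :: (int^'d) set))" using m by linarith
      then have "\<gamma> * (real ?n ^ ?d / 2) \<le> \<gamma> * real (card (Box ?n - \<Theta> :: (int^'d) set))"
        by (rule mult_left_mono) fact
      also have "\<dots> = (\<Sum>k\<in>(Box ?n - \<Theta> :: (int^'d) set). \<gamma>)" by simp
      also have "\<dots> = (\<Sum>k\<in>(Box ?n - \<Theta> :: (int^'d) set). if k \<in> \<Theta> \<or> k \<notin> Box (2 * ?n) then 0 else \<gamma> * (vcoef ?n k)\<^sup>2)"
      proof (rule sum.cong[OF refl])
        fix k :: "int^'d" assume k: "k \<in> Box ?n - \<Theta>"
        then have "k \<in> Box (2 * ?n)" using Box_mono[of ?n "2 * ?n"] by auto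
        moreover have "vcoef ?n k = 1" using k by (intro vcoef_one) simp
        ultimately show "\<gamma> = (if k \<in> \<Theta> \<or> k \<notin> Box (2 * ?n) then 0 else \<gamma> * (vcoef ?n k)\<^sup>2)" using k by simp
      qed
      also have "\<dots> \<le> (\<Sum>k\<in>?L. if k \<in> \<Theta> \<or> k \<notin> Box (2 * ?n) then 0 else \<gamma> * (vcoef ?n k)\<^sup>2)"
      proof (rule sum_mono2)
        show "Box ?n - \<Theta> \<subseteq> ?L" using Box_mono[of ?n "2 * 2^(s+1)"] by auto
      qed (use \<gamma> in auto)
      finally show ?thesis .
    qed
    ultimately show ?thesis by linarith
  qed
  have "\<gamma> * (real ?n ^ ?d / 2) / ?b \<le> (\<Sum>j\<le>s+1. Lp_norm q (sigma_block j R))"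
    using order_trans[OF low up] b by (simp only: pos_divide_le_eq)
  then have "ennreal (\<gamma> * (real ?n ^ ?d / 2) / ?b) \<le> ennreal (\<Sum>j\<le>s+1. Lp_norm q (sigma_block j R))"
    by (rule ennreal_leI)
  also have "\<dots> = (\<Sum>j\<le>s+1. ennreal (Lp_norm q (sigma_block j R)))"
    by (rule sum_ennreal[symmetric]) (rule Lp_norm_nonneg)
  also have "\<dots> \<le> (\<Sum>j. ennreal (Lp_norm q (sigma_block j R)))"
    by (rule sum_le_suminf) auto
  also have "\<dots> \<le> Bq1_norm q R" by (simp add: Bq1_norm_def)
  finally show ?thesis .
qed

lemma lower_bound:
  fixes k :: nat and p q r e :: real and \<theta> :: ereal
  defines "d \<equiv> real CARD('d::finite)"
  assumes p: "1 < p" and q: "2 < q" and \<theta>: "1 \<le> \<theta>" and r: "0 < r" and k: "r < real k"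
    and e: "(r - d/p < 0 \<and> d * e = - (q/2) * (r - d * (1/p - 1/q))) \<or> (0 < r - d/p \<and> d * e = - (r - d/p) - d / 2)"
  obtains C where "0 < C" "\<And>m. 1 \<le> m \<Longrightarrow>
    ennreal (C * real m powr e) \<le> best_mterm_class_Bq1 q m (besov_ball k r p \<theta> :: (real^'d \<Rightarrow> complex) set)"
proof -
  let ?d = "CARD('d)"
  define A where "A = r - d/p"
  have d0: "0 < d" by (simp add: d_def)
  define V where "V = besov_const k r ?d"
  have V: "0 < V" unfolding V_def besov_const_def using r k by (intro add_pos_nonneg mult_nonneg_nonneg add_nonneg_nonneg) auto
  \<comment> \<open>Scales the kernel into the ball: 3^d from its L_p norm, \<open>2 powr r\<close>
    since its degree is 2n, and V from \<open>besov_const\<close>.\<close>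
  define c0 where "c0 = 1 / (3 ^ ?d * 2 powr r * V)"
  have c0: "0 < c0" using V by (simp add: c0_def)
  define W where "W = 3 ^ ?d * 2 powr (d + 1) + 1"
  have W: "0 < W" by (simp add: W_def add_pos_pos)
  \<comment> \<open>The last factor pays for rounding n up to a power of 2 when A is positive;
    \<open>W\<close> collects the constants of the denominator in the duality bound.\<close>
  define C where "C = c0 / 2 / W * 2 powr (- ((d + 1) * \<bar>A\<bar> / d))"
  have C: "0 < C" using c0 W by (simp add: C_def)
  have "ennreal (C * real m powr e) \<le> best_mterm_class_Bq1 q m (besov_ball k r p \<theta> :: (real^'d \<Rightarrow> complex) set)"
    if m: "1 \<le> m" for m
  proof -
    \<comment> \<open>The intended order of n^d. When A is negative n^(-A) grows with n, so the
      largest size allowed by the denominator is taken; otherwise the smallest that leaves room for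
      removing m frequencies.\<close>
    define Y where "Y = (if A < 0 then real m powr (q/2) else real m)"
    have mY: "real m \<le> Y" "Y \<le> real m powr (q/2)"
    proof -
      have "real m powr 1 \<le> real m powr (q/2)" using m q by (intro powr_mono) auto
      then show "real m \<le> Y" "Y \<le> real m powr (q/2)" using m by (auto simp: Y_def)
    qed
    have Y1: "1 \<le> Y" using mY m by linarith
    \<comment> \<open>In the duality bound the numerator is of order n^(-A) and the denominator of
      order sqrt m; their quotient is m^e in both regimes.\<close>
    have Ye: "Y powr (- A / d) * real m powr (-1/2) = real m powr e"
    proof (cases "A < 0")
      case True
      have "d * e = - (q/2) * (A + d/q)" using True e by (auto simp: A_def algebra_simps)
      also have "\<dots> = - (q/2) * A - d/2" using q by (simp add: distrib_left)
      also have "\<dots> = d * (q/2 * (- A / d) + -1/2)" using d0 by (simp add: right_diff_distrib)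
      finally have "d * e = d * (q/2 * (- A / d) + -1/2)" .
      then have "e = q/2 * (- A / d) + -1/2" using d0 by simp
      moreover have "Y powr (- A / d) = real m powr (q/2 * (- A / d))" using True by (simp only: Y_def if_True powr_powr)
      ultimately show ?thesis by (simp only: powr_add)
    next
      case False
      have "d * e = - A - d/2" using False e by (auto simp: A_def)
      also have "\<dots> = d * (- A / d + -1/2)" using d0 by (simp add: right_diff_distrib)
      finally have "d * e = d * (- A / d + -1/2)" .
      then have "e = - A / d + -1/2" using d0 by simp
      then show ?thesis using False by (simp only: Y_def if_False powr_add)
    qed
    \<comment> \<open>Places n^d between 2Y and 2^(d+1) Y; the 2 guarantees 2m \<le> n^d, as
      \<open>Bq1_norm_vp_lower\<close> requires.\<close>
    define s where "s = nat \<lceil>log 2 (2 * Y) / d\<rceil>"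
    define n where "n = real (2^s)"
    have n2: "n = 2 powr real s" by (simp add: n_def powr_realpow)
    have n0: "0 < n" by (simp add: n_def)
    have l0: "0 \<le> log 2 (2 * Y) / d" using Y1 d0 by simp
    have s: "log 2 (2 * Y) / d \<le> real s" "real s < log 2 (2 * Y) / d + 1"
      using l0 unfolding s_def by linarith+
    have nd: "n ^ ?d = n powr d" using n0 by (simp add: d_def powr_realpow)
    have nY: "2 * Y \<le> n powr d" "n powr d \<le> 2 powr (d + 1) * Y"
    proof -
      have npd: "n powr d = 2 powr (d * real s)" by (simp only: n2 powr_powr mult.commute)
      have L: "2 * Y = 2 powr (log 2 (2 * Y))" using Y1 by simp
      have "log 2 (2 * Y) \<le> d * real s" using s(1) d0 by (simp add: divide_le_eq mult.commute)
      then show "2 * Y \<le> n powr d" unfolding npd by (subst L) (intro powr_mono, auto)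
      have "real s * d \<le> (log 2 (2 * Y) / d + 1) * d" using s(2) d0 by (intro mult_right_mono) auto
      also have "\<dots> = log 2 (2 * Y) + d" using d0 by (simp add: distrib_right)
      finally have "d * real s \<le> log 2 (2 * Y) + d" by (simp only: mult.commute)
      then have "n powr d \<le> 2 powr (log 2 (2 * Y) + d)" unfolding npd by (intro powr_mono) auto
      also have "\<dots> = 2 * Y * 2 powr d" unfolding powr_add L[symmetric] ..
      also have "\<dots> = 2 powr (d + 1) * Y" by (simp add: powr_add)
      finally show "n powr d \<le> 2 powr (d + 1) * Y" .
    qed
    define \<gamma> where "\<gamma> = c0 * n powr (- (r + d - d/p))"
    have \<gamma>0: "0 \<le> \<gamma>" using c0 by (simp add: \<gamma>_def)
    let ?F = "trig_poly (Box (2 * 2^s)) (\<lambda>k. of_real (\<gamma> * vcoef (2^s) k)) :: real^'d \<Rightarrow> complex"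
    have Fball: "?F \<in> besov_ball k r p \<theta>"
    proof -
      have "Lp_le p (\<lambda>x::real^'d. of_real \<gamma> * vp (2^s) x :: complex) (norm (complex_of_real \<gamma>) * (3 ^ ?d * n powr (d * (1 - 1/p))))"
        unfolding n_def d_def by (rule Lp_le_cmult[OF Lp_le_vp]) (use p in auto)
      moreover have "(\<lambda>x. of_real \<gamma> * vp (2^s) x) = ?F"
        by (simp add: fun_eq_iff vp_trig_poly trig_poly_tchar sum_distrib_left mult.assoc)
      ultimately have FL: "Lp_le p ?F (\<gamma> * (3 ^ ?d * n powr (d * (1 - 1/p))))" using \<gamma>0 by simp
      have "\<gamma> * (3 ^ ?d * n powr (d * (1 - 1/p))) * real (2 * 2^s) powr r * V = 1"
      proof -
        have "real (2 * 2^s) powr r = 2 powr r * n powr r" by (simp add: n_def powr_mult)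
        moreover have "n powr (- (r + d - d/p)) * n powr (d * (1 - 1/p)) * n powr r = 1"
          unfolding powr_add[symmetric] using n0 by (simp add: algebra_simps)
        moreover have "c0 * (3 ^ ?d * 2 powr r * V) = 1" using V by (simp add: c0_def)
        moreover have "\<gamma> * (3 ^ ?d * n powr (d * (1 - 1/p))) * (2 powr r * n powr r) * V
          = (c0 * (3 ^ ?d * 2 powr r * V)) * (n powr (- (r + d - d/p)) * n powr (d * (1 - 1/p)) * n powr r)"
          unfolding \<gamma>_def by (simp only: mult_ac)
        ultimately show ?thesis by simp
      qed
      then show ?thesis
        using besov_ball_trig_poly[OF order_refl _ FL _ r k \<theta>] p unfolding V_def by simp
    qed
    have m2: "2 * real m \<le> real (2^s) ^ ?d"
      using mY(1) nY(1) unfolding nd[unfolded n_def, symmetric] n_def by linarith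
    have low: "C * real m powr e \<le> \<gamma> * (n ^ ?d / 2) / (3 ^ ?d * n powr (?d / q) + sqrt (real m))"
    proof -
      \<comment> \<open>Here Y \<le> m^(q/2) enters: it is the condition under which n^(d/q) is at
        most of order sqrt m.\<close>
      have den: "3 ^ ?d * n powr (?d / q) + sqrt (real m) \<le> W * sqrt (real m)"
      proof -
        have "n powr (?d / q) = (n powr d) powr (1/q)" using q by (simp add: powr_powr d_def)
        also have "\<dots> \<le> (2 powr (d + 1) * Y) powr (1/q)" using nY(2) q by (intro powr_mono2) auto
        also have "\<dots> = (2 powr (d + 1)) powr (1/q) * Y powr (1/q)" using Y1 by (simp add: powr_mult)
        also have "\<dots> \<le> 2 powr (d + 1) * sqrt (real m)"
        proof (intro mult_mono)
          have "(d + 1) * (1/q) \<le> (d + 1) * 1" using d0 q by (intro mult_left_mono) auto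
          then show "(2 powr (d + 1)) powr (1/q) \<le> 2 powr (d + 1)" unfolding powr_powr by (intro powr_mono) auto
          have "Y powr (1/q) \<le> (real m powr (q/2)) powr (1/q)" using mY(2) Y1 q by (intro powr_mono2) auto
          also have "\<dots> = sqrt (real m)" using q by (simp add: powr_powr powr_half_sqrt)
          finally show "Y powr (1/q) \<le> sqrt (real m)" .
        qed auto
        finally have "3 ^ ?d * n powr (?d / q) \<le> 3 ^ ?d * (2 powr (d + 1) * sqrt (real m))" by (rule mult_left_mono) simp
        then show ?thesis by (simp add: W_def distrib_right mult.assoc)
      qed
      have num: "c0 * (2 powr (- ((d + 1) * \<bar>A\<bar> / d)) * Y powr (- A / d)) \<le> \<gamma> * n ^ ?d"
      proof -
        have "\<gamma> * n ^ ?d = c0 * n powr (- A)"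
        proof -
          have "n powr (- (r + d - d/p)) * n powr d = n powr (- A)"
            unfolding powr_add[symmetric] by (simp add: A_def)
          then show ?thesis unfolding nd \<gamma>_def by (simp only: mult.assoc)
        qed
        also have "n powr (- A) = (n powr d) powr (- A / d)" using d0 by (simp add: powr_powr)
        also have "2 powr (- ((d + 1) * \<bar>A\<bar> / d)) * Y powr (- A / d) \<le> (n powr d) powr (- A / d)"
        proof (cases "A < 0")
          case True
          have "2 powr (- ((d + 1) * \<bar>A\<bar> / d)) \<le> 2 powr 0" using d0 by (intro powr_mono) auto
          then have "2 powr (- ((d + 1) * \<bar>A\<bar> / d)) * Y powr (- A / d) \<le> 1 * Y powr (- A / d)" by (intro mult_right_mono) auto
          also have "1 * Y powr (- A / d) \<le> (n powr d) powr (- A / d)"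
            unfolding mult_1_left
          proof (rule powr_mono2)
            show "0 \<le> - A / d" using True d0 by (intro divide_nonneg_pos) auto
            show "0 \<le> Y" "Y \<le> n powr d" using nY(1) Y1 by linarith+
          qed
          finally show ?thesis .
        next
          case False
          have "2 powr (- ((d + 1) * \<bar>A\<bar> / d)) * Y powr (- A / d) = (2 powr (d + 1) * Y) powr (- A / d)"
            using False Y1 by (simp add: powr_mult powr_powr)
          also have "\<dots> \<le> (n powr d) powr (- A / d)"
          proof (rule powr_mono2')
            show "- A / d \<le> 0" using False d0 by (intro divide_nonpos_pos) auto
            show "0 < n powr d" using n0 by simp
          qed (rule nY(2))
          finally show ?thesis .
        qed
        then have "c0 * (2 powr (- ((d + 1) * \<bar>A\<bar> / d)) * Y powr (- A / d)) \<le> c0 * (n powr d) powr (- A / d)"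
          using c0 by (intro mult_left_mono) auto
        finally show ?thesis by simp
      qed
      have sm: "0 < sqrt (real m)" using m by simp
      have "C * real m powr e = (c0 * (2 powr (- ((d + 1) * \<bar>A\<bar> / d)) * Y powr (- A / d))) / 2 / (W * sqrt (real m))"
      proof -
        have "real m powr (-1/2) = 1 / sqrt (real m)" using m by (simp add: powr_minus_divide powr_half_sqrt)
        then show ?thesis unfolding Ye[symmetric] C_def by simp
      qed
      also have "\<dots> \<le> (\<gamma> * n ^ ?d) / 2 / (W * sqrt (real m))"
        using W sm by (intro divide_right_mono num) auto
      also have "\<dots> \<le> (\<gamma> * n ^ ?d) / 2 / (3 ^ ?d * n powr (?d / q) + sqrt (real m))"
        using den \<gamma>0 n0 sm W by (intro divide_left_mono mult_pos_pos add_nonneg_pos) auto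
      finally show ?thesis by simp
    qed
    have "ennreal (C * real m powr e) \<le> best_mterm_Bq1 q m ?F"
      unfolding best_mterm_Bq1_def
    proof (intro INF_greatest)
      fix \<Theta> :: "(int^'d) set" and c
      assume "\<Theta> \<in> {\<Theta>. finite \<Theta> \<and> card \<Theta> = m}"
      then have \<Theta>: "finite \<Theta>" "card \<Theta> = m" by auto
      have "ennreal (C * real m powr e) \<le> ennreal (\<gamma> * (real (2^s) ^ ?d / 2) / (3 ^ ?d * real (2^s) powr (?d / q) + sqrt (real m)))"
        using low unfolding n_def by (rule ennreal_leI)
      also have "\<dots> \<le> Bq1_norm q (\<lambda>x. ?F x - trig_poly \<Theta> c x)"
        by (rule Bq1_norm_vp_lower[OF q \<Theta> m2 \<gamma>0 refl])
      finally show "ennreal (C * real m powr e) \<le> Bq1_norm q (\<lambda>x. ?F x - trig_poly \<Theta> c x)" .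
    qed
    also have "\<dots> \<le> best_mterm_class_Bq1 q m (besov_ball k r p \<theta> :: (real^'d \<Rightarrow> complex) set)"
      unfolding best_mterm_class_Bq1_def by (rule SUP_upper[OF Fball])
    finally show ?thesis .
  qed
  with C show ?thesis by (rule that)
qed

text \<open>Both regimes are carried by one exponent e, determined by the value of d e, so that the
  upper and the lower bound need only one proof each.\<close>

lemma asymp_equiv_of_bounds:
  fixes k :: nat and p q r e :: real and \<theta> :: ereal
  defines "d \<equiv> real CARD('d::finite)"
  assumes p: "1 < p" "p \<le> 2" and q: "2 < q" and \<theta>: "1 \<le> \<theta>" and r: "0 < r" and k: "r < real k"
    and B: "0 < r - d * (1/p - 1/q)"
    and e: "(r - d/p < 0 \<and> d * e = - (q/2) * (r - d * (1/p - 1/q))) \<or> (0 < r - d/p \<and> d * e = - (r - d/p) - d / 2)"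
  shows "asymp_equiv_nat (\<lambda>m. real m powr e)
    (\<lambda>m. best_mterm_class_Bq1 q m (besov_ball k r p \<theta> :: (real^'d \<Rightarrow> complex) set))"
proof -
  have k0: "0 < k" using k r by (cases k) auto
  obtain C1 where C1: "0 < C1" "\<And>m. 1 \<le> m \<Longrightarrow>
    ennreal (C1 * real m powr e) \<le> best_mterm_class_Bq1 q m (besov_ball k r p \<theta> :: (real^'d \<Rightarrow> complex) set)"
    by (rule lower_bound[OF p(1) q \<theta> r k e[unfolded d_def]]) (rule that)
  obtain C2 where C2: "0 < C2" "\<And>m. 1 \<le> m \<Longrightarrow>
    best_mterm_class_Bq1 q m (besov_ball k r p \<theta> :: (real^'d \<Rightarrow> complex) set) \<le> ennreal (C2 * real m powr e)"
    by (rule upper_bound[OF p q \<theta> r k0 B[unfolded d_def] e[unfolded d_def]]) (rule that)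
  \<comment> \<open>The sum of the constants is used because \<open>asymp_equiv_nat\<close> demands
    a strict inequality between the two.\<close>
  have "best_mterm_class_Bq1 q m (besov_ball k r p \<theta> :: (real^'d \<Rightarrow> complex) set) \<le> ennreal ((C1 + C2) * real m powr e)"
    if "1 \<le> m" for m
    using C2(2)[OF that] by (rule order_trans) (use C1(1) in \<open>auto intro!: ennreal_leI mult_right_mono\<close>)
  then show ?thesis unfolding asymp_equiv_nat_def
    by (intro exI[of _ C1] exI[of _ "C1 + C2"]) (use C1 C2(1) in auto)
qed

theorem theorem1:
  fixes p q r :: real and \<theta> :: ereal and k :: nat
  assumes "1 < p" "p \<le> 2" "2 < q" "1 \<le> \<theta>" and "0 < r" and "real k > r"
  defines "d \<equiv> real CARD('d::finite)"
  shows "(d * (1/p - 1/q) < r \<and> r < d / p \<longrightarrow>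
           asymp_equiv_nat (\<lambda>m. real m powr (-(q/2) * (r/d - 1/p + 1/q)))
             (\<lambda>m. best_mterm_class_Bq1 q m (besov_ball k r p \<theta> :: (real^'d \<Rightarrow> complex) set)))
       \<and> (d / p < r \<longrightarrow>
           asymp_equiv_nat (\<lambda>m. real m powr (-r/d + 1/p - 1/2))
             (\<lambda>m. best_mterm_class_Bq1 q m (besov_ball k r p \<theta> :: (real^'d \<Rightarrow> complex) set)))"
proof -
  have d0: "0 < d" by (simp add: d_def)
  show ?thesis
  proof (intro conjI impI)
    assume *: "d * (1/p - 1/q) < r \<and> r < d / p"
    have "d * (-(q/2) * (r/d - 1/p + 1/q)) = - (q/2) * (r - d * (1/p - 1/q))"
      using d0 by (simp add: algebra_simps)
    then show "asymp_equiv_nat (\<lambda>m. real m powr (-(q/2) * (r/d - 1/p + 1/q)))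
        (\<lambda>m. best_mterm_class_Bq1 q m (besov_ball k r p \<theta> :: (real^'d \<Rightarrow> complex) set))"
      using * assms(1-6) unfolding d_def by (intro asymp_equiv_of_bounds) auto
  next
    assume *: "d / p < r"
    have "d * (1/p - 1/q) < r"
    proof -
      have "d * (1/p - 1/q) \<le> d * (1/p)" using d0 assms(3) by (intro mult_left_mono) auto
      then show ?thesis using * by simp
    qed
    moreover have "d * (-r/d + 1/p - 1/2) = - (r - d/p) - d / 2"
      using d0 by (simp add: algebra_simps)
    ultimately show "asymp_equiv_nat (\<lambda>m. real m powr (-r/d + 1/p - 1/2))
        (\<lambda>m. best_mterm_class_Bq1 q m (besov_ball k r p \<theta> :: (real^'d \<Rightarrow> complex) set))"
      using * assms(1-6) unfolding d_def by (intro asymp_equiv_of_bounds) auto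
  qed
qed

end
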